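(* Let $(\varphi,R,\alpha,f,g)$ be a contact$-G_2-$structure on a smooth manifold $M^7$. Then $\alpha$ is a contact form on $M$. Moreover, $\xi=\mathrm{Ker}(\alpha)$ is an A-compatible contact structure on $(M,\varphi)$. In particular, if $M$ is closed (compact without boundary), then it does not admit a contact$-G_2-$structure with $d\varphi=0$.
   Context: A $G_2$-structure on a smooth $7$-manifold $M$ is a $3$-form $\varphi$ on $M$ such that for every $p\in M$ the pair $(T_pM,\varphi_p)$ is linearly isomorphic to $(\mathbb{R}^7,\varphi_0)$, where $\varphi_0=e^{123}+e^{145}+e^{167}+e^{246}-e^{257}-e^{347}-e^{356}$ and $e^{ijk}=dx_i\wedge dx_j\wedge dx_k$. Such a $\varphi$ determines a Riemannian metric $g_\varphi$ and a volume form $\mathrm{Vol}$ on $M$ with $(\iota_u\varphi)\wedge(\iota_v\varphi)\wedge\varphi=6\,g_\varphi(u,v)\,\mathrm{Vol}$ for all vector fields $u,v$, where $\iota$ is the interior product. A contact$-G_2-$structure on a smooth $7$-manifold $M$ is a quintuple $(\varphi,R,\alpha,f,g)$ where $\varphi$ is a $G_2$-structure, $R$ is a nowhere-zero vector field, $\alpha$ is a $1$-form on $M$, and $f,g:M\to\mathbb{R}$ are nowhere-zero smooth functions such that (i) $\alpha(R)=f$ and (ii) $d(g\,\alpha)=\iota_R\varphi$. A contact form on a $(2n+1)$-dimensional manifold is a $1$-form $\alpha$ with $\alpha\wedge(d\alpha)^n$ nowhere zero. A co-oriented contact structure is a hyperplane distribution $\xi=\mathrm{Ker}(\alpha)$ for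 a global contact form $\alpha$; any such $\alpha$ is called a contact form for $\xi$. The Reeb vector field of a contact form $\alpha$ is the unique vector field $R$ with $\iota_R d\alpha=0$ and $\alpha(R)=1$. A co-oriented contact structure $\xi$ on $(M,\varphi)$ is A-compatible with $\varphi$ if there exist a vector field $R$ on $M$ and a nowhere-zero function $f:M\to\mathbb{R}$ such that $d\alpha=\iota_R\varphi$ for some contact form $\alpha$ for $\xi$, and $fR$ is the Reeb vector field of some (possibly different) contact form for $\xi$. *)

theory Defs
  imports "HOL-Analysis.Analysis"
begin

section \<open>Smooth maps between open sets of normed spaces\<close>

text \<open>For open \<open>S\<close> and a finite-dimensional domain, \<open>Ck_on k S f\<close> says that \<open>f\<close> is \<open>k\<close> times
  continuously differentiable on \<open>S\<close>; the derivatives are taken one direction at a time.\<close>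

primrec Ck_on :: "nat \<Rightarrow> 'a::real_normed_vector set \<Rightarrow> ('a \<Rightarrow> 'b::real_normed_vector) \<Rightarrow> bool" where
  "Ck_on 0 S f \<longleftrightarrow> continuous_on S f"
| "Ck_on (Suc k) S f \<longleftrightarrow> (\<forall>x\<in>S. f differentiable (at x)) \<and>
     (\<forall>v. Ck_on k S (\<lambda>x. frechet_derivative f (at x) v))"

definition smooth_on :: "'a::real_normed_vector set \<Rightarrow> ('a \<Rightarrow> 'b::real_normed_vector) \<Rightarrow> bool" where
  "smooth_on S f \<longleftrightarrow> (\<forall>k. Ck_on k S f)"


section \<open>Smooth manifolds\<close>

type_synonym ('a, 'n) chart = "'a set \<times> ('a \<Rightarrow> real ^ 'n)"

abbreviation chart_dom :: "('a, 'n) chart \<Rightarrow> 'a set" where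
  "chart_dom c \<equiv> fst c"

abbreviation chart_map :: "('a, 'n) chart \<Rightarrow> 'a \<Rightarrow> real ^ 'n" where
  "chart_map c \<equiv> snd c"

abbreviation chart_range :: "('a, 'n) chart \<Rightarrow> (real ^ 'n) set" where
  "chart_range c \<equiv> snd c ` fst c"

definition chart_inv :: "('a, 'n) chart \<Rightarrow> real ^ 'n \<Rightarrow> 'a" where
  "chart_inv c = inv_into (chart_dom c) (chart_map c)"

definition is_chart :: "'a topology \<Rightarrow> ('a, 'n::finite) chart \<Rightarrow> bool" where
  "is_chart M c \<longleftrightarrow> openin M (chart_dom c) \<and> open (chart_range c) \<and>
     homeomorphic_map (subtopology M (chart_dom c)) (top_of_set (chart_range c)) (chart_map c)"

definition transition :: "('a, 'n) chart \<Rightarrow> ('a, 'n) chart \<Rightarrow> real ^ 'n \<Rightarrow> real ^ 'n" where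
  "transition c c' = chart_map c' \<circ> chart_inv c"

text \<open>The smooth structure is given by any smooth atlas \<open>A\<close>, not necessarily a maximal one. The
  manifold has no boundary and dimension \<open>CARD('n)\<close>; it may be empty or disconnected.\<close>

definition smooth_manifold :: "'a topology \<Rightarrow> ('a, 'n::finite) chart set \<Rightarrow> bool" where
  "smooth_manifold M A \<longleftrightarrow> Hausdorff_space M \<and> second_countable M \<and>
     (\<forall>c\<in>A. is_chart M c) \<and> (\<Union>c\<in>A. chart_dom c) = topspace M \<and>
     (\<forall>c\<in>A. \<forall>c'\<in>A. smooth_on (chart_map c ` (chart_dom c \<inter> chart_dom c')) (transition c c'))"

definition smooth_function :: "('a, 'n::finite) chart set \<Rightarrow> ('a \<Rightarrow> real) \<Rightarrow> bool" where
  "smooth_function A f \<longleftrightarrow> (\<forall>c\<in>A. smooth_on (chart_range c) (f \<circ> chart_inv c))"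


section \<open>Tangent vectors and vector fields\<close>

text \<open>A tangent vector at \<open>p\<close> assigns to each chart around \<open>p\<close> its components in that chart, which
  transform by the Jacobian of the transition maps; at all other arguments it is \<open>0\<close>. The vector
  space operations are pointwise, and \<open>v \<mapsto> v c\<close> identifies the tangent space at \<open>p\<close>
  with \<open>real ^ 'n\<close> for every chart \<open>c\<close> around \<open>p\<close>.\<close>

type_synonym ('a, 'n) tvec = "('a, 'n) chart \<Rightarrow> real ^ 'n"

definition tangent_space :: "('a, 'n::finite) chart set \<Rightarrow> 'a \<Rightarrow> ('a, 'n) tvec set" where
  "tangent_space A p = {v.
     (\<forall>c\<in>A. \<forall>c'\<in>A. p \<in> chart_dom c \<longrightarrow> p \<in> chart_dom c' \<longrightarrow>
        v c' = frechet_derivative (transition c c') (at (chart_map c p)) (v c)) \<and>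
     (\<forall>c. \<not> (c \<in> A \<and> p \<in> chart_dom c) \<longrightarrow> v c = 0)}"

text \<open>The tangent vector at \<open>p\<close> with components \<open>u\<close> in the chart \<open>c\<close>.\<close>

definition chart_vec :: "('a, 'n::finite) chart set \<Rightarrow> ('a, 'n) chart \<Rightarrow> 'a \<Rightarrow> real ^ 'n \<Rightarrow> ('a, 'n) tvec" where
  "chart_vec A c p u = (\<lambda>c'. if c' \<in> A \<and> p \<in> chart_dom c'
     then frechet_derivative (transition c c') (at (chart_map c p)) u else 0)"

definition smooth_vector_field ::
    "'a topology \<Rightarrow> ('a, 'n::finite) chart set \<Rightarrow> ('a \<Rightarrow> ('a, 'n) tvec) \<Rightarrow> bool" where
  "smooth_vector_field M A X \<longleftrightarrow> (\<forall>p\<in>topspace M. X p \<in> tangent_space A p) \<and>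
     (\<forall>c\<in>A. smooth_on (chart_range c) (\<lambda>x. X (chart_inv c x) c))"


section \<open>Differential forms\<close>

text \<open>A \<open>k\<close>-form at a point is evaluated on lists of \<open>k\<close> tangent vectors; its values at other
  lists are irrelevant.\<close>

type_synonym 'v mform = "'v list \<Rightarrow> real"

type_synonym ('a, 'n) dform = "'a \<Rightarrow> ('a, 'n) tvec mform"

definition alternating_form :: "('a, 'n) tvec set \<Rightarrow> nat \<Rightarrow> ('a, 'n::finite) tvec mform \<Rightarrow> bool" where
  "alternating_form T k \<omega> \<longleftrightarrow>
     (\<forall>vs i u w a b. length vs = k \<longrightarrow> set vs \<subseteq> T \<longrightarrow> i < k \<longrightarrow> u \<in> T \<longrightarrow> w \<in> T \<longrightarrow>
        \<omega> (vs[i := (\<lambda>c. a *\<^sub>R u c + b *\<^sub>R w c)]) = a * \<omega> (vs[i := u]) + b * \<omega> (vs[i := w])) \<and>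
     (\<forall>vs i j. length vs = k \<longrightarrow> set vs \<subseteq> T \<longrightarrow> i < j \<longrightarrow> j < k \<longrightarrow> vs ! i = vs ! j \<longrightarrow> \<omega> vs = 0)"

definition local_form ::
    "('a, 'n::finite) chart set \<Rightarrow> ('a, 'n) chart \<Rightarrow> ('a, 'n) dform \<Rightarrow> real ^ 'n \<Rightarrow> (real ^ 'n) mform" where
  "local_form A c \<omega> x us = \<omega> (chart_inv c x) (map (chart_vec A c (chart_inv c x)) us)"

definition smooth_form :: "'a topology \<Rightarrow> ('a, 'n::finite) chart set \<Rightarrow> nat \<Rightarrow> ('a, 'n) dform \<Rightarrow> bool" where
  "smooth_form M A k \<omega> \<longleftrightarrow> (\<forall>p\<in>topspace M. alternating_form (tangent_space A p) k (\<omega> p)) \<and>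
     (\<forall>c\<in>A. \<forall>us. length us = k \<longrightarrow> smooth_on (chart_range c) (\<lambda>x. local_form A c \<omega> x us))"

definition form_eq ::
    "'a topology \<Rightarrow> ('a, 'n::finite) chart set \<Rightarrow> nat \<Rightarrow> ('a, 'n) dform \<Rightarrow> ('a, 'n) dform \<Rightarrow> bool" where
  "form_eq M A k \<omega> \<eta> \<longleftrightarrow>
     (\<forall>p\<in>topspace M. \<forall>vs. length vs = k \<longrightarrow> set vs \<subseteq> tangent_space A p \<longrightarrow> \<omega> p vs = \<eta> p vs)"

definition nowhere_zero_form ::
    "'a topology \<Rightarrow> ('a, 'n::finite) chart set \<Rightarrow> nat \<Rightarrow> ('a, 'n) dform \<Rightarrow> bool" where
  "nowhere_zero_form M A k \<omega> \<longleftrightarrow>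
     (\<forall>p\<in>topspace M. \<exists>vs. length vs = k \<and> set vs \<subseteq> tangent_space A p \<and> \<omega> p vs \<noteq> 0)"

text \<open>Exterior product of a \<open>k\<close>-form and an \<open>l\<close>-form, normalised so that
  \<open>dx\<^sub>1 \<and> \<dots> \<and> dx\<^sub>n\<close> is the determinant.\<close>

definition wedge :: "nat \<Rightarrow> nat \<Rightarrow> 'v mform \<Rightarrow> 'v mform \<Rightarrow> 'v mform" where
  "wedge k l \<omega> \<eta> vs = (\<Sum>\<sigma> | \<sigma> permutes {..<k + l}.
     of_int (sign \<sigma>) * \<omega> (map (\<lambda>i. vs ! \<sigma> i) [0..<k]) * \<eta> (map (\<lambda>i. vs ! \<sigma> i) [k..<k + l]))
     / (fact k * fact l)"

primrec wedge_power :: "nat \<Rightarrow> 'v mform \<Rightarrow> nat \<Rightarrow> 'v mform" where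
  "wedge_power k \<omega> 0 = (\<lambda>vs. 1)"
| "wedge_power k \<omega> (Suc n) = wedge k (k * n) \<omega> (wedge_power k \<omega> n)"

definition interior_product :: "('a \<Rightarrow> ('a, 'n) tvec) \<Rightarrow> ('a, 'n) dform \<Rightarrow> ('a, 'n) dform" where
  "interior_product X \<omega> p vs = \<omega> p (X p # vs)"

text \<open>In a chart, \<open>d\<omega>(u\<^sub>0, \<dots>, u\<^sub>k) = (\<Sum>i. (-1)\<^sup>i D\<^bsub>u\<^sub>i\<^esub> (\<omega>(u\<^sub>0, \<dots>, u\<^sub>i omitted, \<dots>, u\<^sub>k)))\<close> for
  constant vector fields \<open>u\<^sub>i\<close>, which is \<open>\<Sum>I. d\<omega>\<^sub>I \<and> dx\<^sub>I\<close>. On smooth forms the value does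
  not depend on which chart around \<open>p\<close> is chosen.\<close>

definition local_ext_deriv :: "(real ^ 'n \<Rightarrow> (real ^ 'n) mform) \<Rightarrow> real ^ 'n \<Rightarrow> (real ^ 'n::finite) mform" where
  "local_ext_deriv \<omega> x us = (\<Sum>i<length us. (-1) ^ i *
     frechet_derivative (\<lambda>y. \<omega> y (take i us @ drop (Suc i) us)) (at x) (us ! i))"

definition ext_deriv :: "('a, 'n::finite) chart set \<Rightarrow> ('a, 'n) dform \<Rightarrow> ('a, 'n) dform" where
  "ext_deriv A \<omega> p vs = (let c = (SOME c. c \<in> A \<and> p \<in> chart_dom c) in
     local_ext_deriv (local_form A c \<omega>) (chart_map c p) (map (\<lambda>v. v c) vs))"


section \<open>Contact structures\<close>

definition contact_form :: "'a topology \<Rightarrow> ('a, 'n::finite) chart set \<Rightarrow> ('a, 'n) dform \<Rightarrow> bool" where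
  "contact_form M A \<alpha> \<longleftrightarrow> smooth_form M A 1 \<alpha> \<and>
     (\<exists>n. CARD('n) = 2 * n + 1 \<and>
        nowhere_zero_form M A (2 * n + 1)
          (\<lambda>p. wedge 1 (2 * n) (\<alpha> p) (wedge_power 2 (ext_deriv A \<alpha> p) n)))"

definition form_ker :: "('a, 'n::finite) chart set \<Rightarrow> ('a, 'n) dform \<Rightarrow> 'a \<Rightarrow> ('a, 'n) tvec set" where
  "form_ker A \<alpha> p = {v \<in> tangent_space A p. \<alpha> p [v] = 0}"

definition contact_form_for ::
    "'a topology \<Rightarrow> ('a, 'n::finite) chart set \<Rightarrow> ('a \<Rightarrow> ('a, 'n) tvec set) \<Rightarrow> ('a, 'n) dform \<Rightarrow> bool" where
  "contact_form_for M A \<xi> \<alpha> \<longleftrightarrow> contact_form M A \<alpha> \<and> (\<forall>p\<in>topspace M. \<xi> p = form_ker A \<alpha> p)"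

definition contact_structure ::
    "'a topology \<Rightarrow> ('a, 'n::finite) chart set \<Rightarrow> ('a \<Rightarrow> ('a, 'n) tvec set) \<Rightarrow> bool" where
  "contact_structure M A \<xi> \<longleftrightarrow> (\<exists>\<alpha>. contact_form_for M A \<xi> \<alpha>)"

definition is_Reeb_field ::
    "'a topology \<Rightarrow> ('a, 'n::finite) chart set \<Rightarrow> ('a, 'n) dform \<Rightarrow> ('a \<Rightarrow> ('a, 'n) tvec) \<Rightarrow> bool" where
  "is_Reeb_field M A \<alpha> R \<longleftrightarrow> smooth_vector_field M A R \<and>
     form_eq M A 1 (interior_product R (ext_deriv A \<alpha>)) (\<lambda>p vs. 0) \<and>
     (\<forall>p\<in>topspace M. \<alpha> p [R p] = 1)"


section \<open>\<open>G\<^sub>2\<close>-structures\<close>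

definition dx :: "'n \<Rightarrow> (real ^ 'n) mform" where
  "dx i vs = vs ! 0 $ i"

definition dx3 :: "'n \<Rightarrow> 'n \<Rightarrow> 'n \<Rightarrow> (real ^ 'n) mform" where
  "dx3 i j k = wedge 1 2 (dx i) (wedge 1 1 (dx j) (dx k))"

text \<open>In the index type \<open>7\<close> the numeral \<open>7\<close> denotes the same element as \<open>0\<close>, so that
  \<open>1, \<dots>, 7\<close> are its seven distinct elements.\<close>

definition phi0 :: "(real ^ 7) mform" where
  "phi0 vs = dx3 1 2 3 vs + dx3 1 4 5 vs + dx3 1 6 7 vs + dx3 2 4 6 vs
     - dx3 2 5 7 vs - dx3 3 4 7 vs - dx3 3 5 6 vs"

definition G2_structure :: "'a topology \<Rightarrow> ('a, 7) chart set \<Rightarrow> ('a, 7) dform \<Rightarrow> bool" where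
  "G2_structure M A \<phi> \<longleftrightarrow> smooth_form M A 3 \<phi> \<and>
     (\<forall>p\<in>topspace M. \<exists>L. bij_betw L UNIV (tangent_space A p) \<and>
        (\<forall>a b u v. L (a *\<^sub>R u + b *\<^sub>R v) = (\<lambda>c. a *\<^sub>R L u c + b *\<^sub>R L v c)) \<and>
        (\<forall>u v w. \<phi> p [L u, L v, L w] = phi0 [u, v, w]))"

definition contact_G2_structure ::
    "'a topology \<Rightarrow> ('a, 7) chart set \<Rightarrow> ('a, 7) dform \<Rightarrow> ('a \<Rightarrow> ('a, 7) tvec) \<Rightarrow> ('a, 7) dform \<Rightarrow>
     ('a \<Rightarrow> real) \<Rightarrow> ('a \<Rightarrow> real) \<Rightarrow> bool" where
  "contact_G2_structure M A \<phi> R \<alpha> f g \<longleftrightarrow> G2_structure M A \<phi> \<and>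
     smooth_vector_field M A R \<and> (\<forall>p\<in>topspace M. R p \<noteq> (\<lambda>c. 0)) \<and>
     smooth_form M A 1 \<alpha> \<and>
     smooth_function A f \<and> (\<forall>p\<in>topspace M. f p \<noteq> 0) \<and>
     smooth_function A g \<and> (\<forall>p\<in>topspace M. g p \<noteq> 0) \<and>
     (\<forall>p\<in>topspace M. \<alpha> p [R p] = f p) \<and>
     form_eq M A 2 (ext_deriv A (\<lambda>p vs. g p * \<alpha> p vs)) (interior_product R \<phi>)"

definition A_compatible ::
    "'a topology \<Rightarrow> ('a, 7) chart set \<Rightarrow> ('a, 7) dform \<Rightarrow> ('a \<Rightarrow> ('a, 7) tvec set) \<Rightarrow> bool" where
  "A_compatible M A \<phi> \<xi> \<longleftrightarrow> contact_structure M A \<xi> \<and>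
     (\<exists>R f. smooth_vector_field M A R \<and>
        smooth_function A f \<and> (\<forall>p\<in>topspace M. f p \<noteq> 0) \<and>
        (\<exists>\<alpha>. contact_form_for M A \<xi> \<alpha> \<and> form_eq M A 2 (ext_deriv A \<alpha>) (interior_product R \<phi>)) \<and>
        (\<exists>\<beta>. contact_form_for M A \<xi> \<beta> \<and> is_Reeb_field M A \<beta> (\<lambda>p c. f p *\<^sub>R R p c)))"

end

theory Submission
  imports Defs
begin

text \<open>Put \<open>\<beta> = g\<alpha>\<close> and \<open>\<omega> = \<iota>\<^sub>R\<phi> = d\<beta>\<close>. In the octonionic cross product, \<open>\<omega>(u, v) = (R \<times> u) \<bullet> v\<close>,
  so the kernel of \<open>\<omega>\<close> is spanned by \<open>R\<close> and \<open>\<omega>\<^sup>3 \<noteq> 0\<close> on every hyperplane not containing \<open>R\<close>. On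
  the kernel of \<open>\<alpha>\<close> one has \<open>d\<alpha> = \<omega> / g\<close>, hence \<open>\<alpha>\<close> and \<open>\<beta>\<close> are contact forms with the same kernel,
  and \<open>R / (fg)\<close> is the Reeb field of \<open>\<beta>\<close>.

  If \<open>d\<phi> = 0\<close>, then \<open>d(\<beta> \<and> d\<beta> \<and> \<phi>) = \<omega> \<and> \<omega> \<and> \<phi>\<close>, whose contraction with \<open>R\<close> is \<open>\<omega>\<^sup>3\<close>. So a nowhere
  zero form of top degree would be exact. On a compact manifold this contradicts Stokes' theorem, which
  is used for a partition of unity \<open>\<rho>\<^sub>i\<close> subordinate to charts: the integral of each
  \<open>d(\<rho>\<^sub>i\<beta> \<and> d\<beta> \<and> \<phi>)\<close> vanishes in its own chart, and these forms add up to the volume form.\<close>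


section \<open>Skew forms on lists and contraction of exterior products\<close>

text \<open>The manifold carries no chosen orientation, and no integral over it is defined. With
  \<Theta> = \<beta> \<and> d\<beta> \<and> \<phi>, the exact form d\<Theta> is nowhere zero, so the
  sign of its coefficient N orients every chart: multiplied by that sign, the coefficient of
  d(\<rho>_i \<Theta>) becomes a density, whose integrals can be compared between charts. The global
  sum is replaced by a double sum over the partition: the integral of \<rho>_j times the density of
  d(\<rho>_i \<Theta>) may be taken in the chart of i or in that of j. Summed over j first, in the
  chart of i, it is 0; summed over i first, in the chart of j, it is the integral of \<rho>_j |N|,
  which is positive. Each \<rho>_i is differentiated only once, so cutoffs of class C^1 suffice. The
  exterior algebra rests on contraction: \<open>wedge_Cons\<close> extracts the antiderivation rule
  from the sum over permutations, and the product formulas and the Leibniz rule for d follow from it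
  by removing arguments one at a time.\<close>

definition skew :: "nat \<Rightarrow> 'v mform \<Rightarrow> bool" where
  "skew k \<omega> \<longleftrightarrow> (\<forall>xs u v ys. length xs + length ys + 2 = k \<longrightarrow>
     \<omega> (xs @ u # v # ys) = - \<omega> (xs @ v # u # ys))"

lemma skewD: "skew k \<omega> \<Longrightarrow> length xs + length ys + 2 = k \<Longrightarrow> \<omega> (xs @ u # v # ys) = - \<omega> (xs @ v # u # ys)"
  unfolding skew_def by blast

lemma skew_Cons:
  assumes "skew (Suc k) \<omega>"
  shows "skew k (\<lambda>vs. \<omega> (u # vs))"
  unfolding skew_def
proof (intro allI impI)
  fix xs ys :: "'a list" and v w
  assume "length xs + length ys + 2 = k"
  then show "\<omega> (u # xs @ v # w # ys) = - \<omega> (u # xs @ w # v # ys)"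
    using skewD[OF assms, of "u # xs" ys v w] by simp
qed

lemma skew_move:
  assumes "skew k \<omega>" "length xs + length ys + length zs + 1 = k"
  shows "\<omega> (xs @ u # ys @ zs) = (-1) ^ length ys * \<omega> (xs @ ys @ u # zs)"
  using assms(2)
proof (induction ys arbitrary: xs)
  case (Cons y ys)
  have "\<omega> (xs @ u # y # ys @ zs) = - \<omega> (xs @ y # u # ys @ zs)"
    by (rule skewD[OF assms(1)]) (use Cons.prems in simp)
  also have "\<dots> = - ((-1) ^ length ys * \<omega> ((xs @ [y]) @ ys @ u # zs))"
    using Cons.IH[of "xs @ [y]"] Cons.prems by simp
  finally show ?case by simp
qed simp

text \<open>Moving u past ys and v costs |ys| + 1 signs, and moving v back in front of ys costs
  |ys|, so a single sign remains.\<close>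

lemma skew_exchange:
  assumes "skew k \<omega>" "length xs + length ys + length zs + 2 = k"
  shows "\<omega> (xs @ u # ys @ v # zs) = - \<omega> (xs @ v # ys @ u # zs)"
proof -
  have "\<omega> (xs @ u # ys @ v # zs) = (-1) ^ length (ys @ [v]) * \<omega> (xs @ (ys @ [v]) @ u # zs)"
    using skew_move[OF assms(1), of xs "ys @ [v]" zs u] assms(2) by simp
  also have "\<omega> (xs @ (ys @ [v]) @ u # zs) = (-1) ^ length ys * \<omega> (xs @ v # ys @ u # zs)"
    using skew_move[OF assms(1), of xs ys "u # zs" v] assms(2)
    by (simp add: minus_one_power_iff split: if_splits)
  finally show ?thesis
    by (simp add: minus_one_power_iff)
qed

text \<open>Index form of the exchange of two entries: permutations act on positions, whereas
  contractions take lists apart.\<close>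

lemma skew_swap:
  assumes "skew k \<omega>" "i < j" "j < k" "length xs = k"
  shows "\<omega> (xs[i := xs ! j, j := xs ! i]) = - \<omega> xs"
proof -
  define as where "as = take i xs"
  define bs where "bs = take (j - Suc i) (drop (Suc i) xs)"
  define cs where "cs = drop (Suc j) xs"
  have len: "length as = i" "length bs = j - Suc i" "length as + length bs + length cs + 2 = k"
    using assms(2-4) by (auto simp: as_def bs_def cs_def)
  have "xs = as @ xs ! i # drop (Suc i) xs"
    using assms by (simp add: as_def id_take_nth_drop[symmetric])
  moreover have "drop (Suc i) xs = bs @ xs ! j # cs"
  proof -
    have "drop (Suc i) xs ! (j - Suc i) = xs ! j"
      using assms by simp
    moreover have "drop (Suc (j - Suc i)) (drop (Suc i) xs) = cs"
      using assms(2) by (simp add: cs_def)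
    ultimately show ?thesis
      using id_take_nth_drop[of "j - Suc i" "drop (Suc i) xs"] assms by (simp add: bs_def)
  qed
  ultimately have xs: "xs = as @ xs ! i # bs @ xs ! j # cs"
    by simp
  define a b where "a = xs ! i" and "b = xs ! j"
  have xs': "xs = as @ a # bs @ b # cs"
    using xs by (simp add: a_def b_def)
  have "xs[i := b, j := a] = as @ b # bs @ a # cs"
  proof -
    have "j = Suc (length as + length bs)" "i = length as"
      using len assms(2) by auto
    then show ?thesis
      unfolding xs' by (simp add: list_update_append)
  qed
  then show ?thesis
    using skew_exchange[OF assms(1) len(3), of b a] xs' a_def b_def by metis
qed

lemma skew_eq_0:
  assumes "skew k \<omega>" "i < j" "j < k" "length xs = k" "xs ! i = xs ! j"
  shows "\<omega> xs = 0"
proof -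
  have "xs[i := xs ! j, j := xs ! i] = xs"
    using assms(5) by (metis list_update_id)
  then show ?thesis
    using skew_swap[OF assms(1-4)] by simp
qed

lemma skew_swapI:
  assumes "\<And>xs i j. i < j \<Longrightarrow> j < k \<Longrightarrow> length xs = k \<Longrightarrow> \<omega> (xs[i := xs ! j, j := xs ! i]) = - \<omega> xs"
  shows "skew k \<omega>"
  unfolding skew_def
proof (intro allI impI)
  fix xs ys :: "'a list" and u v
  assume *: "length xs + length ys + 2 = k"
  have "(xs @ u # v # ys)[length xs := (xs @ u # v # ys) ! Suc (length xs), Suc (length xs) := (xs @ u # v # ys) ! length xs]
        = xs @ v # u # ys"
    by (simp add: nth_append list_update_append)
  then show "\<omega> (xs @ u # v # ys) = - \<omega> (xs @ v # u # ys)"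
    using assms[of "length xs" "Suc (length xs)" "xs @ u # v # ys"] * by simp
qed

section \<open>Exterior products as signed sums over permutations\<close>

definition wedge_term :: "nat \<Rightarrow> nat \<Rightarrow> 'v mform \<Rightarrow> 'v mform \<Rightarrow> 'v list \<Rightarrow> (nat \<Rightarrow> nat) \<Rightarrow> real" where
  "wedge_term k l \<omega> \<eta> vs \<sigma> = of_int (sign \<sigma>) * \<omega> (map (\<lambda>i. vs ! \<sigma> i) [0..<k]) *
     \<eta> (map (\<lambda>i. vs ! \<sigma> i) [k..<k + l])"

lemma wedge_eq_sum_term:
  "wedge k l \<omega> \<eta> vs = (\<Sum>\<sigma> | \<sigma> permutes {..<k + l}. wedge_term k l \<omega> \<eta> vs \<sigma>) / (fact k * fact l)"
  by (simp add: wedge_def wedge_term_def)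

lemma permutes_imp_permutation: "\<sigma> permutes {..<n::nat} \<Longrightarrow> permutation \<sigma>"
  by (rule permutation_permutes[THEN iffD2]) auto

abbreviation exchange :: "'a \<Rightarrow> 'a \<Rightarrow> 'a \<Rightarrow> 'a" where
  "exchange \<equiv> Transposition.transpose"

lemma nth_swap_transpose:
  assumes "i < length vs" "j < length vs" "p < length vs"
  shows "vs[i := vs ! j, j := vs ! i] ! p = vs ! exchange i j p"
  using assms by (auto simp: nth_list_update Transposition.transpose_def)

text \<open>Swapping two arguments composes every permutation with a transposition on the left,
  which reindexes the sum and flips each sign. The factors themselves may be arbitrary functions on
  lists.\<close>

lemma wedge_skew: "skew (k + l) (wedge k l \<omega> \<eta>)"
proof (rule skew_swapI)
  fix xs :: "'a list" and i j
  assume ij: "i < j" "j < k + l" and len: "length xs = k + l"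
  let ?t = "exchange i j"
  have t: "?t permutes {..<k + l}"
    using ij by (simp add: permutes_swap_id)
  have "wedge_term k l \<omega> \<eta> (xs[i := xs ! j, j := xs ! i]) \<sigma> = - wedge_term k l \<omega> \<eta> xs (?t \<circ> \<sigma>)"
    if \<sigma>: "\<sigma> permutes {..<k + l}" for \<sigma>
  proof -
    have "sign (?t \<circ> \<sigma>) = - sign \<sigma>"
      using ij(1) permutes_imp_permutation[OF \<sigma>] permutes_imp_permutation[OF t]
      by (simp add: sign_compose sign_swap_id)
    moreover have "xs[i := xs ! j, j := xs ! i] ! \<sigma> p = xs ! (?t (\<sigma> p))" if "p < k + l" for p
      using ij len permutes_in_image[OF \<sigma>, of p] that by (intro nth_swap_transpose) auto
    then have "map (\<lambda>p. xs[i := xs ! j, j := xs ! i] ! \<sigma> p) [0..<k] = map (\<lambda>p. xs ! (?t (\<sigma> p))) [0..<k]"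
      "map (\<lambda>p. xs[i := xs ! j, j := xs ! i] ! \<sigma> p) [k..<k + l] = map (\<lambda>p. xs ! (?t (\<sigma> p))) [k..<k + l]"
      by auto
    ultimately show ?thesis
      by (simp only: wedge_term_def o_apply of_int_minus mult_minus_left)
  qed
  then have "(\<Sum>\<sigma> | \<sigma> permutes {..<k + l}. wedge_term k l \<omega> \<eta> (xs[i := xs ! j, j := xs ! i]) \<sigma>)
      = - (\<Sum>\<sigma> | \<sigma> permutes {..<k + l}. wedge_term k l \<omega> \<eta> xs (?t \<circ> \<sigma>))"
    by (simp add: sum_negf[symmetric])
  also have "\<dots> = - (\<Sum>\<sigma> | \<sigma> permutes {..<k + l}. wedge_term k l \<omega> \<eta> xs \<sigma>)"
    using setum_permutations_compose_left[OF t, of "wedge_term k l \<omega> \<eta> xs"] by simp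
  finally show "wedge k l \<omega> \<eta> (xs[i := xs ! j, j := xs ! i]) = - wedge k l \<omega> \<eta> xs"
    by (simp add: wedge_eq_sum_term)
qed

text \<open>Turns a permutation of the positions of \<open>us\<close> into one of the positions of
  \<open>u # us\<close> that leaves u in front.\<close>

definition lift_perm :: "(nat \<Rightarrow> nat) \<Rightarrow> nat \<Rightarrow> nat" where
  "lift_perm \<tau> i = (case i of 0 \<Rightarrow> 0 | Suc j \<Rightarrow> Suc (\<tau> j))"

lemma lift_perm_simps [simp]: "lift_perm \<tau> 0 = 0" "lift_perm \<tau> (Suc j) = Suc (\<tau> j)"
  by (simp_all add: lift_perm_def)

lemma lift_perm_permutes:
  assumes "\<tau> permutes {..<n}"
  shows "lift_perm \<tau> permutes {1..n}"
proof (rule bij_imp_permutes)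
  have "inj (lift_perm \<tau>)"
  proof (rule injI)
    fix x y assume "lift_perm \<tau> x = lift_perm \<tau> y"
    then show "x = y"
      using injD[OF permutes_inj[OF assms]] by (cases x; cases y) auto
  qed
  moreover have "lift_perm \<tau> ` {1..n} \<subseteq> {1..n}"
  proof
    fix y assume "y \<in> lift_perm \<tau> ` {1..n}"
    then obtain j where "y = Suc (\<tau> j)" "j < n"
      by (auto simp: lift_perm_def split: nat.splits)
    then show "y \<in> {1..n}"
      using permutes_in_image[OF assms, of j] by auto
  qed
  ultimately show "bij_betw (lift_perm \<tau>) {1..n} {1..n}"
    using endo_inj_surj[of "{1..n}" "lift_perm \<tau>"] inj_on_subset[of "lift_perm \<tau>" UNIV "{1..n}"]
    by (simp add: bij_betw_def)
  show "lift_perm \<tau> x = x" if "x \<notin> {1..n}" for x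
    using that permutes_not_in[OF assms] by (cases x) auto
qed

text \<open>Lifting respects composition and sends transpositions to transpositions, so a
  factorisation of \<tau> lifts factor by factor.\<close>

lemma sign_lift_perm:
  assumes "\<tau> permutes {..<n}"
  shows "sign (lift_perm \<tau>) = sign \<tau>"
  using assms finite_lessThan
proof (induction rule: permutes_induct)
  case id
  have "lift_perm id = id"
    by (auto simp: lift_perm_def split: nat.splits)
  then show ?case by (simp only: sign_id)
next
  case (swap a b p)
  have "lift_perm (exchange a b \<circ> p) = exchange (Suc a) (Suc b) \<circ> lift_perm p"
    by (auto simp: lift_perm_def Transposition.transpose_def fun_eq_iff split: nat.splits)
  moreover have "permutation (lift_perm p)"
    using lift_perm_permutes[OF swap.hyps(4)] permutation_permutes by blast
  ultimately show ?case
    using swap.IH permutes_imp_permutation[OF swap.hyps(4)]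
    by (simp only: sign_compose sign_swap_id permutation_swap_id nat.inject)
qed

lemma sum_permutes_lift:
  "(\<Sum>q | q permutes {1..n}. f q) = (\<Sum>\<tau> | \<tau> permutes {..<n}. f (lift_perm \<tau>))"
proof (rule sum.reindex_bij_betw[symmetric])
  have inj: "inj_on lift_perm {\<tau>. \<tau> permutes {..<n}}"
    by (rule inj_onI) (metis Suc_inject ext lift_perm_simps(2))
  have "lift_perm ` {\<tau>. \<tau> permutes {..<n}} = {q. q permutes {1..n}}"
  \<comment> \<open>Surjectivity by counting: both sets have n! elements.\<close>
  proof (rule card_subset_eq)
    show "finite {q. q permutes {1..n}}" by (simp add: finite_permutations)
    show "lift_perm ` {\<tau>. \<tau> permutes {..<n}} \<subseteq> {q. q permutes {1..n}}"
      using lift_perm_permutes by blast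
    show "card (lift_perm ` {\<tau>. \<tau> permutes {..<n}}) = card {q. q permutes {1..n}}"
      using card_image[OF inj] card_permutations[of "{..<n}" n] card_permutations[of "{1..n}" n] by simp
  qed
  then show "bij_betw lift_perm {\<tau>. \<tau> permutes {..<n}} {q. q permutes {1..n}}"
    using inj by (simp add: bij_betw_def)
qed

text \<open>Each permutation is uniquely q composed with the transposition of 0 and m, where q fixes
  0; then \<sigma> m = 0, so m is the slot that receives the first vector of the list. Passing to
  inverses moves the transposition from the left of q to its right.\<close>

lemma sum_permutes_by_position:
  fixes F :: "(nat \<Rightarrow> nat) \<Rightarrow> real"
  shows "(\<Sum>\<sigma> | \<sigma> permutes {..<Suc n}. F \<sigma>) = (\<Sum>m\<in>{..<Suc n}. \<Sum>q | q permutes {1..n}. F (q \<circ> exchange 0 m))"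
proof -
  have eq: "insert 0 {1..n} = {..<Suc n}" by auto
  have "(\<Sum>\<sigma> | \<sigma> permutes {..<Suc n}. F \<sigma>) = (\<Sum>\<sigma> | \<sigma> permutes insert 0 {1..n}. F (inv \<sigma>))"
    by (simp only: eq sum_permutations_inverse[of F])
  also have "\<dots> = (\<Sum>m\<in>insert 0 {1..n}. \<Sum>q | q permutes {1..n}. F (inv (exchange 0 m \<circ> q)))"
    by (rule sum_over_permutations_insert) auto
  also have "\<dots> = (\<Sum>m\<in>insert 0 {1..n}. \<Sum>q | q permutes {1..n}. F (inv q \<circ> exchange 0 m))"
    by (intro sum.cong refl) (auto simp: o_inv_distrib permutes_bij)
  also have "\<dots> = (\<Sum>m\<in>insert 0 {1..n}. \<Sum>q | q permutes {1..n}. F (q \<circ> exchange 0 m))"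
    by (rule sum.cong[OF refl], rule sum_permutations_inverse[symmetric])
  finally show ?thesis by (simp only: eq)
qed

text \<open>Both slots belong to \<omega>, so the sign of the permutation and the value of \<omega>
  flip together. The next lemma is the same for \<eta>.\<close>

lemma wedge_term_swap_left:
  assumes "skew k \<omega>" "\<sigma> permutes {..<k + l}" "a < b" "b < k"
  shows "wedge_term k l \<omega> \<eta> vs (\<sigma> \<circ> exchange a b) = wedge_term k l \<omega> \<eta> vs \<sigma>"
proof -
  let ?xs = "map (\<lambda>i. vs ! \<sigma> i) [0..<k]"
  have "map (\<lambda>i. vs ! \<sigma> (exchange a b i)) [0..<k] = ?xs[a := ?xs ! b, b := ?xs ! a]"
    using assms(3,4) by (intro nth_equalityI) (auto simp: nth_list_update Transposition.transpose_def)
  then have "\<omega> (map (\<lambda>i. vs ! \<sigma> (exchange a b i)) [0..<k]) = - \<omega> ?xs"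
    using skew_swap[OF assms(1,3,4), of ?xs] by simp
  moreover have "map (\<lambda>i. vs ! \<sigma> (exchange a b i)) [k..<k + l] = map (\<lambda>i. vs ! \<sigma> i) [k..<k + l]"
    using assms(3,4) by (auto simp: Transposition.transpose_def)
  moreover have "sign (\<sigma> \<circ> exchange a b) = - sign \<sigma>"
    using assms(3) permutes_imp_permutation[OF assms(2)]
    by (simp add: sign_compose permutation_swap_id sign_swap_id)
  ultimately show ?thesis
    by (simp only: wedge_term_def o_apply of_int_minus mult_minus_left mult_minus_right minus_minus)
qed

lemma wedge_term_swap_right:
  assumes "skew l \<eta>" "\<sigma> permutes {..<k + l}" "k \<le> a" "a < b" "b < k + l"
  shows "wedge_term k l \<omega> \<eta> vs (\<sigma> \<circ> exchange a b) = wedge_term k l \<omega> \<eta> vs \<sigma>"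
proof -
  let ?xs = "map (\<lambda>i. vs ! \<sigma> i) [k..<k + l]"
  have "map (\<lambda>i. vs ! \<sigma> (exchange a b i)) [k..<k + l] = ?xs[a - k := ?xs ! (b - k), b - k := ?xs ! (a - k)]"
    using assms(3-5) by (intro nth_equalityI) (auto simp: nth_list_update Transposition.transpose_def)
  then have "\<eta> (map (\<lambda>i. vs ! \<sigma> (exchange a b i)) [k..<k + l]) = - \<eta> ?xs"
    using skew_swap[OF assms(1), of "a - k" "b - k" ?xs] assms(3-5) by simp
  moreover have "map (\<lambda>i. vs ! \<sigma> (exchange a b i)) [0..<k] = map (\<lambda>i. vs ! \<sigma> i) [0..<k]"
    using assms(3,4) by (auto simp: Transposition.transpose_def)
  moreover have "sign (\<sigma> \<circ> exchange a b) = - sign \<sigma>"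
    using assms(4) permutes_imp_permutation[OF assms(2)]
    by (simp add: sign_compose permutation_swap_id sign_swap_id)
  ultimately show ?thesis
    by (simp only: wedge_term_def o_apply of_int_minus mult_minus_left mult_minus_right minus_minus)
qed

lemma upt_shift: "[Suc a..<Suc b] = map Suc [a..<b]"
  by (simp add: map_Suc_upt)

lemma wedge_term_first:
  assumes "\<tau> permutes {..<k + l}"
  shows "wedge_term (Suc k) l \<omega> \<eta> (u # us) (lift_perm \<tau>) = wedge_term k l (\<lambda>vs. \<omega> (u # vs)) \<eta> us \<tau>"
proof -
  have "map (\<lambda>i. (u # us) ! lift_perm \<tau> i) [0..<Suc k] = u # map (\<lambda>i. us ! \<tau> i) [0..<k]"
    by (simp add: upt_conv_Cons upt_shift del: upt_Suc)
  moreover have "map (\<lambda>i. (u # us) ! lift_perm \<tau> i) [Suc k..<Suc k + l] = map (\<lambda>i. us ! \<tau> i) [k..<k + l]"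
    by (simp only: add_Suc upt_shift) simp
  ultimately show ?thesis
    by (simp add: wedge_term_def sign_lift_perm[OF assms])
qed

text \<open>Here u occupies slot k, the first slot of \<eta>, and the vector displaced by the
  transposition sits in slot 0. Returning it to the end of the arguments of \<omega> costs k - 1
  signs, and the transposition costs one more. For k = 0 the transposition is the identity and no
  sign arises.\<close>

lemma wedge_term_second:
  assumes "\<tau> permutes {..<k + l}" "skew k \<omega>"
  shows "wedge_term k (Suc l) \<omega> \<eta> (u # us) (lift_perm \<tau> \<circ> exchange 0 k)
    = (-1) ^ k * wedge_term k l \<omega> (\<lambda>vs. \<eta> (u # vs)) us \<tau>"
proof -
  let ?t = "exchange 0 k"
  have "permutation (lift_perm \<tau>)"
    using lift_perm_permutes[OF assms(1)] permutation_permutes by blast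
  then have sg: "sign (lift_perm \<tau> \<circ> ?t) = (if k = 0 then 1 else -1) * sign \<tau>"
    by (simp add: sign_compose permutation_swap_id sign_swap_id sign_lift_perm[OF assms(1)])
  have "map (\<lambda>i. (u # us) ! lift_perm \<tau> (?t i)) [Suc k..<Suc (k + l)] = map (\<lambda>i. us ! \<tau> i) [k..<k + l]"
    by (auto simp only: upt_shift map_map o_def intro!: map_cong) (auto simp: Transposition.transpose_def)
  then have r: "map (\<lambda>i. (u # us) ! lift_perm \<tau> (?t i)) [k..<k + Suc l] = u # map (\<lambda>i. us ! \<tau> i) [k..<k + l]"
    by (simp add: upt_conv_Cons del: upt_Suc)
  have l: "(if k = 0 then 1 else -1) * \<omega> (map (\<lambda>i. (u # us) ! lift_perm \<tau> (?t i)) [0..<k])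
      = (-1) ^ k * \<omega> (map (\<lambda>i. us ! \<tau> i) [0..<k])"
  proof (cases k)
    case (Suc k')
    have "map (\<lambda>i. (u # us) ! lift_perm \<tau> (?t i)) [Suc 0..<Suc k'] = map (\<lambda>i. us ! \<tau> i) [0..<k']"
      unfolding Suc by (auto simp only: upt_shift map_map o_def intro!: map_cong) (auto simp: Transposition.transpose_def)
    then have "map (\<lambda>i. (u # us) ! lift_perm \<tau> (?t i)) [0..<k] = us ! \<tau> k' # map (\<lambda>i. us ! \<tau> i) [0..<k']"
      by (simp add: upt_conv_Cons Suc del: upt_Suc)
    then show ?thesis
      using skew_move[OF assms(2), of "[]" "map (\<lambda>i. us ! \<tau> i) [0..<k']" "[]" "us ! \<tau> k'"] Suc by simp
  qed simp
  show ?thesis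
    unfolding wedge_term_def using sg l r by (auto simp: algebra_simps)
qed

text \<open>The antiderivation rule for contractions: the permutations in the exterior product are sorted by
  the slot that receives \<open>u\<close>.\<close>

lemma wedge_Cons:
  assumes "skew k \<omega>" "skew l \<eta>" "Suc (length us) = k + l"
  shows "wedge k l \<omega> \<eta> (u # us) = (if k = 0 then 0 else wedge (k - 1) l (\<lambda>vs. \<omega> (u # vs)) \<eta> us)
    + (if l = 0 then 0 else (-1) ^ k * wedge k (l - 1) \<omega> (\<lambda>vs. \<eta> (u # vs)) us)"
proof -
  define n where "n = length us"
  have n: "Suc n = k + l" using assms(3) n_def by simp
  define F where "F = wedge_term k l \<omega> \<eta> (u # us)"
  \<comment> \<open>G m collects the permutations that put u into slot m. It depends only on which
    factor owns the slot, leaving k equal terms and l equal terms; the multiplicities k and l turn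
    k! l! into (k-1)! l! and k! (l-1)!.\<close>
  define G where "G m = (\<Sum>q | q permutes {1..n}. F (q \<circ> exchange 0 m))" for m
  have perm: "q permutes {..<k + l}" if "q permutes {1..n}" for q
    using that by (rule permutes_subset) (use n in auto)
  have Gl: "G m = G 0" if "m < k" for m
  proof (cases "m = 0")
    case False
    then show ?thesis
      using wedge_term_swap_left[OF assms(1) perm] that by (auto simp: G_def F_def intro!: sum.cong)
  qed simp
  have Gr: "G m = G k" if "k \<le> m" "m < k + l" for m
  proof (cases "m = k")
    case False
    then have mk: "k < m" using that by simp
    have t: "exchange 0 m permutes {..<k + l}"
      using that n by (intro permutes_swap_id) auto
    have "G m = (\<Sum>q | q permutes {1..n}. F ((q \<circ> exchange 0 m) \<circ> exchange k m))"
      unfolding G_def F_def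
      using wedge_term_swap_right[OF assms(2) permutes_compose[OF t perm] order_refl mk that(2)]
      by (intro sum.cong) auto
    \<comment> \<open>For k > 0 the transposition of k and m fixes 0 and is absorbed into q; for k =
      0 the two transpositions cancel.\<close>
    also have "\<dots> = (\<Sum>q | q permutes {1..n}. F ((q \<circ> (if k = 0 then id else exchange k m)) \<circ> exchange 0 k))"
    proof -
      have "exchange 0 m \<circ> exchange k m = (if k = 0 then id else exchange k m) \<circ> exchange 0 k"
        using mk by (auto simp: fun_eq_iff Transposition.transpose_def)
      then show ?thesis by (simp only: comp_assoc)
    qed
    also have "\<dots> = G k"
    proof (cases "k = 0")
      case False
      then have "exchange k m permutes {1..n}"
        using mk n that by (intro permutes_swap_id) auto
      from sum_permutations_compose_right[OF this, of "\<lambda>q. F (q \<circ> exchange 0 k)"]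
      show ?thesis using False by (simp add: G_def)
    qed (simp add: G_def)
    finally show ?thesis .
  qed simp
  have "(\<Sum>\<sigma> | \<sigma> permutes {..<k + l}. F \<sigma>) = (\<Sum>m\<in>{..<k + l}. G m)"
    using sum_permutes_by_position[of F n] n by (simp add: G_def)
  also have "\<dots> = (\<Sum>m\<in>{..<k}. G m) + (\<Sum>m\<in>{k..<k + l}. G m)"
    by (subst sum.union_disjoint[symmetric]) (auto intro!: sum.cong)
  also have "\<dots> = k * G 0 + l * G k"
  proof -
    have "(\<Sum>m\<in>{..<k}. G m) = (\<Sum>m\<in>{..<k}. G 0)" "(\<Sum>m\<in>{k..<k + l}. G m) = (\<Sum>m\<in>{k..<k + l}. G k)"
      by (rule sum.cong, rule refl, rule Gl, simp) (rule sum.cong, rule refl, rule Gr, auto)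
    then show ?thesis by simp
  qed
  finally have S: "wedge k l \<omega> \<eta> (u # us) = (k * G 0 + l * G k) / (fact k * fact l)"
    by (simp add: wedge_eq_sum_term F_def)
  have 1: "k * G 0 / (fact k * fact l) = wedge (k - 1) l (\<lambda>vs. \<omega> (u # vs)) \<eta> us" if "k \<noteq> 0"
  proof -
    obtain k' where k: "k = Suc k'" using \<open>k \<noteq> 0\<close> not0_implies_Suc by blast
    then have n': "n = k' + l" using n by simp
    have "G 0 = (\<Sum>\<tau> | \<tau> permutes {..<k' + l}. wedge_term k' l (\<lambda>vs. \<omega> (u # vs)) \<eta> us \<tau>)"
      unfolding G_def F_def k Transposition.transpose_same comp_id sum_permutes_lift n' by (intro sum.cong refl wedge_term_first) auto
    then show ?thesis
      by (simp add: k wedge_eq_sum_term)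
  qed
  have 2: "l * G k / (fact k * fact l) = (-1) ^ k * wedge k (l - 1) \<omega> (\<lambda>vs. \<eta> (u # vs)) us" if "l \<noteq> 0"
  proof -
    obtain l' where l: "l = Suc l'" using \<open>l \<noteq> 0\<close> not0_implies_Suc by blast
    then have n': "n = k + l'" using n by simp
    have "G k = (\<Sum>\<tau> | \<tau> permutes {..<k + l'}. (-1) ^ k * wedge_term k l' \<omega> (\<lambda>vs. \<eta> (u # vs)) us \<tau>)"
      unfolding G_def F_def l sum_permutes_lift n' by (intro sum.cong refl wedge_term_second assms) auto
    then show ?thesis
      by (simp add: l wedge_eq_sum_term sum_distrib_left[symmetric] del: of_nat_Suc)
  qed
  show ?thesis
    using S 1 2 by (cases "k = 0"; cases "l = 0"; simp add: add_divide_distrib)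
qed

text \<open>Forms are controlled only on lists of their own degree, and sometimes only on vectors of
  a special set such as a kernel. Factors therefore are replaced under these restrictions and not as
  functions.\<close>

lemma wedge_cong:
  assumes "\<And>us. length us = k \<Longrightarrow> set us \<subseteq> set vs \<Longrightarrow> \<omega> us = \<omega>' us"
    and "\<And>us. length us = l \<Longrightarrow> set us \<subseteq> set vs \<Longrightarrow> \<eta> us = \<eta>' us"
    and "length vs = k + l"
  shows "wedge k l \<omega> \<eta> vs = wedge k l \<omega>' \<eta>' vs"
  unfolding wedge_def
proof (intro arg_cong2[where f = "(/)"] refl sum.cong)
  fix \<sigma> assume "\<sigma> \<in> {\<sigma>. \<sigma> permutes {..<k + l}}"
  then have "\<sigma> i < k + l" if "i < k + l" for i
    using permutes_in_image[of \<sigma> "{..<k + l}" i] that by simp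
  then have "set (map (\<lambda>i. vs ! \<sigma> i) [0..<k]) \<subseteq> set vs" "set (map (\<lambda>i. vs ! \<sigma> i) [k..<k + l]) \<subseteq> set vs"
    using assms(3) by auto
  then show "of_int (sign \<sigma>) * \<omega> (map (\<lambda>i. vs ! \<sigma> i) [0..<k]) * \<eta> (map (\<lambda>i. vs ! \<sigma> i) [k..<k + l]) =
    of_int (sign \<sigma>) * \<omega>' (map (\<lambda>i. vs ! \<sigma> i) [0..<k]) * \<eta>' (map (\<lambda>i. vs ! \<sigma> i) [k..<k + l])"
    using assms(1)[of "map (\<lambda>i. vs ! \<sigma> i) [0..<k]"] assms(2)[of "map (\<lambda>i. vs ! \<sigma> i) [k..<k + l]"] by simp
qed

lemma wedge_map:
  assumes "length vs = k + l"
  shows "wedge k l \<omega> \<eta> (map f vs) = wedge k l (\<lambda>us. \<omega> (map f us)) (\<lambda>us. \<eta> (map f us)) vs"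
  unfolding wedge_def
proof (intro arg_cong2[where f = "(/)"] refl sum.cong)
  fix \<sigma> assume "\<sigma> \<in> {\<sigma>. \<sigma> permutes {..<k + l}}"
  then have "\<sigma> i < k + l" if "i < k + l" for i
    using permutes_in_image[of \<sigma> "{..<k + l}" i] that by simp
  then have "map (\<lambda>i. map f vs ! \<sigma> i) [0..<k] = map f (map (\<lambda>i. vs ! \<sigma> i) [0..<k])"
    "map (\<lambda>i. map f vs ! \<sigma> i) [k..<k + l] = map f (map (\<lambda>i. vs ! \<sigma> i) [k..<k + l])"
    using assms by auto
  then show "of_int (sign \<sigma>) * \<omega> (map (\<lambda>i. map f vs ! \<sigma> i) [0..<k]) * \<eta> (map (\<lambda>i. map f vs ! \<sigma> i) [k..<k + l]) =
    of_int (sign \<sigma>) * \<omega> (map f (map (\<lambda>i. vs ! \<sigma> i) [0..<k])) * \<eta> (map f (map (\<lambda>i. vs ! \<sigma> i) [k..<k + l]))"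
    by (simp only:)
qed

lemma wedge_lincomb_left:
  "wedge k l (\<lambda>vs. a * \<omega> vs + b * \<omega>' vs) \<eta> us = a * wedge k l \<omega> \<eta> us + b * wedge k l \<omega>' \<eta> us"
  by (simp add: wedge_def sum_divide_distrib sum_distrib_left sum.distrib algebra_simps add_divide_distrib)

lemma wedge_lincomb_right:
  "wedge k l \<omega> (\<lambda>vs. a * \<eta> vs + b * \<eta>' vs) us = a * wedge k l \<omega> \<eta> us + b * wedge k l \<omega> \<eta>' us"
  by (simp add: wedge_def sum_divide_distrib sum_distrib_left sum.distrib algebra_simps add_divide_distrib)

lemma wedge_zero_left: "wedge k l (\<lambda>vs. 0) \<eta> us = 0"
  by (simp add: wedge_def)

lemma wedge_zero_right: "wedge k l \<omega> (\<lambda>vs. 0) us = 0"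
  by (simp add: wedge_def)

lemma skew_less_2: "k < 2 \<Longrightarrow> skew k \<omega>"
  unfolding skew_def by linarith

lemma wedge_zero_degree_left:
  assumes "skew l \<eta>" "length us = l"
  shows "wedge 0 l \<omega> \<eta> us = \<omega> [] * \<eta> us"
  using assms
proof (induction us arbitrary: l \<eta>)
  case Nil
  then show ?case by (simp add: wedge_def)
next
  case (Cons u us)
  have "skew (length us) (\<lambda>vs. \<eta> (u # vs))"
    using Cons.prems by (intro skew_Cons) simp
  then show ?case
    using Cons.IH[of "length us" "\<lambda>vs. \<eta> (u # vs)"] Cons.prems wedge_Cons[of 0 \<omega> l \<eta> us u] skew_less_2[of 0 \<omega>] by auto
qed

lemma wedge_zero_degree_right:
  assumes "skew k \<omega>" "length us = k"
  shows "wedge k 0 \<omega> \<eta> us = \<omega> us * \<eta> []"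
  using assms
proof (induction us arbitrary: k \<omega>)
  case Nil
  then show ?case by (simp add: wedge_def)
next
  case (Cons u us)
  have "skew (length us) (\<lambda>vs. \<omega> (u # vs))"
    using Cons.prems by (intro skew_Cons) simp
  then show ?case
    using Cons.IH[of "length us" "\<lambda>vs. \<omega> (u # vs)"] Cons.prems wedge_Cons[of k \<omega> 0 \<eta> us u] skew_less_2[of 0 \<eta>] by auto
qed

section \<open>Exterior products of low degree and the cube of a 2-form\<close>

lemma skew_2_Cons: "skew 2 \<omega> \<Longrightarrow> skew 1 (\<lambda>vs. \<omega> (u # vs))" and skew_3_Cons: "skew 3 \<omega> \<Longrightarrow> skew 2 (\<lambda>vs. \<omega> (u # vs))"
  and skew_4_Cons: "skew 4 \<omega> \<Longrightarrow> skew 3 (\<lambda>vs. \<omega> (u # vs))"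
  using skew_Cons[of 1 \<omega> u] skew_Cons[of 2 \<omega> u] skew_Cons[of 3 \<omega> u] by (simp_all add: eval_nat_numeral)

lemma skew_2_iff: "skew 2 \<omega> \<longleftrightarrow> (\<forall>u v. \<omega> [u, v] = - \<omega> [v, u])"
proof
  assume \<omega>: "skew 2 \<omega>"
  have "\<omega> [u, v] = - \<omega> [v, u]" for u v
    using skewD[OF \<omega>, of "[]" "[]" u v] by simp
  then show "\<forall>u v. \<omega> [u, v] = - \<omega> [v, u]" by blast
next
  assume *: "\<forall>u v. \<omega> [u, v] = - \<omega> [v, u]"
  have "\<omega> (xs @ u # v # ys) = - \<omega> (xs @ v # u # ys)" if "length xs + length ys + 2 = 2" for xs u v ys
    using that *[rule_format, of u v] by simp
  then show "skew 2 \<omega>" unfolding skew_def by blast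
qed

lemma wedge_1_1: "wedge 1 1 \<omega> \<eta> [a, b] = \<omega> [a] * \<eta> [b] - \<omega> [b] * \<eta> [a]"
  by (simp add: wedge_Cons skew_less_2 wedge_zero_degree_left wedge_zero_degree_right)

lemma wedge_1_2:
  assumes "skew 2 \<eta>"
  shows "wedge 1 2 \<omega> \<eta> [a, b, c] = \<omega> [a] * \<eta> [b, c] - \<omega> [b] * \<eta> [a, c] + \<omega> [c] * \<eta> [a, b]"
  using assms wedge_1_1[of \<omega> "\<lambda>vs. \<eta> (a # vs)" b c]
  by (simp add: wedge_Cons[of "Suc 0" _ 2] skew_less_2 wedge_zero_degree_left)

lemma wedge_1_3:
  assumes "skew 3 \<eta>"
  shows "wedge 1 3 \<omega> \<eta> [a, b, c, d] = \<omega> [a] * \<eta> [b, c, d] - \<omega> [b] * \<eta> [a, c, d] + \<omega> [c] * \<eta> [a, b, d] - \<omega> [d] * \<eta> [a, b, c]"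
  using assms wedge_1_2[OF skew_3_Cons[OF assms], of \<omega> a b c d]
  by (simp add: wedge_Cons[of "Suc 0" _ 3] skew_less_2 wedge_zero_degree_left)

lemma wedge_2_2:
  assumes "skew 2 \<omega>" "skew 2 \<eta>"
  shows "wedge 2 2 \<omega> \<eta> [a, b, c, d] = \<omega> [a, b] * \<eta> [c, d] - \<omega> [a, c] * \<eta> [b, d] + \<omega> [a, d] * \<eta> [b, c]
    + \<omega> [b, c] * \<eta> [a, d] - \<omega> [b, d] * \<eta> [a, c] + \<omega> [c, d] * \<eta> [a, b]"
proof -
  have "wedge 2 1 \<omega> (\<lambda>vs. \<eta> (a # vs)) [b, c, d] = \<omega> [b, c] * \<eta> [a, d] - \<omega> [b, d] * \<eta> [a, c] + \<omega> [c, d] * \<eta> [a, b]"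
    using assms wedge_1_1[of "\<lambda>vs. \<omega> (b # vs)" "\<lambda>vs. \<eta> (a # vs)" c d]
    by (simp add: wedge_Cons[of 2 _ "Suc 0"] skew_2_Cons wedge_zero_degree_right skew_less_2)
  then show ?thesis
    using assms wedge_1_2[OF assms(2), of "\<lambda>vs. \<omega> (a # vs)" b c d]
    by (simp add: wedge_Cons[of 2 _ 2])
qed

lemma wedge_2_3:
  assumes "skew 2 \<omega>" "skew 3 \<eta>"
  shows "wedge 2 3 \<omega> \<eta> [a, b, c, d, e] = \<omega> [a, b] * \<eta> [c, d, e] - \<omega> [a, c] * \<eta> [b, d, e] + \<omega> [a, d] * \<eta> [b, c, e]
     - \<omega> [a, e] * \<eta> [b, c, d] + wedge 2 2 \<omega> (\<lambda>vs. \<eta> (a # vs)) [b, c, d, e]"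
  using assms wedge_1_3[OF assms(2), of "\<lambda>vs. \<omega> (a # vs)" b c d e]
  by (simp add: wedge_Cons[of 2 _ 3])

lemma wedge_power_2_3:
  assumes "skew 2 \<omega>"
  shows "length vs = 6 \<Longrightarrow> wedge_power 2 \<omega> 3 vs = wedge 2 4 \<omega> (wedge 2 2 \<omega> \<omega>) vs"
proof -
  assume len: "length vs = 6"
  have 1: "wedge 2 0 \<omega> (\<lambda>vs. 1) us = \<omega> us" if "length us = 2" for us
    using wedge_zero_degree_right[OF assms that] by simp
  have 2: "wedge 2 2 \<omega> (wedge 2 0 \<omega> (\<lambda>vs. 1)) us = wedge 2 2 \<omega> \<omega> us" if "length us = 4" for us
    by (rule wedge_cong) (use 1 that in auto)
  have "wedge 2 4 \<omega> (wedge 2 2 \<omega> (wedge 2 0 \<omega> (\<lambda>vs. 1))) vs = wedge 2 4 \<omega> (wedge 2 2 \<omega> \<omega>) vs"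
    by (rule wedge_cong) (use 2 len in auto)
  then show ?thesis by (simp add: eval_nat_numeral)
qed

text \<open>The three planes are mutually \<omega>-orthogonal, so only the products of the three
  values on the planes survive. The factor 6 = 3! counts the ways of distributing the planes among
  the three factors of \<omega>^3.\<close>

lemma wedge_power_2_3_symplectic:
  assumes \<omega>: "skew 2 \<omega>"
    and 0: "\<omega> [a, c] = 0" "\<omega> [a, d] = 0" "\<omega> [a, e] = 0" "\<omega> [a, f] = 0" "\<omega> [b, c] = 0" "\<omega> [b, d] = 0"
      "\<omega> [b, e] = 0" "\<omega> [b, f] = 0" "\<omega> [c, e] = 0" "\<omega> [c, f] = 0" "\<omega> [d, e] = 0" "\<omega> [d, f] = 0"
  shows "wedge_power 2 \<omega> 3 [a, b, c, d, e, f] = 6 * \<omega> [a, b] * \<omega> [c, d] * \<omega> [e, f]"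
proof -
  define \<eta> where "\<eta> = wedge 2 2 \<omega> \<omega>"
  have \<eta>: "skew 4 \<eta>" using wedge_skew[of 2 2 \<omega> \<omega>] by (simp add: \<eta>_def)
  have "wedge 1 4 (\<lambda>vs. \<omega> (a # vs)) \<eta> [b, c, d, e, f] = \<omega> [a, b] * \<eta> [c, d, e, f]
      - wedge 1 3 (\<lambda>vs. \<omega> (a # vs)) (\<lambda>vs. \<eta> (b # vs)) [c, d, e, f]"
    using \<eta> by (simp add: wedge_Cons[of "Suc 0" _ 4] skew_less_2 wedge_zero_degree_left)
  moreover have "wedge 1 3 (\<lambda>vs. \<omega> (a # vs)) (\<lambda>vs. \<eta> (b # vs)) [c, d, e, f] = 0"
    using 0 wedge_1_3[OF skew_4_Cons[OF \<eta>], of "\<lambda>vs. \<omega> (a # vs)" b c d e f] by simp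
  moreover have "wedge 2 3 \<omega> (\<lambda>vs. \<eta> (a # vs)) [b, c, d, e, f] = wedge 2 2 \<omega> (\<lambda>vs. \<eta> (a # b # vs)) [c, d, e, f]"
    using 0 by (simp add: wedge_2_3[OF \<omega> skew_4_Cons[OF \<eta>]])
  moreover have "wedge 2 2 \<omega> (\<lambda>vs. \<eta> (a # b # vs)) [c, d, e, f] = \<omega> [c, d] * \<eta> [a, b, e, f] + \<omega> [e, f] * \<eta> [a, b, c, d]"
    using 0 by (simp add: wedge_2_2[OF \<omega> skew_3_Cons[OF skew_4_Cons[OF \<eta>]]])
  moreover have "\<eta> [c, d, e, f] = 2 * \<omega> [c, d] * \<omega> [e, f]" "\<eta> [a, b, e, f] = 2 * \<omega> [a, b] * \<omega> [e, f]"
    "\<eta> [a, b, c, d] = 2 * \<omega> [a, b] * \<omega> [c, d]"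
    using 0 by (simp_all add: \<eta>_def wedge_2_2[OF \<omega> \<omega>])
  moreover have "wedge 2 4 \<omega> \<eta> [a, b, c, d, e, f] = wedge 1 4 (\<lambda>vs. \<omega> (a # vs)) \<eta> [b, c, d, e, f]
      + wedge 2 3 \<omega> (\<lambda>vs. \<eta> (a # vs)) [b, c, d, e, f]"
    using \<omega> \<eta> by (simp add: wedge_Cons[of 2 _ 4])
  ultimately show ?thesis
    using wedge_power_2_3[OF \<omega>, of "[a, b, c, d, e, f]"] by (simp add: \<eta>_def)
qed

text \<open>Linearity is asked in the first slot only, since skewness carries every slot there. It
  is kept apart from \<open>skew\<close> because the permutation arguments apply to lists over any
  type, in particular to tangent vectors.\<close>

definition alt :: "nat \<Rightarrow> 'v::real_vector mform \<Rightarrow> bool" where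
  "alt k \<omega> \<longleftrightarrow> skew k \<omega> \<and> (\<forall>us. Suc (length us) = k \<longrightarrow> linear (\<lambda>u. \<omega> (u # us)))"

lemma alt_skew: "alt k \<omega> \<Longrightarrow> skew k \<omega>"
  by (simp add: alt_def)

lemma alt_linear: "alt k \<omega> \<Longrightarrow> Suc (length us) = k \<Longrightarrow> linear (\<lambda>u. \<omega> (u # us))"
  by (simp add: alt_def)

lemma alt_lincomb:
  assumes "alt k \<omega>" "Suc (length us) = k"
  shows "\<omega> ((a *\<^sub>R u + b *\<^sub>R v) # us) = a * \<omega> (u # us) + b * \<omega> (v # us)"
  using linear_add[OF alt_linear[OF assms]] linear_scale[OF alt_linear[OF assms]] by simp

lemma alt_linear_at:
  assumes "alt k \<omega>" "Suc (length xs + length ys) = k"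
  shows "linear (\<lambda>u. \<omega> (xs @ u # ys))"
proof -
  have "\<omega> (xs @ u # ys) = (-1) ^ length xs * \<omega> (u # xs @ ys)" for u
    using skew_move[OF alt_skew[OF assms(1)], of "[]" xs ys u] assms(2) by (simp add: minus_one_power_iff)
  moreover have "linear (\<lambda>u. (-1) ^ length xs * \<omega> (u # xs @ ys))"
    using linear_compose_scale_right[OF alt_linear[OF assms(1), of "xs @ ys"], of "(-1) ^ length xs"] assms(2) by simp
  ultimately show ?thesis by simp
qed

lemma alt_Cons:
  assumes "alt (Suc k) \<omega>"
  shows "alt k (\<lambda>vs. \<omega> (u # vs))"
  unfolding alt_def
proof (intro conjI allI impI)
  show "skew k (\<lambda>vs. \<omega> (u # vs))"
    by (rule skew_Cons[OF alt_skew[OF assms]])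
  fix us :: "'a list" assume "Suc (length us) = k"
  then show "linear (\<lambda>v. \<omega> (u # v # us))"
    using alt_linear_at[OF assms, of "[u]" us] by simp
qed

text \<open>By \<open>wedge_Cons\<close>, linearity in the first slot reduces to linearity of the
  contraction of each factor.\<close>

lemma wedge_alt:
  assumes "alt k \<omega>" "alt l \<eta>"
  shows "alt (k + l) (wedge k l \<omega> \<eta>)"
  unfolding alt_def
proof (intro conjI allI impI)
  show "skew (k + l) (wedge k l \<omega> \<eta>)" by (rule wedge_skew)
  fix us :: "'a list" assume us: "Suc (length us) = k + l"
  have k: "wedge (k - 1) l (\<lambda>vs. \<omega> ((a *\<^sub>R u + b *\<^sub>R v) # vs)) \<eta> us
      = a * wedge (k - 1) l (\<lambda>vs. \<omega> (u # vs)) \<eta> us + b * wedge (k - 1) l (\<lambda>vs. \<omega> (v # vs)) \<eta> us"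
    if "k \<noteq> 0" for a b u v
  proof -
    have "wedge (k - 1) l (\<lambda>vs. \<omega> ((a *\<^sub>R u + b *\<^sub>R v) # vs)) \<eta> us
      = wedge (k - 1) l (\<lambda>vs. a * \<omega> (u # vs) + b * \<omega> (v # vs)) \<eta> us"
    proof (rule wedge_cong)
      fix vs :: "'a list" assume "length vs = k - 1"
      then have "Suc (length vs) = k" using that by simp
      then show "\<omega> ((a *\<^sub>R u + b *\<^sub>R v) # vs) = a * \<omega> (u # vs) + b * \<omega> (v # vs)"
        by (rule alt_lincomb[OF assms(1)])
    qed (use us that in auto)
    then show ?thesis by (simp add: wedge_lincomb_left)
  qed
  have l: "wedge k (l - 1) \<omega> (\<lambda>vs. \<eta> ((a *\<^sub>R u + b *\<^sub>R v) # vs)) us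
      = a * wedge k (l - 1) \<omega> (\<lambda>vs. \<eta> (u # vs)) us + b * wedge k (l - 1) \<omega> (\<lambda>vs. \<eta> (v # vs)) us"
    if "l \<noteq> 0" for a b u v
  proof -
    have "wedge k (l - 1) \<omega> (\<lambda>vs. \<eta> ((a *\<^sub>R u + b *\<^sub>R v) # vs)) us
      = wedge k (l - 1) \<omega> (\<lambda>vs. a * \<eta> (u # vs) + b * \<eta> (v # vs)) us"
    proof (rule wedge_cong)
      fix vs :: "'a list" assume "length vs = l - 1"
      then have "Suc (length vs) = l" using that by simp
      then show "\<eta> ((a *\<^sub>R u + b *\<^sub>R v) # vs) = a * \<eta> (u # vs) + b * \<eta> (v # vs)"
        by (rule alt_lincomb[OF assms(2)])
    qed (use us that in auto)
    then show ?thesis by (simp add: wedge_lincomb_right)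
  qed
  have lin: "wedge k l \<omega> \<eta> ((a *\<^sub>R u + b *\<^sub>R v) # us) = a * wedge k l \<omega> \<eta> (u # us) + b * wedge k l \<omega> \<eta> (v # us)" for a b u v
    unfolding wedge_Cons[OF alt_skew[OF assms(1)] alt_skew[OF assms(2)] us]
    using k[of a u b v] l[of a u b v]
    by (cases "k = 0"; cases "l = 0") (simp_all add: algebra_simps)
  show "linear (\<lambda>u. wedge k l \<omega> \<eta> (u # us))"
    using lin[of 1 _ 1 _] lin[of _ _ 0 0] by (intro linearI) auto
qed

text \<open>The sign is left undetermined, because the lemma serves only to transport the vanishing
  of a value.\<close>

lemma skew_mset:
  assumes "skew n \<omega>" "mset us = mset vs" "length vs = n"
  shows "\<omega> us = \<omega> vs \<or> \<omega> us = - \<omega> vs"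
  using assms
proof (induction us arbitrary: \<omega> vs n)
  case (Cons a us)
  then obtain ys zs where vs: "vs = ys @ a # zs"
    by (metis list.set_intros(1) set_mset_mset split_list)
  then have "mset us = mset (ys @ zs)" using Cons.prems(2) by simp
  moreover have "skew (length (ys @ zs)) (\<lambda>v. \<omega> (a # v))"
    using Cons.prems vs by (intro skew_Cons) simp
  ultimately have "\<omega> (a # us) = \<omega> (a # ys @ zs) \<or> \<omega> (a # us) = - \<omega> (a # ys @ zs)"
    using Cons.IH[of _ "\<lambda>v. \<omega> (a # v)" "ys @ zs"] by blast
  moreover have "\<omega> (a # ys @ zs) = (-1) ^ length ys * \<omega> vs"
    using skew_move[OF Cons.prems(1), of "[]" ys zs a] Cons.prems(3) vs by simp
  ultimately show ?case by (auto simp: minus_one_power_iff)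
qed simp

section \<open>Forms of top degree and determinants\<close>

lemma linear_axis_expand:
  fixes f :: "real ^ 'n::finite \<Rightarrow> real"
  assumes "linear f"
  shows "f w = (\<Sum>i\<in>UNIV. w $ i * f (axis i 1))"
proof -
  have "w = (\<Sum>i\<in>UNIV. w $ i *\<^sub>R axis i 1)"
    by (simp add: basis_expansion flip: scalar_mult_eq_scaleR)
  then show ?thesis
    using linear_sum[OF assms, of "\<lambda>i. w $ i *\<^sub>R axis i 1" UNIV] linear_scale[OF assms] by simp
qed

lemmas alt_expand = linear_axis_expand[OF alt_linear]

text \<open>Multilinearity reduces everything to lists of standard basis vectors. Such a list either
  repeats a vector, where \<omega> vanishes, or rearranges the one basis on which \<omega> is
  assumed to vanish.\<close>

lemma alt_eq_0:
  fixes \<omega> :: "(real ^ 'n::finite) mform"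
  assumes alt: "alt n \<omega>" and ix: "distinct ix" "set ix = UNIV" "length ix = n"
    and 0: "\<omega> (map (\<lambda>i. axis i 1) ix) = 0" and len: "length vs = n"
  shows "\<omega> vs = 0"
proof -
  \<comment> \<open>\<open>ws\<close> holds the arguments still to be expanded, \<open>us\<close>
    those already replaced by basis vectors.\<close>
  have "\<omega> (ws @ us) = 0" if "length ws + length us = n" "set us \<subseteq> range (\<lambda>i. axis i 1)" for ws us
    using that
  proof (induction ws arbitrary: us)
    case Nil
    then obtain js where us: "us = map (\<lambda>i. axis i 1) js"
      by (metis (no_types, lifting) ex_map_conv imageE subsetD)
    show ?case
    proof (cases "distinct js")
      case True
      have "card (set js) = CARD('n)" "length js = n"
        using True us Nil ix distinct_card[of ix] distinct_card[of js] by auto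
      then have "set js = UNIV" by (simp add: card_eq_UNIV_imp_eq_UNIV)
      then have "mset js = mset ix"
        using True ix set_eq_iff_mset_eq_distinct by metis
      then have "mset us = mset (map (\<lambda>i. axis i 1) ix)" by (simp add: us)
      from skew_mset[OF alt_skew[OF alt] this] show ?thesis
        using 0 ix by simp
    next
      case False
      then obtain i j where "i < j" "j < length js" "js ! i = js ! j"
        using distinct_conv_nth[of js] by (metis linorder_neqE_nat)
      then show ?thesis
        using skew_eq_0[OF alt_skew[OF alt], of i j us] Nil us by simp
    qed
  next
    case (Cons w ws)
    have "\<omega> (axis i 1 # ws @ us) = 0" for i
      using skew_move[OF alt_skew[OF alt], of "[]" ws us "axis i 1"] Cons.IH[of "axis i 1 # us"] Cons.prems by simp
    moreover have "\<omega> (w # ws @ us) = (\<Sum>i\<in>UNIV. w $ i * \<omega> (axis i 1 # ws @ us))"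
      using Cons.prems by (intro alt_expand[OF alt]) simp
    ultimately show ?case by simp
  qed
  from this[of vs "[]"] show ?thesis using len by simp
qed

text \<open>Rows of a matrix are indexed by the type \<open>'n\<close>, arguments of a form by list
  positions; the enumeration \<open>ix\<close> translates between the two.\<close>

definition det_form :: "'n list \<Rightarrow> (real ^ 'n::finite) mform" where
  "det_form ix vs = det (\<chi> i. vs ! (THE p. p < length ix \<and> ix ! p = i))"

lemma alt_det_form:
  fixes ix :: "'n::finite list"
  assumes ix: "distinct ix" "set ix = UNIV" "length ix = n"
  shows "alt n (det_form ix)"
proof -
  define idx where "idx i = (THE p. p < length ix \<and> ix ! p = i)" for i
  have idx_nth: "idx (ix ! p) = p" if "p < n" for p
    unfolding idx_def using that ix nth_eq_iff_index_eq by (intro the_equality) auto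
  have nth_idx: "ix ! idx i = i \<and> idx i < n" for i
  proof -
    have "i \<in> set ix" using ix by simp
    then obtain p where "p < n" "ix ! p = i" using ix by (metis in_set_conv_nth)
    then show ?thesis using idx_nth by auto
  qed
  have df: "det_form ix vs = det (\<chi> i. vs ! idx i)" for vs :: "(real ^ 'n) list"
    by (simp add: det_form_def idx_def)
  show ?thesis
    unfolding alt_def
  proof (intro conjI allI impI)
    show "skew n (det_form ix)"
    proof (rule skew_swapI)
      fix xs :: "(real ^ 'n) list" and a b assume ab: "a < b" "b < n" "length xs = n"
      let ?t = "exchange (ix ! a) (ix ! b)"
      have "xs[a := xs ! b, b := xs ! a] ! idx i = (\<chi> i. xs ! idx i) $ ?t i" for i
        using ab idx_nth nth_idx[of i] ix by (auto simp: nth_list_update Transposition.transpose_def)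
      then have "det_form ix (xs[a := xs ! b, b := xs ! a]) = det (\<chi> i. (\<chi> i. xs ! idx i) $ ?t i)"
        by (simp add: df)
      also have "\<dots> = of_int (sign ?t) * det (\<chi> i. xs ! idx i)"
        by (rule det_permute_rows) (simp add: permutes_swap_id)
      finally show "det_form ix (xs[a := xs ! b, b := xs ! a]) = - det_form ix xs"
        using ab ix nth_eq_iff_index_eq[of ix a b] by (simp add: df sign_swap_id)
    qed
    fix us :: "(real ^ 'n) list" assume us: "Suc (length us) = n"
    define k where "k = ix ! 0"
    have "(u # us) ! idx i = (if i = k then u else us ! (idx i - 1))" for u i
      using idx_nth[of 0] nth_idx[of i] us by (cases "idx i") (auto simp: k_def)
    then have "det_form ix (u # us) = det (\<chi> i. if i = k then u else us ! (idx i - 1))" for u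
      by (simp add: df)
    then show "linear (\<lambda>u. det_form ix (u # us))"
      using det_row_add[of k "\<lambda>_. v" "\<lambda>_. w" "\<lambda>i. us ! (idx i - 1)" for v w]
        det_row_mul[of k c "\<lambda>_. v" "\<lambda>i. us ! (idx i - 1)" for c v]
      by (intro linearI) (simp_all only: scalar_mult_eq_scaleR real_scaleR_def)
  qed
qed

text \<open>Every top form is a multiple of \<open>det_form\<close>: the difference \<psi> below
  vanishes on the standard basis, hence everywhere. Evaluation at the images of the basis vectors
  gives the determinant.\<close>

lemma alt_top_linear:
  fixes \<omega> :: "(real ^ 'n::finite) mform"
  assumes alt: "alt n \<omega>" and ix: "distinct ix" "set ix = UNIV" "length ix = n" and f: "linear f"
  shows "\<omega> (map (\<lambda>i. f (axis i 1)) ix) = det (matrix f) * \<omega> (map (\<lambda>i. axis i 1) ix)"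
proof -
  let ?bs = "map (\<lambda>i. axis i (1::real)) ix"
  have eval: "det_form ix (map h ix) = det (\<chi> i. h i)" for h
  proof -
    have "map h ix ! (THE p. p < length ix \<and> ix ! p = i) = h i" for i
    proof -
      have "i \<in> set ix" using ix by simp
      then obtain p where p: "p < length ix" "ix ! p = i" by (metis in_set_conv_nth)
      then have "(THE p. p < length ix \<and> ix ! p = i) = p"
        using ix nth_eq_iff_index_eq by (intro the_equality) auto
      then show ?thesis using p by simp
    qed
    then show ?thesis by (simp add: det_form_def)
  qed
  have "det_form ix ?bs = det (mat 1 :: real ^ 'n ^ 'n)"
    unfolding eval by (rule arg_cong[where f = det]) (simp add: vec_eq_iff axis_def mat_def)
  then have one: "det_form ix ?bs = 1" by simp
  \<comment> \<open>The images f(e_i) form the rows here, whereas \<open>matrix f\<close> has them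
    as columns.\<close>
  have "det_form ix (map (\<lambda>i. f (axis i 1)) ix) = det (transpose (matrix f))"
    unfolding eval by (rule arg_cong[where f = det]) (simp add: vec_eq_iff matrix_def transpose_def)
  then have d: "det_form ix (map (\<lambda>i. f (axis i 1)) ix) = det (matrix f)" by simp
  define \<psi> where "\<psi> vs = \<omega> vs - \<omega> ?bs * det_form ix vs" for vs
  have "alt n \<psi>"
    unfolding alt_def
  proof (intro conjI allI impI)
    show "skew n \<psi>"
      unfolding skew_def
    proof (intro allI impI)
      fix xs ys :: "(real ^ 'n) list" and u v assume "length xs + length ys + 2 = n"
      then show "\<psi> (xs @ u # v # ys) = - \<psi> (xs @ v # u # ys)"
        using skewD[OF alt_skew[OF alt], of xs ys u v] skewD[OF alt_skew[OF alt_det_form[OF ix]], of xs ys u v]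
        by (simp add: \<psi>_def)
    qed
    fix us :: "(real ^ 'n) list" assume us: "Suc (length us) = n"
    have "linear (\<lambda>u. \<omega> ?bs *\<^sub>R det_form ix (u # us))"
      by (rule linear_compose_scale_right[OF alt_linear[OF alt_det_form[OF ix] us]])
    from linear_compose_sub[OF alt_linear[OF alt us] this]
    show "linear (\<lambda>u. \<psi> (u # us))" by (simp add: \<psi>_def)
  qed
  then have "\<psi> (map (\<lambda>i. f (axis i 1)) ix) = 0"
    by (rule alt_eq_0[OF _ ix]) (simp_all add: \<psi>_def one ix)
  then show ?thesis using d by (simp add: \<psi>_def)
qed


section \<open>Calculus of continuously differentiable maps\<close>

abbreviation fderiv :: "('a::real_normed_vector \<Rightarrow> 'b::real_normed_vector) \<Rightarrow> 'a \<Rightarrow> 'a \<Rightarrow> 'b" where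
  "fderiv f x \<equiv> frechet_derivative f (at x)"

lemma frechet_derivative_eq: "(f has_derivative f') (at x) \<Longrightarrow> fderiv f x = f'"
  using frechet_derivative_at by metis

lemma has_derivative_frechet: "f differentiable (at x) \<Longrightarrow> (f has_derivative fderiv f x) (at x)"
  by (simp add: frechet_derivative_works)

lemma frechet_derivative_cong_open:
  assumes "open S" "x \<in> S" "\<And>y. y \<in> S \<Longrightarrow> f y = g y"
  shows "fderiv f x = fderiv g x"
proof -
  have "(f has_derivative f') (at x) \<longleftrightarrow> (g has_derivative f') (at x)" for f'
    using has_derivative_transform_within_open[OF _ assms(1,2), of f f' UNIV g]
      has_derivative_transform_within_open[OF _ assms(1,2), of g f' UNIV f] assms(3) by auto
  then show ?thesis unfolding frechet_derivative_def by simp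
qed

lemma differentiable_cong_open:
  assumes "open S" "x \<in> S" "\<And>y. y \<in> S \<Longrightarrow> f y = g y" "g differentiable (at x)"
  shows "f differentiable (at x)"
  using assms has_derivative_transform_within_open[of g _ x UNIV S f] unfolding differentiable_def by metis

lemma Ck_on_cong:
  assumes "open S" "\<And>y. y \<in> S \<Longrightarrow> f y = g y"
  shows "Ck_on k S f \<longleftrightarrow> Ck_on k S g"
  using assms(2)
proof (induction k arbitrary: f g)
  case 0
  then show ?case using continuous_on_cong[OF refl, of S f g] by simp
next
  case (Suc k)
  have "Ck_on k S (\<lambda>x. fderiv f x v) \<longleftrightarrow> Ck_on k S (\<lambda>x. fderiv g x v)" for v
  proof (rule Suc.IH)
    fix y assume "y \<in> S"
    then show "fderiv f y v = fderiv g y v"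
      by (rule arg_cong[where f = "\<lambda>h. h v", OF frechet_derivative_cong_open[OF assms(1)]]) (rule Suc.prems)
  qed
  moreover have "f differentiable (at x) \<longleftrightarrow> g differentiable (at x)" if "x \<in> S" for x
    using differentiable_cong_open[OF assms(1) that, of f g] differentiable_cong_open[OF assms(1) that, of g f] Suc.prems by auto
  ultimately show ?case by simp
qed

lemma Ck_on_subset: "Ck_on k S f \<Longrightarrow> T \<subseteq> S \<Longrightarrow> Ck_on k T f"
  by (induction k arbitrary: f) (auto intro: continuous_on_subset)

lemma Ck_on_Suc_imp: "Ck_on (Suc k) S f \<Longrightarrow> Ck_on k S f"
proof (induction k arbitrary: f)
  case 0
  then show ?case
    by (auto intro!: continuous_at_imp_continuous_on differentiable_imp_continuous_within)
next
  case (Suc k)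
  then show ?case by (metis Ck_on.simps(2))
qed

lemma Ck_on_le: "Ck_on k S f \<Longrightarrow> j \<le> k \<Longrightarrow> Ck_on j S f"
  by (induction k) (use Ck_on_Suc_imp le_Suc_eq in blast)+

lemma Ck_on_continuous: "Ck_on k S f \<Longrightarrow> continuous_on S f"
  using Ck_on_le[of k S f 0] by simp

lemma Ck_on_const: "Ck_on k S (\<lambda>x. c)"
  by (induction k arbitrary: c) (auto simp: frechet_derivative_const)

lemma Ck_on_Un:
  assumes "open S" "open T" "Ck_on k S f" "Ck_on k T f"
  shows "Ck_on k (S \<union> T) f"
  using assms(3,4)
  by (induction k arbitrary: f) (auto intro: continuous_on_open_Un[OF assms(1,2)])

lemma Ck_on_add:
  assumes "open S" "Ck_on k S f" "Ck_on k S g"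
  shows "Ck_on k S (\<lambda>x. f x + g x)"
  using assms(2,3)
proof (induction k arbitrary: f g)
  case 0
  then show ?case by (simp add: continuous_on_add)
next
  case (Suc k)
  have "fderiv (\<lambda>x. f x + g x) x v = fderiv f x v + fderiv g x v"
    if "x \<in> S" for x v
    using frechet_derivative_eq[OF has_derivative_add[of f "fderiv f x" "at x" g "fderiv g x"]]
      that Suc.prems by (simp add: has_derivative_frechet)
  then have "Ck_on k S (\<lambda>x. fderiv (\<lambda>x. f x + g x) x v)" for v
    by (subst Ck_on_cong[OF assms(1), where g = "\<lambda>x. fderiv f x v + fderiv g x v"])
      (use Suc in auto)
  then show ?case using Suc.prems by simp
qed

lemma Ck_on_sum:
  assumes "open S" "\<And>i. i \<in> I \<Longrightarrow> Ck_on k S (f i)"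
  shows "Ck_on k S (\<lambda>x. \<Sum>i\<in>I. f i x)"
  using assms(2)
  by (induction I rule: infinite_finite_induct) (auto simp: Ck_on_const intro!: Ck_on_add[OF assms(1)])

lemma frechet_derivative_scaleR:
  fixes f :: "'a::real_normed_vector \<Rightarrow> real"
  assumes "f differentiable (at x)" "g differentiable (at x)"
  shows "fderiv (\<lambda>x. f x *\<^sub>R g x) x v
    = f x *\<^sub>R fderiv g x v + fderiv f x v *\<^sub>R g x"
  by (simp add: frechet_derivative_eq[OF has_derivative_scaleR[OF has_derivative_frechet[OF assms(1)] has_derivative_frechet[OF assms(2)]]])

lemma Ck_on_scaleR:
  fixes f :: "'a::real_normed_vector \<Rightarrow> real"
  assumes "open S" "Ck_on k S f" "Ck_on k S g"
  shows "Ck_on k S (\<lambda>x. f x *\<^sub>R g x)"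
  using assms(2,3)
proof (induction k arbitrary: f g)
  case 0
  then show ?case by (simp add: continuous_on_scaleR)
next
  case (Suc k)
  have fg: "Ck_on k S f" "Ck_on k S g"
    using Suc.prems Ck_on_Suc_imp by blast+
  have "Ck_on k S (\<lambda>x. f x *\<^sub>R fderiv g x v + fderiv f x v *\<^sub>R g x)" for v
    using Suc.prems by (intro Ck_on_add[OF assms(1)] Suc.IH fg) auto
  then have "Ck_on k S (\<lambda>x. fderiv (\<lambda>x. f x *\<^sub>R g x) x v)" for v
    by (subst Ck_on_cong[OF assms(1) frechet_derivative_scaleR]) (use Suc.prems in auto)
  moreover have "(\<lambda>x. f x *\<^sub>R g x) differentiable (at x)" if "x \<in> S" for x
    using that Suc.prems
    by (intro differentiableI[OF has_derivative_scaleR[OF has_derivative_frechet has_derivative_frechet]]) auto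
  ultimately show ?case by simp
qed

lemma Ck_on_mult:
  fixes f g :: "'a::real_normed_vector \<Rightarrow> real"
  assumes "open S" "Ck_on k S f" "Ck_on k S g"
  shows "Ck_on k S (\<lambda>x. f x * g x)"
  using Ck_on_scaleR[OF assms] by simp

lemma Ck_on_inverse:
  fixes f :: "'a::real_normed_vector \<Rightarrow> real"
  assumes "open S" "Ck_on k S f" "\<And>x. x \<in> S \<Longrightarrow> f x \<noteq> 0"
  shows "Ck_on k S (\<lambda>x. inverse (f x))"
  using assms(2)
proof (induction k)
  case 0
  then show ?case using assms(3) by (simp add: continuous_on_inverse)
next
  case (Suc k)
  have der: "((\<lambda>x. inverse (f x)) has_derivative (\<lambda>v. - (inverse (f x) * fderiv f x v * inverse (f x)))) (at x)"
    if "x \<in> S" for x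
    using that Suc.prems by (intro Deriv.has_derivative_inverse assms(3) has_derivative_frechet) auto
  have "Ck_on k S (\<lambda>x. inverse (f x))"
    using Suc Ck_on_Suc_imp by blast
  then have "Ck_on k S (\<lambda>x. (-1) * ((inverse (f x) * fderiv f x v) * inverse (f x)))" for v
    using Suc.prems by (intro Ck_on_mult[OF assms(1)] Ck_on_const) auto
  then have "Ck_on k S (\<lambda>x. fderiv (\<lambda>x. inverse (f x)) x v)" for v
    by (subst Ck_on_cong[OF assms(1), where g = "\<lambda>x. (-1) * ((inverse (f x) * fderiv f x v) * inverse (f x))"])
      (simp_all add: frechet_derivative_eq[OF der])
  then show ?case
    using der unfolding Ck_on.simps differentiable_def by blast
qed

text \<open>Used to read a cutoff function of class C^1 in another chart.\<close>

lemma Ck_on_1_compose: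
  fixes F :: "'a::real_normed_vector \<Rightarrow> real ^ 'n::finite" and f :: "real ^ 'n \<Rightarrow> real"
  assumes "open S" "Ck_on 1 S F" "Ck_on 1 T f" "F ` S \<subseteq> T"
  shows "Ck_on 1 S (\<lambda>x. f (F x))"
proof -
  have d: "f differentiable (at (F x))" "F differentiable (at x)" if "x \<in> S" for x
    using assms that by auto
  have der: "((\<lambda>x. f (F x)) has_derivative (\<lambda>v. fderiv f (F x) (fderiv F x v))) (at x)" if "x \<in> S" for x
    using has_derivative_compose[OF has_derivative_frechet[OF d(2)] has_derivative_frechet[OF d(1)]] that by simp
  \<comment> \<open>\<open>Ck_on\<close> controls derivatives in fixed directions, but the direction
    \<open>fderiv F x v\<close> moves with x. Expansion in the standard basis separates the two
    dependences.\<close>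
  have ex: "fderiv f (F x) w = (\<Sum>i\<in>UNIV. w $ i * fderiv f (F x) (axis i 1))" if "x \<in> S" for x w
    by (rule linear_axis_expand[OF linear_frechet_derivative[OF d(1)[OF that]]])
  have "continuous_on S (\<lambda>x. \<Sum>i\<in>UNIV. fderiv F x v $ i * fderiv f (F x) (axis i 1))" for v
  proof (intro continuous_on_sum continuous_on_mult continuous_on_component)
    show "continuous_on S (\<lambda>x. fderiv F x v)" using assms(2) by simp
    show "continuous_on S (\<lambda>x. fderiv f (F x) (axis i 1))" for i
      using continuous_on_compose2[of T "\<lambda>x. fderiv f x (axis i 1)" S F] assms Ck_on_continuous[OF assms(2)] by simp
  qed
  then have "continuous_on S (\<lambda>x. fderiv (\<lambda>x. f (F x)) x v)" for v
    by (subst continuous_on_cong[OF refl, where g = "\<lambda>x. \<Sum>i\<in>UNIV. fderiv F x v $ i * fderiv f (F x) (axis i 1)"])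
      (simp_all add: frechet_derivative_eq[OF der] flip: ex)
  then show ?thesis
    using der by (auto simp: differentiable_def)
qed

section \<open>Symmetry of second derivatives\<close>

lemma frechet_derivative_line:
  fixes g :: "'a::real_normed_vector \<Rightarrow> real"
  assumes "g differentiable (at (p + s *\<^sub>R w))"
  shows "((\<lambda>s. g (p + s *\<^sub>R w)) has_real_derivative fderiv g (p + s *\<^sub>R w) w) (at s)"
proof -
  have "((\<lambda>s. p + s *\<^sub>R w) has_derivative (\<lambda>h. h *\<^sub>R w)) (at s)"
    by (auto intro!: derivative_eq_intros)
  from has_derivative_compose[OF this has_derivative_frechet[OF assms]]
  have "((\<lambda>s. g (p + s *\<^sub>R w)) has_derivative (\<lambda>h. fderiv g (p + s *\<^sub>R w) (h *\<^sub>R w))) (at s)" .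
  moreover have "(\<lambda>h. fderiv g (p + s *\<^sub>R w) (h *\<^sub>R w)) = (*) (fderiv g (p + s *\<^sub>R w) w)"
    using linear_scale[OF linear_frechet_derivative[OF assms]] by (auto simp: fun_eq_iff)
  ultimately show ?thesis by (simp add: has_field_derivative_def)
qed

text \<open>The mean value theorem twice: first for \<phi>, the increment in direction v as a
  function of the parameter along u, then for the derivative along u.\<close>

lemma second_difference:
  fixes f :: "'a::real_normed_vector \<Rightarrow> real"
  assumes "Ck_on 2 S f" "t > 0" "\<And>a b. 0 \<le> a \<Longrightarrow> a \<le> t \<Longrightarrow> 0 \<le> b \<Longrightarrow> b \<le> t \<Longrightarrow> x + a *\<^sub>R u + b *\<^sub>R v \<in> S"
  obtains a b where "0 \<le> a" "a \<le> t" "0 \<le> b" "b \<le> t"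
    "f (x + t *\<^sub>R u + t *\<^sub>R v) - f (x + t *\<^sub>R u) - f (x + t *\<^sub>R v) + f x
      = t * (t * fderiv (\<lambda>y. fderiv f y u) (x + a *\<^sub>R u + b *\<^sub>R v) v)"
proof -
  have f1: "f differentiable (at y)" and f2: "(\<lambda>y. fderiv f y u) differentiable (at y)" if "y \<in> S" for y
    using assms(1) that by (simp_all add: eval_nat_numeral)
  define \<phi> where "\<phi> s = f (x + s *\<^sub>R u + t *\<^sub>R v) - f (x + s *\<^sub>R u)" for s
  note line = frechet_derivative_line
  have "(\<phi> has_real_derivative fderiv f (x + s *\<^sub>R u + t *\<^sub>R v) u - fderiv f (x + s *\<^sub>R u) u) (at s)"
    if "0 \<le> s" "s \<le> t" for s
  proof -
    have "x + s *\<^sub>R u + t *\<^sub>R v \<in> S" "x + s *\<^sub>R u \<in> S"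
      using assms(3)[of s t] assms(3)[of s 0] that assms(2) by auto
    then have "((\<lambda>s. f ((x + t *\<^sub>R v) + s *\<^sub>R u) - f (x + s *\<^sub>R u)) has_real_derivative
      fderiv f ((x + t *\<^sub>R v) + s *\<^sub>R u) u - fderiv f (x + s *\<^sub>R u) u) (at s)"
      by (intro DERIV_diff line f1) (simp_all add: algebra_simps)
    then show ?thesis by (simp add: \<phi>_def[abs_def] algebra_simps)
  qed
  from MVT2[OF assms(2) this]
  obtain a where a: "0 < a" "a < t" and *: "\<phi> t - \<phi> 0 = t * (fderiv f (x + a *\<^sub>R u + t *\<^sub>R v) u - fderiv f (x + a *\<^sub>R u) u)"
    by auto
  have "((\<lambda>s. fderiv f (x + a *\<^sub>R u + s *\<^sub>R v) u) has_real_derivative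
      fderiv (\<lambda>y. fderiv f y u) (x + a *\<^sub>R u + s *\<^sub>R v) v) (at s)" if "0 \<le> s" "s \<le> t" for s
    by (rule line[of "\<lambda>y. fderiv f y u"]) (use that a assms(3) f2 in auto)
  from MVT2[OF assms(2) this]
  obtain b where "0 < b" "b < t" "fderiv f (x + a *\<^sub>R u + t *\<^sub>R v) u - fderiv f (x + a *\<^sub>R u) u
     = t * fderiv (\<lambda>y. fderiv f y u) (x + a *\<^sub>R u + b *\<^sub>R v) v"
    by auto
  with a * show ?thesis
    by (intro that[of a b]) (auto simp: \<phi>_def)
qed

text \<open>The second difference is symmetric in u and v, so the two mixed derivatives take a
  common value at points arbitrarily close to x; continuity does the rest.\<close>

lemma symmetric_second_derivative_real:
  fixes f :: "'a::real_normed_vector \<Rightarrow> real"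
  assumes "open S" "x \<in> S" "Ck_on 2 S f"
  shows "fderiv (\<lambda>y. fderiv f y u) x v
    = fderiv (\<lambda>y. fderiv f y v) x u" (is "?uv x = ?vu x")
proof (rule ccontr)
  assume ne: "?uv x \<noteq> ?vu x"
  \<comment> \<open>Half the supposed gap: a common value cannot lie within e of both
    derivatives.\<close>
  define e where "e = \<bar>?uv x - ?vu x\<bar> / 2"
  have "e > 0" using ne by (simp add: e_def)
  have "continuous_on S ?uv" "continuous_on S ?vu"
    using assms(3) by (simp_all add: eval_nat_numeral)
  then have "isCont ?uv x" "isCont ?vu x"
    using assms(1,2) continuous_on_eq_continuous_at by blast+
  then obtain d1 d2 where d1: "d1 > 0" "\<And>y. dist y x < d1 \<Longrightarrow> dist (?uv y) (?uv x) < e"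
    and d2: "d2 > 0" "\<And>y. dist y x < d2 \<Longrightarrow> dist (?vu y) (?vu x) < e"
    using \<open>e > 0\<close> unfolding continuous_at_eps_delta by (metis dist_norm)
  obtain d3 where d3: "d3 > 0" "ball x d3 \<subseteq> S"
    using assms(1,2) open_contains_ball by blast
  define d where "d = min d1 (min d2 d3)"
  have d: "d > 0" using d1 d2 d3 by (simp add: d_def)
  \<comment> \<open>The summand 1 keeps n positive; with t = d / (2n) the parallelogram spanned by t
    u and t v stays within d/2 of x.\<close>
  define n where "n = norm u + norm v + 1"
  define t where "t = d / (2 * n)"
  have n: "n > 0"
    using norm_ge_zero[of u] norm_ge_zero[of v] unfolding n_def by linarith
  have t: "t > 0" using d n by (simp add: t_def)
  have near: "dist (x + a *\<^sub>R u + b *\<^sub>R v) x < d" if "0 \<le> a" "a \<le> t" "0 \<le> b" "b \<le> t" for a b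
  proof -
    have "dist (x + a *\<^sub>R u + b *\<^sub>R v) x = norm (a *\<^sub>R u + b *\<^sub>R v)"
      by (simp add: dist_norm algebra_simps)
    also have "\<dots> \<le> a * norm u + b * norm v"
      using norm_triangle_ineq[of "a *\<^sub>R u" "b *\<^sub>R v"] that by simp
    also have "\<dots> \<le> t * norm u + t * norm v"
      using that by (intro add_mono mult_right_mono) auto
    also have "\<dots> \<le> t * n"
      using t by (simp add: algebra_simps n_def)
    also have "\<dots> = d / 2" using n by (simp add: t_def)
    also have "\<dots> < d" using d by simp
    finally show ?thesis .
  qed
  have inS: "x + a *\<^sub>R u + b *\<^sub>R v \<in> S" "x + b *\<^sub>R v + a *\<^sub>R u \<in> S" if "0 \<le> a" "a \<le> t" "0 \<le> b" "b \<le> t" for a b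
  proof -
    show "x + a *\<^sub>R u + b *\<^sub>R v \<in> S"
      using near[OF that] d3 by (auto simp: d_def dist_commute mem_ball subset_iff)
    then show "x + b *\<^sub>R v + a *\<^sub>R u \<in> S" by (simp add: add_ac)
  qed
  obtain a b where ab: "0 \<le> a" "a \<le> t" "0 \<le> b" "b \<le> t"
    and 1: "f (x + t *\<^sub>R u + t *\<^sub>R v) - f (x + t *\<^sub>R u) - f (x + t *\<^sub>R v) + f x = t * (t * ?uv (x + a *\<^sub>R u + b *\<^sub>R v))"
    using second_difference[OF assms(3) t, of x u v] inS(1) by metis
  obtain a' b' where ab': "0 \<le> a'" "a' \<le> t" "0 \<le> b'" "b' \<le> t"
    and 2: "f (x + t *\<^sub>R v + t *\<^sub>R u) - f (x + t *\<^sub>R v) - f (x + t *\<^sub>R u) + f x = t * (t * ?vu (x + b' *\<^sub>R v + a' *\<^sub>R u))"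
    using second_difference[OF assms(3) t, of x v u] inS(2) by metis
  have eq: "x + t *\<^sub>R v + t *\<^sub>R u = x + t *\<^sub>R u + t *\<^sub>R v" "x + b' *\<^sub>R v + a' *\<^sub>R u = x + a' *\<^sub>R u + b' *\<^sub>R v"
    by (simp_all add: add_ac)
  have "t * (t * ?uv (x + a *\<^sub>R u + b *\<^sub>R v)) = t * (t * ?vu (x + a' *\<^sub>R u + b' *\<^sub>R v))"
    using 1 2[unfolded eq] by linarith
  then have "?uv (x + a *\<^sub>R u + b *\<^sub>R v) = ?vu (x + a' *\<^sub>R u + b' *\<^sub>R v)"
    using t by simp
  moreover have "dist (?uv (x + a *\<^sub>R u + b *\<^sub>R v)) (?uv x) < e"
    using near[OF ab] by (intro d1) (simp add: d_def)
  moreover have "dist (?vu (x + a' *\<^sub>R u + b' *\<^sub>R v)) (?vu x) < e"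
    using near[OF ab'] by (intro d2) (simp add: d_def)
  ultimately show False
    by (simp add: e_def dist_real_def abs_if split: if_splits)
qed

lemma frechet_derivative_inner:
  fixes f :: "'a::real_normed_vector \<Rightarrow> 'b::real_inner"
  assumes "f differentiable (at x)"
  shows "fderiv (\<lambda>y. f y \<bullet> b) x u = fderiv f x u \<bullet> b"
  using frechet_derivative_eq[OF has_derivative_inner_left[OF has_derivative_frechet[OF assms]]] by simp

lemma Ck_on_inner:
  fixes f :: "'a::real_normed_vector \<Rightarrow> 'b::real_inner"
  assumes "open S" "Ck_on k S f"
  shows "Ck_on k S (\<lambda>y. f y \<bullet> b)"
  using assms(2)
proof (induction k arbitrary: f)
  case 0
  then show ?case by (simp add: continuous_on_inner)
next
  case (Suc k)
  then have "Ck_on k S (\<lambda>x. fderiv (\<lambda>y. f y \<bullet> b) x v)" for v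
    by (subst Ck_on_cong[OF assms(1) frechet_derivative_inner]) auto
  moreover have "(\<lambda>y. f y \<bullet> b) differentiable (at x)" if "x \<in> S" for x
    using Suc.prems that by (intro differentiableI[OF has_derivative_inner_left[OF has_derivative_frechet]]) auto
  ultimately show ?case by simp
qed

lemma symmetric_second_derivative:
  fixes f :: "'a::real_normed_vector \<Rightarrow> 'b::real_inner"
  assumes "open S" "x \<in> S" "Ck_on 2 S f"
  shows "fderiv (\<lambda>y. fderiv f y u) x v
    = fderiv (\<lambda>y. fderiv f y v) x u"
proof -
  have *: "fderiv (\<lambda>y. fderiv (\<lambda>y. f y \<bullet> b) y u) x v
      = fderiv (\<lambda>y. fderiv f y u) x v \<bullet> b" for b u v
  proof -
    have "fderiv (\<lambda>y. fderiv (\<lambda>y. f y \<bullet> b) y u) x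
      = fderiv (\<lambda>y. fderiv f y u \<bullet> b) x"
      by (rule frechet_derivative_cong_open[OF assms(1,2)], rule frechet_derivative_inner)
        (use assms(3) in \<open>simp add: eval_nat_numeral\<close>)
    then show ?thesis
      using assms(2,3) by (simp add: frechet_derivative_inner eval_nat_numeral)
  qed
  have "\<forall>b. fderiv (\<lambda>y. fderiv f y u) x v \<bullet> b
    = fderiv (\<lambda>y. fderiv f y v) x u \<bullet> b"
    using symmetric_second_derivative_real[OF assms(1,2) Ck_on_inner[OF assms(1,3)]] unfolding * by blast
  then show ?thesis by (simp add: vector_eq_rdot)
qed


section \<open>The local exterior derivative\<close>

definition diff_form_at :: "nat \<Rightarrow> (real ^ 'n \<Rightarrow> (real ^ 'n::finite) mform) \<Rightarrow> real ^ 'n \<Rightarrow> bool" where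
  "diff_form_at k \<omega> x \<longleftrightarrow> (\<forall>us. length us = k \<longrightarrow> (\<lambda>y. \<omega> y us) differentiable (at x))"

lemma diff_form_atD: "diff_form_at k \<omega> x \<Longrightarrow> length us = k \<Longrightarrow> (\<lambda>y. \<omega> y us) differentiable (at x)"
  by (simp add: diff_form_at_def)

lemma diff_form_at_Cons: "diff_form_at (Suc k) \<omega> x \<Longrightarrow> diff_form_at k (\<lambda>y vs. \<omega> y (u # vs)) x"
  by (simp add: diff_form_at_def)

lemma local_ext_deriv_Nil: "local_ext_deriv \<omega> x [] = 0"
  by (simp add: local_ext_deriv_def)

text \<open>Cartan's formula for the contraction with a constant vector field.\<close>

lemma local_ext_deriv_Cons:
  "local_ext_deriv \<omega> x (u # us) = fderiv (\<lambda>y. \<omega> y us) x u - local_ext_deriv (\<lambda>y vs. \<omega> y (u # vs)) x us"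
  by (simp add: local_ext_deriv_def sum.lessThan_Suc_shift sum_negf del: sum.lessThan_Suc)

lemma local_ext_deriv_cong:
  assumes "open S" "x \<in> S" "\<And>y vs. y \<in> S \<Longrightarrow> length vs = k \<Longrightarrow> \<omega> y vs = \<eta> y vs" "length us = Suc k"
  shows "local_ext_deriv \<omega> x us = local_ext_deriv \<eta> x us"
  unfolding local_ext_deriv_def
proof (rule sum.cong[OF refl])
  fix i assume i: "i \<in> {..<length us}"
  have "fderiv (\<lambda>y. \<omega> y (take i us @ drop (Suc i) us)) x = fderiv (\<lambda>y. \<eta> y (take i us @ drop (Suc i) us)) x"
    by (rule frechet_derivative_cong_open[OF assms(1,2) assms(3)]) (use i assms(4) in auto)
  then show "(-1) ^ i * fderiv (\<lambda>y. \<omega> y (take i us @ drop (Suc i) us)) x (us ! i)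
    = (-1) ^ i * fderiv (\<lambda>y. \<eta> y (take i us @ drop (Suc i) us)) x (us ! i)" by simp
qed

lemma frechet_derivative_lincomb:
  fixes f g :: "'a::real_normed_vector \<Rightarrow> real"
  assumes "f differentiable (at x)" "g differentiable (at x)"
  shows "fderiv (\<lambda>y. a * f y + b * g y) x u = a * fderiv f x u + b * fderiv g x u"
proof -
  have "((\<lambda>y. a * f y + b * g y) has_derivative (\<lambda>u. a * fderiv f x u + b * fderiv g x u)) (at x)"
    using assms by (intro has_derivative_add has_derivative_mult_right has_derivative_frechet)
  from frechet_derivative_eq[OF this] show ?thesis by simp
qed

lemma local_ext_deriv_lincomb:
  assumes "diff_form_at k \<omega> x" "diff_form_at k \<eta> x" "length us = Suc k"
  shows "local_ext_deriv (\<lambda>y vs. a * \<omega> y vs + b * \<eta> y vs) x us = a * local_ext_deriv \<omega> x us + b * local_ext_deriv \<eta> x us"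
  unfolding local_ext_deriv_def sum_distrib_left sum.distrib[symmetric]
proof (rule sum.cong[OF refl])
  fix i assume i: "i \<in> {..<length us}"
  let ?vs = "take i us @ drop (Suc i) us"
  have "length ?vs = k" using i assms(3) by auto
  then have "fderiv (\<lambda>y. a * \<omega> y ?vs + b * \<eta> y ?vs) x (us ! i)
    = a * fderiv (\<lambda>y. \<omega> y ?vs) x (us ! i) + b * fderiv (\<lambda>y. \<eta> y ?vs) x (us ! i)"
    using assms by (intro frechet_derivative_lincomb) (simp_all add: diff_form_atD)
  then show "(-1) ^ i * fderiv (\<lambda>y. a * \<omega> y ?vs + b * \<eta> y ?vs) x (us ! i)
    = a * ((-1) ^ i * fderiv (\<lambda>y. \<omega> y ?vs) x (us ! i)) + b * ((-1) ^ i * fderiv (\<lambda>y. \<eta> y ?vs) x (us ! i))"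
    by (simp add: algebra_simps)
qed

lemma local_ext_deriv_uminus:
  assumes "diff_form_at k \<omega> x" "length us = Suc k"
  shows "local_ext_deriv (\<lambda>y vs. - \<omega> y vs) x us = - local_ext_deriv \<omega> x us"
  using local_ext_deriv_lincomb[OF assms(1,1,2), of "-1" 0] by simp

text \<open>Cartan's formula removes the leading vectors until u and v stand in front. There the two
  derivative terms change places with opposite signs, and the remaining term contracts the skew form
  \<omega> with both vectors.\<close>

lemma local_ext_deriv_skew:
  fixes \<omega> :: "real ^ 'n \<Rightarrow> (real ^ 'n::finite) mform"
  assumes "open S" "x \<in> S" "\<And>y. y \<in> S \<Longrightarrow> skew k (\<omega> y)" "diff_form_at k \<omega> x"
  shows "skew (Suc k) (local_ext_deriv \<omega> x)"
proof -
  have "local_ext_deriv \<omega> x (xs @ u # v # ys) = - local_ext_deriv \<omega> x (xs @ v # u # ys)"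
    if "length xs + length ys + 2 = Suc k" for xs ys u v
    using that assms(3,4)
  proof (induction xs arbitrary: k \<omega>)
    case Nil
    then have k: "k = Suc (length ys)" by simp
    have "local_ext_deriv (\<lambda>y vs. \<omega> y (v # u # vs)) x ys = - local_ext_deriv (\<lambda>y vs. \<omega> y (u # v # vs)) x ys"
    proof (cases ys)
      case (Cons y' ys')
      then have k: "k = Suc (Suc (length ys'))" using k by simp
      have "local_ext_deriv (\<lambda>y vs. \<omega> y (v # u # vs)) x ys = local_ext_deriv (\<lambda>y vs. - \<omega> y (u # v # vs)) x ys"
      proof (rule local_ext_deriv_cong[OF assms(1,2)])
        fix y and vs :: "(real ^ 'n) list" assume y: "y \<in> S" and vs: "length vs = length ys'"
        show "\<omega> y (v # u # vs) = - \<omega> y (u # v # vs)"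
          using skewD[OF Nil.prems(2)[OF y], of "[]" vs v u] vs k by simp
      qed (use Cons in simp)
      also have "\<dots> = - local_ext_deriv (\<lambda>y vs. \<omega> y (u # v # vs)) x ys"
        by (rule local_ext_deriv_uminus[of "length ys'"]) (use Nil.prems k Cons in \<open>auto simp: diff_form_at_def\<close>)
      finally show ?thesis .
    qed (simp add: local_ext_deriv_Nil)
    then show ?case by (simp add: local_ext_deriv_Cons)
  next
    case (Cons a xs)
    then obtain k' where k: "k = Suc k'" by (cases k) auto
    have "fderiv (\<lambda>y. \<omega> y (xs @ u # v # ys)) x = fderiv (\<lambda>y. - \<omega> y (xs @ v # u # ys)) x"
      by (rule frechet_derivative_cong_open[OF assms(1,2)], rule skewD[OF Cons.prems(2)]) (use Cons.prems in auto)
    also have "\<dots> = (\<lambda>h. - fderiv (\<lambda>y. \<omega> y (xs @ v # u # ys)) x h)"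
      by (rule frechet_derivative_eq, rule has_derivative_minus, rule has_derivative_frechet, rule diff_form_atD[OF Cons.prems(3)])
        (use Cons.prems in auto)
    finally have 1: "fderiv (\<lambda>y. \<omega> y (xs @ u # v # ys)) x a = - fderiv (\<lambda>y. \<omega> y (xs @ v # u # ys)) x a"
      by simp
    have 2: "local_ext_deriv (\<lambda>y vs. \<omega> y (a # vs)) x (xs @ u # v # ys) = - local_ext_deriv (\<lambda>y vs. \<omega> y (a # vs)) x (xs @ v # u # ys)"
      using Cons.prems k by (intro Cons.IH[of k']) (auto intro: skew_Cons diff_form_at_Cons)
    show ?case
      unfolding append_Cons local_ext_deriv_Cons 1 2 by simp
  qed
  then show ?thesis unfolding skew_def by blast
qed

lemma local_ext_deriv_alt:
  fixes \<omega> :: "real ^ 'n \<Rightarrow> (real ^ 'n::finite) mform"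
  assumes S: "open S" "x \<in> S" and alt: "\<And>y. y \<in> S \<Longrightarrow> alt k (\<omega> y)" and diff: "diff_form_at k \<omega> x"
  shows "alt (Suc k) (local_ext_deriv \<omega> x)"
  unfolding alt_def
proof (intro conjI allI impI)
  show "skew (Suc k) (local_ext_deriv \<omega> x)"
    using local_ext_deriv_skew[OF S alt_skew[OF alt] diff] .
  fix us :: "(real ^ 'n) list" assume us: "Suc (length us) = Suc k"
  have lin: "linear (fderiv (\<lambda>y. \<omega> y us) x)"
    using us by (intro linear_frechet_derivative diff_form_atD[OF diff]) simp
  have "local_ext_deriv (\<lambda>y vs. \<omega> y ((a *\<^sub>R u + b *\<^sub>R v) # vs)) x us
    = a * local_ext_deriv (\<lambda>y vs. \<omega> y (u # vs)) x us + b * local_ext_deriv (\<lambda>y vs. \<omega> y (v # vs)) x us" for a b u v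
  proof (cases us)
    case (Cons w ws)
    then have k: "k = Suc (length ws)" using us by simp
    have "local_ext_deriv (\<lambda>y vs. \<omega> y ((a *\<^sub>R u + b *\<^sub>R v) # vs)) x us
      = local_ext_deriv (\<lambda>y vs. a * \<omega> y (u # vs) + b * \<omega> y (v # vs)) x us"
      by (rule local_ext_deriv_cong[OF S]) (use k Cons alt in \<open>auto intro: alt_lincomb\<close>)
    also have "\<dots> = a * local_ext_deriv (\<lambda>y vs. \<omega> y (u # vs)) x us + b * local_ext_deriv (\<lambda>y vs. \<omega> y (v # vs)) x us"
      by (rule local_ext_deriv_lincomb) (use diff k Cons in \<open>auto intro: diff_form_at_Cons\<close>)
    finally show ?thesis .
  qed (simp add: local_ext_deriv_Nil)
  then have "local_ext_deriv \<omega> x ((a *\<^sub>R u + b *\<^sub>R v) # us) = a * local_ext_deriv \<omega> x (u # us) + b * local_ext_deriv \<omega> x (v # us)" for a b u v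
    using linear_add[OF lin, of "a *\<^sub>R u" "b *\<^sub>R v"] linear_scale[OF lin]
    by (simp add: local_ext_deriv_Cons algebra_simps)
  from this[of 1 _ 1 _] this[of _ _ 0 0] show "linear (\<lambda>u. local_ext_deriv \<omega> x (u # us))"
    by (intro linearI) simp_all
qed

lemma wedge_has_derivative:
  assumes "diff_form_at k \<omega> x" "diff_form_at l \<eta> x"
  shows "((\<lambda>y. wedge k l (\<omega> y) (\<eta> y) vs) has_derivative
    (\<lambda>u. wedge k l (\<lambda>vs. fderiv (\<lambda>y. \<omega> y vs) x u) (\<eta> x) vs
       + wedge k l (\<omega> x) (\<lambda>vs. fderiv (\<lambda>y. \<eta> y vs) x u) vs)) (at x)"
proof -
  have d1: "((\<lambda>y. \<omega> y (map f [0..<k])) has_derivative fderiv (\<lambda>y. \<omega> y (map f [0..<k])) x) (at x)" for f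
    by (intro has_derivative_frechet diff_form_atD[OF assms(1)]) simp
  have d2: "((\<lambda>y. \<eta> y (map f [k..<k + l])) has_derivative fderiv (\<lambda>y. \<eta> y (map f [k..<k + l])) x) (at x)" for f
    by (intro has_derivative_frechet diff_form_atD[OF assms(2)]) simp
  have "((\<lambda>y. (\<Sum>\<sigma> | \<sigma> permutes {..<k + l}. of_int (sign \<sigma>) *
       (\<omega> y (map (\<lambda>i. vs ! \<sigma> i) [0..<k]) * \<eta> y (map (\<lambda>i. vs ! \<sigma> i) [k..<k + l]))) / (fact k * fact l)) has_derivative
    (\<lambda>u. (\<Sum>\<sigma> | \<sigma> permutes {..<k + l}. of_int (sign \<sigma>) *
       (\<omega> x (map (\<lambda>i. vs ! \<sigma> i) [0..<k]) * fderiv (\<lambda>y. \<eta> y (map (\<lambda>i. vs ! \<sigma> i) [k..<k + l])) x u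
       + fderiv (\<lambda>y. \<omega> y (map (\<lambda>i. vs ! \<sigma> i) [0..<k])) x u * \<eta> x (map (\<lambda>i. vs ! \<sigma> i) [k..<k + l]))) / (fact k * fact l))) (at x)"
    by (intro bounded_linear.has_derivative[OF bounded_linear_divide] has_derivative_sum has_derivative_mult_right has_derivative_mult d1 d2)
  then show ?thesis
    by (simp add: wedge_def algebra_simps sum.distrib add_divide_distrib)
qed

lemma diff_form_at_wedge:
  "diff_form_at k \<omega> x \<Longrightarrow> diff_form_at l \<eta> x \<Longrightarrow> diff_form_at m (\<lambda>y. wedge k l (\<omega> y) (\<eta> y)) x"
  using wedge_has_derivative unfolding diff_form_at_def[of m] differentiable_def by blast

lemma wedge_diff_left: "wedge k l (\<lambda>vs. \<omega> vs - \<omega>' vs) \<eta> us = wedge k l \<omega> \<eta> us - wedge k l \<omega>' \<eta> us"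
  using wedge_lincomb_left[of k l 1 \<omega> "-1" \<omega>' \<eta> us] by simp

lemma wedge_diff_right: "wedge k l \<omega> (\<lambda>vs. \<eta> vs - \<eta>' vs) us = wedge k l \<omega> \<eta> us - wedge k l \<omega> \<eta>' us"
  using wedge_lincomb_right[of k l \<omega> 1 \<eta> "-1" \<eta>' us] by simp

text \<open>Leibniz rule by induction on the arguments: contracting both sides with u gives, by
  Cartan's formula and the antiderivation rule, instances of the rule for the contracted
  factors.\<close>

lemma local_ext_deriv_wedge:
  fixes \<omega> \<eta> :: "real ^ 'n \<Rightarrow> (real ^ 'n::finite) mform"
  assumes S: "open S" "x \<in> S"
    and "\<And>y. y \<in> S \<Longrightarrow> skew k (\<omega> y)" "\<And>y. y \<in> S \<Longrightarrow> skew l (\<eta> y)"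
    and "diff_form_at k \<omega> x" "diff_form_at l \<eta> x" "length us = Suc (k + l)"
  shows "local_ext_deriv (\<lambda>y. wedge k l (\<omega> y) (\<eta> y)) x us
    = wedge (Suc k) l (local_ext_deriv \<omega> x) (\<eta> x) us + (-1) ^ k * wedge k (Suc l) (\<omega> x) (local_ext_deriv \<eta> x) us"
  using assms(3-)
proof (induction us arbitrary: k l \<omega> \<eta>)
  case (Cons u us)
  have len: "length us = k + l" using Cons.prems by simp
  define \<omega>u where "\<omega>u y vs = \<omega> y (u # vs)" for y vs
  define \<eta>u where "\<eta>u y vs = \<eta> y (u # vs)" for y vs
  define D\<omega> where "D\<omega> vs = fderiv (\<lambda>y. \<omega> y vs) x u" for vs
  define D\<eta> where "D\<eta> vs = fderiv (\<lambda>y. \<eta> y vs) x u" for vs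
  have sk: "skew (Suc k) (local_ext_deriv \<omega> x)" "skew (Suc l) (local_ext_deriv \<eta> x)"
    using local_ext_deriv_skew[OF S] Cons.prems by blast+
  have cons: "(\<lambda>vs. local_ext_deriv \<omega> x (u # vs)) = (\<lambda>vs. D\<omega> vs - local_ext_deriv \<omega>u x vs)"
    "(\<lambda>vs. local_ext_deriv \<eta> x (u # vs)) = (\<lambda>vs. D\<eta> vs - local_ext_deriv \<eta>u x vs)"
    by (simp_all add: local_ext_deriv_Cons D\<omega>_def D\<eta>_def \<omega>u_def[abs_def] \<eta>u_def[abs_def])
  have R1: "wedge (Suc k) l (local_ext_deriv \<omega> x) (\<eta> x) (u # us)
     = wedge k l D\<omega> (\<eta> x) us - wedge k l (local_ext_deriv \<omega>u x) (\<eta> x) us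
       - (if l = 0 then 0 else (-1) ^ k * wedge (Suc k) (l - 1) (local_ext_deriv \<omega> x) (\<eta>u x) us)"
    using wedge_Cons[OF sk(1) Cons.prems(2)[OF S(2)], of us u] len
    by (simp add: cons wedge_diff_left \<eta>u_def[abs_def])
  have R2: "wedge k (Suc l) (\<omega> x) (local_ext_deriv \<eta> x) (u # us)
     = (if k = 0 then 0 else wedge (k - 1) (Suc l) (\<omega>u x) (local_ext_deriv \<eta> x) us)
       + (-1) ^ k * (wedge k l (\<omega> x) D\<eta> us - wedge k l (\<omega> x) (local_ext_deriv \<eta>u x) us)"
    using wedge_Cons[OF Cons.prems(1)[OF S(2)] sk(2), of us u] len
    by (simp add: cons wedge_diff_right \<omega>u_def[abs_def])
  \<comment> \<open>A and B are the two parts of the contracted product, set to 0 when the factor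
    has degree 0 and cannot be contracted.\<close>
  define A where "A y vs = (if k = 0 then 0 else wedge (k - 1) l (\<omega>u y) (\<eta> y) vs)" for y vs
  define B where "B y vs = (if l = 0 then 0 else wedge k (l - 1) (\<omega> y) (\<eta>u y) vs)" for y vs
  have k: "skew (k - 1) (\<omega>u y)" "diff_form_at (k - 1) \<omega>u x" if "k \<noteq> 0" "y \<in> S" for y
    using that skew_Cons[of "k - 1" "\<omega> y" u] diff_form_at_Cons[of "k - 1" \<omega> x u] Cons.prems
    by (simp_all add: \<omega>u_def[abs_def])
  have l: "skew (l - 1) (\<eta>u y)" "diff_form_at (l - 1) \<eta>u x" if "l \<noteq> 0" "y \<in> S" for y
    using that skew_Cons[of "l - 1" "\<eta> y" u] diff_form_at_Cons[of "l - 1" \<eta> x u] Cons.prems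
    by (simp_all add: \<eta>u_def[abs_def])
  have A: "local_ext_deriv A x us = (if k = 0 then 0 else
      wedge k l (local_ext_deriv \<omega>u x) (\<eta> x) us - (-1) ^ k * wedge (k - 1) (Suc l) (\<omega>u x) (local_ext_deriv \<eta> x) us)"
  proof (cases "k = 0")
    case True
    then show ?thesis by (simp add: A_def[abs_def] local_ext_deriv_def frechet_derivative_const)
  next
    case False
    then show ?thesis
      using Cons.IH[of "k - 1" \<omega>u l \<eta>] k S Cons.prems len
      by (cases k) (simp_all add: A_def[abs_def])
  qed
  have B: "local_ext_deriv B x us = (if l = 0 then 0 else
      wedge (Suc k) (l - 1) (local_ext_deriv \<omega> x) (\<eta>u x) us + (-1) ^ k * wedge k l (\<omega> x) (local_ext_deriv \<eta>u x) us)"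
  proof (cases "l = 0")
    case True
    then show ?thesis by (simp add: B_def[abs_def] local_ext_deriv_def frechet_derivative_const)
  next
    case False
    then show ?thesis
      using Cons.IH[of k \<omega> "l - 1" \<eta>u] l S Cons.prems len
      by (cases l) (simp_all add: B_def[abs_def])
  qed
  \<comment> \<open>In degree 0 the expansions R1 and R2 still contain the derivative of a
    contraction. It is evaluated on the empty list, where the exterior derivative is 0.\<close>
  have K: "wedge k l (local_ext_deriv \<omega>u x) (\<eta> x) us = 0" if "k = 0"
    using wedge_cong[of k us "local_ext_deriv \<omega>u x" "\<lambda>_. 0" l "\<eta> x" "\<eta> x"] len that
    by (simp add: local_ext_deriv_Nil wedge_zero_left)
  have L: "wedge k l (\<omega> x) (local_ext_deriv \<eta>u x) us = 0" if "l = 0"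
    using wedge_cong[of k us "\<omega> x" "\<omega> x" l "local_ext_deriv \<eta>u x" "\<lambda>_. 0"] len that
    by (simp add: local_ext_deriv_Nil wedge_zero_right)
  have AB: "local_ext_deriv (\<lambda>y vs. wedge k l (\<omega> y) (\<eta> y) (u # vs)) x us = local_ext_deriv A x us + (-1) ^ k * local_ext_deriv B x us"
  proof (cases us)
    case (Cons w ws)
    then have kl: "k + l = Suc (length ws)" using len by simp
    have "local_ext_deriv (\<lambda>y vs. wedge k l (\<omega> y) (\<eta> y) (u # vs)) x us = local_ext_deriv (\<lambda>y vs. 1 * A y vs + (-1) ^ k * B y vs) x us"
    proof (rule local_ext_deriv_cong[OF S])
      fix y and vs :: "(real ^ 'n) list" assume "y \<in> S" "length vs = length ws"
      then show "wedge k l (\<omega> y) (\<eta> y) (u # vs) = 1 * A y vs + (-1) ^ k * B y vs"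
        using wedge_Cons[OF Cons.prems(1,2), of y y vs u] kl by (simp add: A_def B_def \<omega>u_def[abs_def] \<eta>u_def[abs_def])
    qed (simp add: Cons)
    also have "\<dots> = 1 * local_ext_deriv A x us + (-1) ^ k * local_ext_deriv B x us"
    proof (rule local_ext_deriv_lincomb)
      show "diff_form_at (length ws) A x" "diff_form_at (length ws) B x"
        using k l S Cons.prems
        by (cases "k = 0"; cases "l = 0"; simp add: A_def[abs_def] B_def[abs_def] diff_form_at_wedge;
            simp add: diff_form_at_def)+
    qed (simp add: Cons)
    finally show ?thesis by simp
  qed (simp add: local_ext_deriv_Nil)
  have "fderiv (\<lambda>y. wedge k l (\<omega> y) (\<eta> y) us) x u = wedge k l D\<omega> (\<eta> x) us + wedge k l (\<omega> x) D\<eta> us"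
    unfolding frechet_derivative_eq[OF wedge_has_derivative[OF Cons.prems(3,4)]] D\<omega>_def[abs_def] D\<eta>_def[abs_def] ..
  then show ?case
    unfolding local_ext_deriv_Cons AB A B R1 R2 using K L
    by (cases "k = 0"; cases "l = 0") (simp_all add: algebra_simps flip: power_add power_mult_distrib)
qed simp

text \<open>The case of a 1-form, meant for \<beta>: the six mixed second derivatives cancel in
  pairs by symmetry.\<close>

lemma local_ext_deriv_twice:
  assumes S: "open S" "x \<in> S" and smooth: "\<And>u. Ck_on 2 S (\<lambda>y. \<beta> y [u])"
  shows "local_ext_deriv (local_ext_deriv \<beta>) x [u, v, w] = 0"
proof -
  define D where "D u v y = fderiv (\<lambda>y. \<beta> y [v]) y u" for u v y
  have d: "local_ext_deriv \<beta> y [u, v] = 1 * D u v y + (-1) * D v u y" for u v y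
    by (simp add: local_ext_deriv_Cons local_ext_deriv_Nil D_def)
  have diff: "D u v differentiable (at x)" for u v
    using smooth[of v] S by (simp add: D_def[abs_def] eval_nat_numeral)
  have "fderiv (\<lambda>y. local_ext_deriv \<beta> y [u, v]) x w
    = 1 * fderiv (D u v) x w + (-1) * fderiv (D v u) x w" for u v w
    unfolding d by (rule frechet_derivative_lincomb[OF diff diff])
  moreover have "fderiv (D u v) x w = fderiv (D w v) x u" for u v w
    unfolding D_def[abs_def] by (rule symmetric_second_derivative[OF S smooth])
  ultimately show ?thesis
    by (simp add: local_ext_deriv_Cons local_ext_deriv_Nil)
qed

text \<open>Product rule when base point and arguments all move. Differentiability of \<omega> is
  known for fixed arguments only, so the leading argument is expanded in the standard basis and its
  coordinates become scalar factors; the induction treats the other slots.\<close>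

lemma mform_has_derivative:
  fixes F :: "real ^ 'm::finite \<Rightarrow> real ^ 'n::finite" and \<omega> :: "real ^ 'n \<Rightarrow> (real ^ 'n) mform"
  assumes S: "open S" "x \<in> S" and T: "open T" "F ` S \<subseteq> T" and F: "(F has_derivative F') (at x)"
    and "\<And>y. y \<in> T \<Longrightarrow> alt k (\<omega> y)" "diff_form_at k \<omega> (F x)" "length fs = k"
    and "list_all2 (\<lambda>f f'. (f has_derivative f') (at x)) fs fs'"
  shows "((\<lambda>y. \<omega> (F y) (map (\<lambda>f. f y) fs)) has_derivative
    (\<lambda>u. fderiv (\<lambda>z. \<omega> z (map (\<lambda>f. f x) fs)) (F x) (F' u)
       + (\<Sum>j<k. \<omega> (F x) ((map (\<lambda>f. f x) fs)[j := (fs' ! j) u])))) (at x)"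
  using assms(9,6-8)
proof (induction arbitrary: k \<omega> rule: list_all2_induct)
  case Nil
  then have "((\<lambda>z. \<omega> z []) has_derivative fderiv (\<lambda>z. \<omega> z []) (F x)) (at (F x))"
    by (intro has_derivative_frechet diff_form_atD) auto
  from has_derivative_compose[OF F this] show ?case
    using Nil by simp
next
  case (Cons f fs f' fs')
  then have k: "k = Suc (length fs)" by simp
  define V where "V y = map (\<lambda>f. f y) fs" for y
  define D where "D vs = fderiv (\<lambda>z. \<omega> z vs) (F x)" for vs
  have Fx: "F x \<in> T" using S T by blast
  have G: "((\<lambda>y. \<omega> (F y) (axis i 1 # V y)) has_derivative
      (\<lambda>u. D (axis i 1 # V x) (F' u) + (\<Sum>j<length fs. \<omega> (F x) (axis i 1 # (V x)[j := (fs' ! j) u])))) (at x)" for i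
    unfolding V_def D_def
    by (rule Cons.IH) (use Cons.prems k in \<open>auto intro: alt_Cons diff_form_at_Cons\<close>)
  have f: "((\<lambda>y. f y $ i) has_derivative (\<lambda>u. f' u $ i)) (at x)" for i
    by (rule bounded_linear.has_derivative[OF bounded_linear_vec_nth Cons.hyps(1)])
  have "((\<lambda>y. \<Sum>i\<in>UNIV. f y $ i * \<omega> (F y) (axis i 1 # V y)) has_derivative
      (\<lambda>u. \<Sum>i\<in>UNIV. f x $ i * (D (axis i 1 # V x) (F' u) + (\<Sum>j<length fs. \<omega> (F x) (axis i 1 # (V x)[j := (fs' ! j) u])))
        + f' u $ i * \<omega> (F x) (axis i 1 # V x))) (at x)"
    by (intro has_derivative_sum has_derivative_mult f G)
  moreover have "(\<Sum>i\<in>UNIV. f x $ i * (D (axis i 1 # V x) (F' u) + (\<Sum>j<length fs. \<omega> (F x) (axis i 1 # (V x)[j := (fs' ! j) u])))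
        + f' u $ i * \<omega> (F x) (axis i 1 # V x))
    = D (f x # V x) (F' u) + (\<omega> (F x) (f' u # V x) + (\<Sum>j<length fs. \<omega> (F x) (f x # (V x)[j := (fs' ! j) u])))" for u
  proof -
    have "D (f x # V x) = (\<lambda>h. \<Sum>i\<in>UNIV. f x $ i * D (axis i 1 # V x) h)"
    proof -
      have "D (f x # V x) = fderiv (\<lambda>z. \<Sum>i\<in>UNIV. f x $ i * \<omega> z (axis i 1 # V x)) (F x)"
        unfolding D_def using Cons.prems(1) k
        by (intro frechet_derivative_cong_open[OF T(1) Fx] alt_expand) (auto simp: V_def)
      also have "\<dots> = (\<lambda>h. \<Sum>i\<in>UNIV. f x $ i * D (axis i 1 # V x) h)"
        unfolding D_def using Cons.prems(2) k
        by (intro frechet_derivative_eq has_derivative_sum has_derivative_mult_right has_derivative_frechet diff_form_atD) (auto simp: V_def)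
      finally show ?thesis .
    qed
    moreover have "\<omega> (F x) (f' u # V x) = (\<Sum>i\<in>UNIV. f' u $ i * \<omega> (F x) (axis i 1 # V x))"
      using Cons.prems(1)[OF Fx] k by (intro alt_expand) (auto simp: V_def)
    moreover have "\<omega> (F x) (f x # (V x)[j := (fs' ! j) u]) = (\<Sum>i\<in>UNIV. f x $ i * \<omega> (F x) (axis i 1 # (V x)[j := (fs' ! j) u]))" for j
      using Cons.prems(1)[OF Fx] k by (intro alt_expand) (auto simp: V_def)
    moreover have "(\<Sum>j<length fs. \<Sum>i\<in>UNIV. f x $ i * \<omega> (F x) (axis i 1 # (V x)[j := (fs' ! j) u]))
        = (\<Sum>i\<in>UNIV. \<Sum>j<length fs. f x $ i * \<omega> (F x) (axis i 1 # (V x)[j := (fs' ! j) u]))"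
      by (rule sum.swap)
    ultimately show ?thesis
      by (simp add: algebra_simps sum.distrib sum_distrib_left)
  qed
  ultimately have "((\<lambda>y. \<Sum>i\<in>UNIV. f y $ i * \<omega> (F y) (axis i 1 # V y)) has_derivative
      (\<lambda>u. D (f x # V x) (F' u) + (\<omega> (F x) (f' u # V x) + (\<Sum>j<length fs. \<omega> (F x) (f x # (V x)[j := (fs' ! j) u]))))) (at x)"
    by simp
  then have "((\<lambda>y. \<omega> (F y) (f y # V y)) has_derivative
      (\<lambda>u. D (f x # V x) (F' u) + (\<omega> (F x) (f' u # V x) + (\<Sum>j<length fs. \<omega> (F x) (f x # (V x)[j := (fs' ! j) u]))))) (at x)"
  proof (rule has_derivative_transform_within_open[OF _ S])
    fix y assume "y \<in> S"
    then have "F y \<in> T" using T by blast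
    then show "(\<Sum>i\<in>UNIV. f y $ i * \<omega> (F y) (axis i 1 # V y)) = \<omega> (F y) (f y # V y)"
      using Cons.prems(1) k by (intro alt_expand[symmetric]) (auto simp: V_def)
  qed
  then show ?case
    unfolding k by (simp add: sum.lessThan_Suc_shift V_def D_def del: sum.lessThan_Suc)
qed

text \<open>The second derivatives of the change of coordinates drop out of the exterior derivative,
  being symmetric.\<close>

lemma symmetric_terms_cancel:
  fixes H :: "'u \<Rightarrow> 'u \<Rightarrow> 'v"
  assumes "\<And>u v. H u v = H v u" "skew k \<omega>" "length us = Suc k"
  shows "(\<Sum>i<Suc k. (-1) ^ i * (\<Sum>j<k. \<omega> ((map L (take i us @ drop (Suc i) us))[j := H (us ! i) ((take i us @ drop (Suc i) us) ! j)]))) = 0"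
  using assms(2,3)
proof (induction us arbitrary: k \<omega>)
  case (Cons u us)
  show ?case
  proof (cases k)
    case (Suc k')
    then have us: "length us = Suc k'" using Cons.prems by simp
    have IH: "(\<Sum>i<Suc k'. (-1) ^ i * (\<Sum>j<k'. \<omega> (L u # (map L (take i us @ drop (Suc i) us))[j := H (us ! i) ((take i us @ drop (Suc i) us) ! j)]))) = 0"
      using Cons.prems Suc by (intro Cons.IH) (auto intro: skew_Cons)
    \<comment> \<open>Differentiating along u and altering slot j is paired with differentiating
      along the j-th entry and altering the slot of u. By symmetry of H the two agree up to the sign
      of moving that entry to the front.\<close>
    have first: "\<omega> ((map L us)[j := H u (us ! j)]) = (-1) ^ j * \<omega> (H (us ! j) u # map L (take j us @ drop (Suc j) us))"
      if "j < Suc k'" for j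
    proof -
      have "(map L us)[j := H u (us ! j)] = map L (take j us) @ H (us ! j) u # map L (drop (Suc j) us)"
        using that us by (simp add: upd_conv_take_nth_drop take_map drop_map assms(1)[of u])
      moreover have "\<omega> (H (us ! j) u # map L (take j us) @ map L (drop (Suc j) us))
          = (-1) ^ length (map L (take j us)) * \<omega> (map L (take j us) @ H (us ! j) u # map L (drop (Suc j) us))"
        using skew_move[OF Cons.prems(1), of "[]" "map L (take j us)" "map L (drop (Suc j) us)" "H (us ! j) u"] that us Suc
        by simp
      ultimately show ?thesis
        using that us by (simp add: minus_one_power_iff)
    qed
    have "(\<Sum>i<Suc k. (-1) ^ i * (\<Sum>j<k. \<omega> ((map L (take i (u # us) @ drop (Suc i) (u # us)))[j := H ((u # us) ! i) ((take i (u # us) @ drop (Suc i) (u # us)) ! j)])))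
      = (\<Sum>j<Suc k'. \<omega> ((map L us)[j := H u (us ! j)]))
        - (\<Sum>i<Suc k'. (-1) ^ i * (\<omega> (H (us ! i) u # map L (take i us @ drop (Suc i) us))
          + (\<Sum>j<k'. \<omega> (L u # (map L (take i us @ drop (Suc i) us))[j := H (us ! i) ((take i us @ drop (Suc i) us) ! j)]))))"
      unfolding Suc sum.lessThan_Suc_shift[of _ "Suc k'"]
      by (simp add: sum.lessThan_Suc_shift[of _ k'] sum_negf[symmetric] del: sum.lessThan_Suc)
    also have "\<dots> = 0"
      using IH by (simp add: first algebra_simps sum.distrib del: sum.lessThan_Suc)
    finally show ?thesis .
  qed simp
qed simp

text \<open>Naturality of d, which makes the exterior derivative independent of the chart. The
  product rule leaves the pulled back derivative plus terms containing H, the second derivative of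
  F, and these cancel.\<close>

lemma local_ext_deriv_pullback:
  fixes F :: "real ^ 'm::finite \<Rightarrow> real ^ 'n::finite" and \<omega> :: "real ^ 'n \<Rightarrow> (real ^ 'n) mform"
  assumes S: "open S" "x \<in> S" and T: "open T" "F ` S \<subseteq> T" and F: "Ck_on 2 S F"
    and alt: "\<And>y. y \<in> T \<Longrightarrow> alt k (\<omega> y)" and diff: "diff_form_at k \<omega> (F x)" and len: "length us = Suc k"
  shows "local_ext_deriv (\<lambda>y vs. \<omega> (F y) (map (fderiv F y) vs)) x us
    = local_ext_deriv \<omega> (F x) (map (fderiv F x) us)"
proof -
  define L where "L y = fderiv F y" for y
  define H where "H u v = fderiv (\<lambda>y. L y v) x u" for u v
  have Fx: "F x \<in> T" using S T by blast
  have H: "((\<lambda>y. L y v) has_derivative (\<lambda>u. H u v)) (at x)" for v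
    unfolding H_def L_def by (rule has_derivative_frechet) (use F S in \<open>simp add: eval_nat_numeral\<close>)
  have sym: "H u v = H v u" for u v
    unfolding H_def L_def by (rule symmetric_second_derivative[OF S F])
  have FL: "(F has_derivative L x) (at x)"
    unfolding L_def by (rule has_derivative_frechet) (use F S in \<open>simp add: eval_nat_numeral\<close>)
  have D: "fderiv (\<lambda>y. \<omega> (F y) (map (L y) vs)) x u
      = fderiv (\<lambda>z. \<omega> z (map (L x) vs)) (F x) (L x u) + (\<Sum>j<k. \<omega> (F x) ((map (L x) vs)[j := H u (vs ! j)]))"
    if "length vs = k" for vs u
  proof -
    have "list_all2 (\<lambda>f f'. (f has_derivative f') (at x)) (map (\<lambda>v y. L y v) vs) (map (\<lambda>v u. H u v) vs)"
      by (simp add: list_all2_conv_all_nth H)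
    from frechet_derivative_eq[OF mform_has_derivative[OF S T FL alt diff _ this]] that
    show ?thesis by (simp add: o_def)
  qed
  have "local_ext_deriv (\<lambda>y vs. \<omega> (F y) (map (L y) vs)) x us
    = (\<Sum>i<Suc k. (-1) ^ i * fderiv (\<lambda>z. \<omega> z (map (L x) (take i us @ drop (Suc i) us))) (F x) (L x (us ! i)))
     + (\<Sum>i<Suc k. (-1) ^ i * (\<Sum>j<k. \<omega> (F x) ((map (L x) (take i us @ drop (Suc i) us))[j := H (us ! i) ((take i us @ drop (Suc i) us) ! j)])))"
    unfolding local_ext_deriv_def len sum.distrib[symmetric]
    by (rule sum.cong[OF refl], subst D) (use len in \<open>auto simp: algebra_simps\<close>)
  also have "\<dots> = local_ext_deriv \<omega> (F x) (map (L x) us)"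
    unfolding symmetric_terms_cancel[where H = H and L = "L x", OF sym alt_skew[OF alt[OF Fx]] len] add_0_right
    using len by (auto simp: local_ext_deriv_def take_map drop_map simp del: sum.lessThan_Suc intro!: sum.cong)
  finally show ?thesis by (simp add: L_def)
qed


section \<open>Linear algebra of the \<open>G\<^sub>2\<close>-form\<close>

lemma exhaust_7:
  fixes x :: 7
  shows "x = 1 \<or> x = 2 \<or> x = 3 \<or> x = 4 \<or> x = 5 \<or> x = 6 \<or> x = 7"
proof (induct x)
  case (of_int z)
  then have "z = 0 \<or> z = 1 \<or> z = 2 \<or> z = 3 \<or> z = 4 \<or> z = 5 \<or> z = 6" by fastforce
  then show ?case by auto
qed

lemma UNIV_7: "UNIV = {1, 2, 3, 4, 5, 6, 7::7}"
  using exhaust_7 by auto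

lemma sum_7: "sum f (UNIV::7 set) = f 1 + f 2 + f 3 + f 4 + f 5 + f 6 + f 7"
  unfolding UNIV_7 by (simp add: ac_simps)

lemma dx3_eq:
  "dx3 i j k [u, v, w] = u $ i * (v $ j * w $ k - w $ j * v $ k) - v $ i * (u $ j * w $ k - w $ j * u $ k)
     + w $ i * (u $ j * v $ k - v $ j * u $ k)"
proof -
  have "skew 2 (wedge 1 1 (dx j) (dx k))"
    using wedge_skew[of 1 1 "dx j" "dx k"] by (simp only: one_add_one)
  then show ?thesis
    unfolding dx3_def wedge_1_2[OF \<open>skew 2 (wedge 1 1 (dx j) (dx k))\<close>] wedge_1_1 by (simp add: dx_def)
qed

definition cross7 :: "real ^ 7 \<Rightarrow> real ^ 7 \<Rightarrow> real ^ 7" where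
  "cross7 r u = (\<chi> i. phi0 [r, u, axis i 1])"

lemma cross7_inner: "cross7 r u \<bullet> v = phi0 [r, u, v]"
  by (simp add: cross7_def inner_vec_def sum_7 phi0_def dx3_eq axis_def) (simp add: algebra_simps)

text \<open>The norm identity of the octonionic cross product, checked as a polynomial identity.
  Beyond multilinearity and skew symmetry, nothing else about the coefficients of
  \<open>phi0\<close> enters the argument.\<close>

lemma cross7_norm: "cross7 r u \<bullet> cross7 r u = (r \<bullet> r) * (u \<bullet> u) - (r \<bullet> u)\<^sup>2"
  by (simp add: cross7_def inner_vec_def sum_7 phi0_def dx3_eq axis_def) (simp add: algebra_simps power2_eq_square)

lemma phi0_skew: "phi0 [u, v, w] = - phi0 [v, u, w]" "phi0 [u, v, w] = - phi0 [u, w, v]"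
  by (simp_all add: phi0_def dx3_eq) (simp_all add: algebra_simps)

lemma cross7_add: "cross7 r (u + v) = cross7 r u + cross7 r v"
  by (simp add: cross7_def phi0_def dx3_eq vec_eq_iff algebra_simps)

text \<open>Polarisation of \<open>cross7_norm\<close> in its second argument.\<close>

lemma cross7_inner_cross7:
  "cross7 r u \<bullet> cross7 r v = (r \<bullet> r) * (u \<bullet> v) - (r \<bullet> u) * (r \<bullet> v)"
  using cross7_norm[of r "u + v"] cross7_norm[of r u] cross7_norm[of r v]
  by (simp add: cross7_add inner_add_left inner_add_right inner_commute power2_eq_square algebra_simps)

lemma cross7_inner_self: "r \<bullet> cross7 r u = 0"
  using phi0_skew[of r u r] phi0_skew(1)[of r r u] cross7_inner[of r u r] by (simp add: inner_commute)

lemma orthogonal_vector_exists: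
  fixes xs :: "(real ^ 'n) list"
  assumes "length xs < CARD('n)"
  shows "\<exists>x. x \<noteq> 0 \<and> (\<forall>v\<in>set xs. v \<bullet> x = 0)"
proof -
  have "dim (set xs) < DIM(real ^ 'n)"
    using dim_le_card'[of "set xs"] card_length[of xs] assms by simp
  from orthogonal_to_subspace_exists[OF this] show ?thesis
    by (metis orthogonal_def inner_commute span_base)
qed

text \<open>The plane spanned by u and r \<times> u is orthogonal, for the contraction of
  \<open>phi0\<close> with r, to the plane spanned by v and r \<times> v. Each of the four values is
  an inner product of cross products, up to sign.\<close>

lemma cross7_pairs_vanish:
  assumes "r \<bullet> u = 0" "r \<bullet> v = 0" "u \<bullet> v = 0" "cross7 r u \<bullet> v = 0"
  shows "phi0 [r, u, v] = 0" "phi0 [r, u, cross7 r v] = 0" "phi0 [r, cross7 r u, v] = 0" "phi0 [r, cross7 r u, cross7 r v] = 0"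
proof -
  show "phi0 [r, u, v] = 0" "phi0 [r, u, cross7 r v] = 0" "phi0 [r, cross7 r u, cross7 r v] = 0"
    using assms cross7_inner_self[of r u] by (simp_all add: cross7_inner_cross7 flip: cross7_inner)
  have "phi0 [r, v, cross7 r u] = 0"
    using assms by (simp add: cross7_inner_cross7 inner_commute flip: cross7_inner)
  then show "phi0 [r, cross7 r u, v] = 0"
    using phi0_skew(2)[of r "cross7 r u" v] by simp
qed

text \<open>The basis is a, r \<times> a, c, r \<times> c, e, r \<times> e, with c and e chosen
  orthogonal to r and to all earlier vectors. At most five conditions arise in dimension 7, so a
  nonzero choice exists. A pair u, r \<times> u has value |r|^2 |u|^2.\<close>

lemma phi0_symplectic_basis:
  assumes r: "r \<noteq> 0"
  obtains a b c d e f where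
    "phi0 [r, a, b] \<noteq> 0" "phi0 [r, c, d] \<noteq> 0" "phi0 [r, e, f] \<noteq> 0"
    "\<And>u v. u \<in> {a, b} \<Longrightarrow> v \<in> {c, d, e, f} \<Longrightarrow> phi0 [r, u, v] = 0"
    "\<And>u v. u \<in> {c, d} \<Longrightarrow> v \<in> {e, f} \<Longrightarrow> phi0 [r, u, v] = 0"
proof -
  obtain a where a: "a \<noteq> 0" "r \<bullet> a = 0"
    using orthogonal_vector_exists[of "[r]"] by force
  have "\<exists>c. c \<noteq> 0 \<and> r \<bullet> c = 0 \<and> a \<bullet> c = 0 \<and> cross7 r a \<bullet> c = 0"
    using orthogonal_vector_exists[of "[r, a, cross7 r a]"] by simp
  then obtain c where c: "c \<noteq> 0" "r \<bullet> c = 0" "a \<bullet> c = 0" "cross7 r a \<bullet> c = 0"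
    by blast
  have "\<exists>e. e \<noteq> 0 \<and> r \<bullet> e = 0 \<and> a \<bullet> e = 0 \<and> cross7 r a \<bullet> e = 0 \<and> c \<bullet> e = 0 \<and> cross7 r c \<bullet> e = 0"
    using orthogonal_vector_exists[of "[r, a, cross7 r a, c, cross7 r c]"] by simp
  then obtain e where e: "e \<noteq> 0" "r \<bullet> e = 0" "a \<bullet> e = 0" "cross7 r a \<bullet> e = 0" "c \<bullet> e = 0" "cross7 r c \<bullet> e = 0"
    by blast
  have "phi0 [r, u, cross7 r u] \<noteq> 0" if "u \<noteq> 0" "r \<bullet> u = 0" for u
    using r that cross7_norm[of r u] by (simp flip: cross7_inner)
  then show ?thesis
    using a c e cross7_pairs_vanish
    by (intro that[of a "cross7 r a" c "cross7 r c" e "cross7 r e"]) auto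
qed

definition G2_form :: "(real ^ 7) mform \<Rightarrow> bool" where
  "G2_form \<phi> \<longleftrightarrow> (\<exists>P. linear P \<and> bij P \<and> (\<forall>u v w. \<phi> [u, v, w] = phi0 [P u, P v, P w]))"

text \<open>The contraction of a \<open>G\<^sub>2\<close>-form with \<open>r \<noteq> 0\<close> has kernel spanned by \<open>r\<close>, so it has
  maximal rank on any hyperplane not containing \<open>r\<close>.\<close>

lemma G2_form_contraction_cube:
  assumes G2: "G2_form \<phi>" and r: "r \<noteq> 0" and \<beta>: "linear \<beta>" "\<beta> r \<noteq> (0::real)"
  obtains vs where "length vs = 6" "\<And>v. v \<in> set vs \<Longrightarrow> \<beta> v = 0"
    "wedge_power 2 (\<lambda>us. \<phi> (r # us)) 3 vs \<noteq> 0"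
proof -
  obtain P where P: "linear P" "bij P" "\<And>u v w. \<phi> [u, v, w] = phi0 [P u, P v, P w]"
    using G2 unfolding G2_form_def by blast
  have "P r \<noteq> 0"
    using r P(1,2) linear_injective_0[OF P(1)] by (auto simp: bij_def)
  from phi0_symplectic_basis[OF this] obtain a b c d e f where
    nz: "phi0 [P r, a, b] \<noteq> 0" "phi0 [P r, c, d] \<noteq> 0" "phi0 [P r, e, f] \<noteq> 0"
    and z: "\<And>u v. u \<in> {a, b} \<Longrightarrow> v \<in> {c, d, e, f} \<Longrightarrow> phi0 [P r, u, v] = 0"
    "\<And>u v. u \<in> {c, d} \<Longrightarrow> v \<in> {e, f} \<Longrightarrow> phi0 [P r, u, v] = 0"
    by metis
  \<comment> \<open>Q pulls a vector back by P and corrects it by a multiple of r, so that it falls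
    into the kernel of \<beta>. The contraction annihilates r, so its values are not affected by the
    correction.\<close>
  define Q where "Q v = inv P v - (\<beta> (inv P v) / \<beta> r) *\<^sub>R r" for v
  have PQ: "P (Q v) = v - (\<beta> (inv P v) / \<beta> r) *\<^sub>R P r" for v
    using P(1,2) by (simp add: Q_def linear_diff linear_scale bij_is_surj surj_f_inv_f)
  have 0: "phi0 [s, s, v] = 0" for s v
    using phi0_skew(1)[of s s v] by simp
  have sh: "phi0 [s, u - x *\<^sub>R s, v - y *\<^sub>R s] = phi0 [s, u, v]" for s u v x y
  proof -
    have "phi0 [s, w, v - y *\<^sub>R s] = phi0 [s, w, v]" for w v y
      using phi0_skew(2)[of s w s] 0[of s w] by (simp add: inner_diff_right flip: cross7_inner)
    then show ?thesis by (metis phi0_skew(2))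
  qed
  define \<omega> where "\<omega> us = \<phi> (r # us)" for us
  have \<omega>Q: "\<omega> [Q u, Q v] = phi0 [P r, u, v]" for u v
    by (simp add: \<omega>_def P(3) PQ sh)
  have sk: "skew 2 \<omega>"
    unfolding skew_2_iff \<omega>_def P(3) by (intro allI) (rule phi0_skew(2))
  have "wedge_power 2 \<omega> 3 [Q a, Q b, Q c, Q d, Q e, Q f] = 6 * \<omega> [Q a, Q b] * \<omega> [Q c, Q d] * \<omega> [Q e, Q f]"
    by (rule wedge_power_2_3_symplectic[OF sk]) (simp_all add: \<omega>Q z)
  also have "\<dots> \<noteq> 0"
    by (simp add: \<omega>Q nz)
  finally have "wedge_power 2 (\<lambda>us. \<phi> (r # us)) 3 [Q a, Q b, Q c, Q d, Q e, Q f] \<noteq> 0"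
    by (simp add: \<omega>_def[abs_def])
  moreover have "\<beta> (Q v) = 0" for v
    using \<beta> by (simp add: Q_def linear_diff linear_scale)
  ultimately show ?thesis
    by (intro that[of "[Q a, Q b, Q c, Q d, Q e, Q f]"]) auto
qed

text \<open>Proportionality is required on the entries of vs alone, since d\<alpha> is a multiple of
  the contraction of \<phi> only on the kernel of \<alpha>.\<close>

lemma wedge_power_cong:
  assumes "\<And>u v. u \<in> set vs \<Longrightarrow> v \<in> set vs \<Longrightarrow> \<tau> [u, v] = h * \<omega> [u, v]"
  shows "length vs = 2 * n \<Longrightarrow> wedge_power 2 \<tau> n vs = h ^ n * wedge_power 2 \<omega> n vs"
  using assms
proof (induction n arbitrary: vs)
  case (Suc n)
  have "wedge 2 (2 * n) \<tau> (wedge_power 2 \<tau> n) vs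
    = wedge 2 (2 * n) (\<lambda>us. h * \<omega> us + 0 * \<omega> us) (\<lambda>us. h ^ n * wedge_power 2 \<omega> n us + 0 * wedge_power 2 \<omega> n us) vs"
  proof (rule wedge_cong)
    fix us :: "'a list" assume "length us = 2" "set us \<subseteq> set vs"
    moreover from this obtain u v where "us = [u, v]"
      by (auto simp: numeral_2_eq_2 length_Suc_conv)
    ultimately show "\<tau> us = h * \<omega> us + 0 * \<omega> us" using Suc.prems(2) by simp
  next
    fix us :: "'a list" assume "length us = 2 * n" "set us \<subseteq> set vs"
    then show "wedge_power 2 \<tau> n us = h ^ n * wedge_power 2 \<omega> n us + 0 * wedge_power 2 \<omega> n us"
      using Suc.IH[of us] Suc.prems(2) by (simp add: subset_iff)
  qed (use Suc.prems in simp)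
  also have "\<dots> = h ^ Suc n * wedge 2 (2 * n) \<omega> (wedge_power 2 \<omega> n) vs"
    unfolding wedge_lincomb_left wedge_lincomb_right by simp
  finally show ?case by simp
qed simp

text \<open>Evaluate on r followed by six vectors in the kernel of a. The antiderivation rule leaves
  a(r) times \<tau>^3 on those vectors, because a vanishes on all of them.\<close>

lemma wedge_1_wedge_power_nonzero:
  assumes G2: "G2_form \<phi>" and r: "r \<noteq> 0" and a: "alt 1 a" "a [r] \<noteq> 0" and \<tau>: "skew 2 \<tau>"
    and h: "h \<noteq> 0" "\<And>u v. a [u] = 0 \<Longrightarrow> a [v] = 0 \<Longrightarrow> \<tau> [u, v] = h * \<phi> [r, u, v]"
  obtains vs where "length vs = 7" "wedge 1 6 a (wedge_power 2 \<tau> 3) vs \<noteq> 0"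
proof -
  have lin: "linear (\<lambda>v. a [v])"
    using alt_linear[OF a(1), of "[]"] by simp
  obtain vs where vs: "length vs = 6" "\<And>v. v \<in> set vs \<Longrightarrow> a [v] = 0" "wedge_power 2 (\<lambda>us. \<phi> (r # us)) 3 vs \<noteq> 0"
    using G2_form_contraction_cube[OF G2 r lin a(2)] by metis
  have sk: "skew 6 (wedge_power 2 \<tau> 3)"
    using wedge_skew[of 2 4 \<tau> "wedge_power 2 \<tau> 2"] by (simp add: eval_nat_numeral)
  have "wedge_power 2 \<tau> 3 vs = h ^ 3 * wedge_power 2 (\<lambda>us. \<phi> (r # us)) 3 vs"
    by (rule wedge_power_cong) (use vs h in auto)
  then have nz: "wedge_power 2 \<tau> 3 vs \<noteq> 0" using vs h by simp
  have "wedge 1 5 a (\<lambda>us. wedge_power 2 \<tau> 3 (r # us)) vs = wedge 1 5 (\<lambda>_. 0) (\<lambda>us. wedge_power 2 \<tau> 3 (r # us)) vs"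
  proof (rule wedge_cong)
    fix us :: "(real ^ 7) list" assume "length us = 1" "set us \<subseteq> set vs"
    then show "a us = 0" using vs(2) by (auto simp: length_Suc_conv)
  qed (use vs in auto)
  then have "wedge 1 6 a (wedge_power 2 \<tau> 3) (r # vs) = a [r] * wedge_power 2 \<tau> 3 vs"
    using wedge_Cons[OF alt_skew[OF a(1)] sk, of vs r] vs wedge_zero_degree_left[OF sk vs(1)]
    by (simp add: wedge_zero_left)
  then show ?thesis
    using nz a(2) vs(1) by (intro that[of "r # vs"]) auto
qed

text \<open>The contraction of \<omega> with r is 0, so r passes both factors \<omega> without a
  sign and reaches \<phi>, where it produces a third factor \<omega>.\<close>

lemma wedge_contraction_square_nonzero:
  assumes G2: "G2_form \<phi>" and \<phi>: "alt 3 \<phi>" and r: "r \<noteq> 0"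
    and \<omega>: "skew 2 \<omega>" "\<And>u v. \<omega> [u, v] = \<phi> [r, u, v]"
  obtains vs where "length vs = 7" "wedge 2 5 \<omega> (wedge 2 3 \<omega> \<phi>) vs \<noteq> 0"
proof -
  \<comment> \<open>Any hyperplane missing r will do; a coordinate that is nonzero at r defines
    one.\<close>
  obtain i where "r $ i \<noteq> 0" using r by (auto simp: vec_eq_iff)
  moreover have "linear (\<lambda>v :: real ^ 7. v $ i)"
    using bounded_linear.linear[OF bounded_linear_vec_nth] .
  ultimately obtain vs where vs: "length vs = 6" "wedge_power 2 (\<lambda>us. \<phi> (r # us)) 3 vs \<noteq> 0"
    using G2_form_contraction_cube[OF G2 r] by metis
  have \<omega>\<phi>: "\<omega> us = \<phi> (r # us)" if "length us = 2" for us
    using that \<omega>(2) by (auto simp: numeral_2_eq_2 length_Suc_conv)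
  have "wedge_power 2 \<omega> 3 vs = 1 ^ 3 * wedge_power 2 (\<lambda>us. \<phi> (r # us)) 3 vs"
    by (rule wedge_power_cong) (use vs \<omega>\<phi> in auto)
  then have nz: "wedge 2 4 \<omega> (wedge 2 2 \<omega> \<omega>) vs \<noteq> 0"
    using vs wedge_power_2_3[OF \<omega>(1)] by simp
  have \<omega>r: "\<omega> (r # us) = 0" if us: "length us = 1" for us
  proof -
    obtain u where "us = [u]" using us by (cases us) auto
    then show ?thesis using \<omega>(2)[of r u] skew_eq_0[OF alt_skew[OF \<phi>], of 0 1 "[r, r, u]"] by simp
  qed
  have zero: "wedge 1 l (\<lambda>us. \<omega> (r # us)) \<eta> us = 0" if "length us = 1 + l" for l \<eta> us
  proof -
    have "wedge 1 l (\<lambda>us. \<omega> (r # us)) \<eta> us = wedge 1 l (\<lambda>_. 0) \<eta> us"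
      by (rule wedge_cong) (use that \<omega>r in auto)
    then show ?thesis by (simp add: wedge_zero_left)
  qed
  have sk5: "skew 5 (wedge 2 3 \<omega> \<phi>)" using wedge_skew[of 2 3 \<omega> \<phi>] by simp
  have in4: "wedge 2 3 \<omega> \<phi> (r # us) = wedge 2 2 \<omega> \<omega> us" if "length us = 4" for us
  proof -
    have "wedge 2 2 \<omega> (\<lambda>us. \<phi> (r # us)) us = wedge 2 2 \<omega> \<omega> us"
      by (rule wedge_cong) (use that \<omega>\<phi> in auto)
    then show ?thesis
      using wedge_Cons[OF \<omega>(1) alt_skew[OF \<phi>], of us r] zero[of us 3] that by simp
  qed
  have "wedge 2 4 \<omega> (\<lambda>us. wedge 2 3 \<omega> \<phi> (r # us)) vs = wedge 2 4 \<omega> (wedge 2 2 \<omega> \<omega>) vs"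
    by (rule wedge_cong) (use vs in4 in auto)
  then have "wedge 2 5 \<omega> (wedge 2 3 \<omega> \<phi>) (r # vs) = wedge 2 4 \<omega> (wedge 2 2 \<omega> \<omega>) vs"
    using wedge_Cons[OF \<omega>(1) sk5, of vs r] zero[of vs 5] vs by simp
  then show ?thesis
    using nz vs by (intro that[of "r # vs"]) auto
qed


section \<open>Forms on a smooth atlas\<close>

locale smooth_atlas =
  fixes M :: "'a topology" and A :: "('a, 'n::finite) chart set"
  assumes manifold: "smooth_manifold M A"
begin

definition jac :: "('a, 'n) chart \<Rightarrow> ('a, 'n) chart \<Rightarrow> real ^ 'n \<Rightarrow> real ^ 'n \<Rightarrow> real ^ 'n" where
  "jac c c' x = fderiv (transition c c') x"

definition overlap :: "('a, 'n) chart \<Rightarrow> ('a, 'n) chart \<Rightarrow> (real ^ 'n) set" where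
  "overlap c c' = chart_map c ` (chart_dom c \<inter> chart_dom c')"

section \<open>Charts and transition maps\<close>

lemma chart: "c \<in> A \<Longrightarrow> is_chart M c"
  using manifold by (simp add: smooth_manifold_def)

lemma chart_dom_open: "c \<in> A \<Longrightarrow> openin M (chart_dom c)"
  using chart by (simp add: is_chart_def)

lemma chart_dom_subset: "c \<in> A \<Longrightarrow> chart_dom c \<subseteq> topspace M"
  using chart_dom_open openin_subset by blast

lemma chart_range_open: "c \<in> A \<Longrightarrow> open (chart_range c)"
  using chart by (simp add: is_chart_def)

lemma chart_homeomorphic:
  "c \<in> A \<Longrightarrow> homeomorphic_map (subtopology M (chart_dom c)) (top_of_set (chart_range c)) (chart_map c)"
  using chart by (simp add: is_chart_def)

lemma chart_inj: "c \<in> A \<Longrightarrow> inj_on (chart_map c) (chart_dom c)"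
  using homeomorphic_imp_injective_map[OF chart_homeomorphic] chart_dom_subset
  by (simp add: Int_absorb1)

lemma chart_cover: "p \<in> topspace M \<Longrightarrow> \<exists>c\<in>A. p \<in> chart_dom c"
  using manifold by (auto simp: smooth_manifold_def)

lemma chart_inv_map [simp]: "c \<in> A \<Longrightarrow> p \<in> chart_dom c \<Longrightarrow> chart_inv c (chart_map c p) = p"
  by (simp add: chart_inv_def chart_inj inv_into_f_f)

lemma chart_map_inv [simp]: "x \<in> chart_range c \<Longrightarrow> chart_map c (chart_inv c x) = x"
  by (simp add: chart_inv_def f_inv_into_f)

lemma chart_inv_in: "x \<in> chart_range c \<Longrightarrow> chart_inv c x \<in> chart_dom c"
  by (simp add: chart_inv_def inv_into_into)

lemma chart_inv_topspace: "c \<in> A \<Longrightarrow> x \<in> chart_range c \<Longrightarrow> chart_inv c x \<in> topspace M"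
  by (rule subsetD[OF chart_dom_subset chart_inv_in])

lemma chart_image_open:
  assumes "c \<in> A" "openin M U" "U \<subseteq> chart_dom c"
  shows "open (chart_map c ` U)"
proof -
  have "openin (subtopology M (chart_dom c)) U"
    using assms by (auto simp: openin_subtopology)
  then have "openin (top_of_set (chart_range c)) (chart_map c ` U)"
    using homeomorphic_imp_open_map[OF chart_homeomorphic[OF assms(1)]] by (simp add: open_map_def)
  then show ?thesis
    using chart_range_open[OF assms(1)] openin_open_eq by blast
qed

lemma chart_vimage_open:
  assumes "c \<in> A" "open V"
  shows "openin M {p \<in> chart_dom c. chart_map c p \<in> V}"
proof -
  have "continuous_map (subtopology M (chart_dom c)) (top_of_set (chart_range c)) (chart_map c)"
    using chart_homeomorphic[OF assms(1)] homeomorphic_eq_everything_map by blast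
  then have "openin (subtopology M (chart_dom c)) {p \<in> topspace (subtopology M (chart_dom c)). chart_map c p \<in> chart_range c \<inter> V}"
    by (rule openin_continuous_map_preimage) (rule openin_open_Int[OF assms(2)])
  moreover have "{p \<in> topspace (subtopology M (chart_dom c)). chart_map c p \<in> chart_range c \<inter> V} = {p \<in> chart_dom c. chart_map c p \<in> V}"
    using chart_dom_subset[OF assms(1)] by auto
  ultimately show ?thesis
    using openin_trans_full chart_dom_open[OF assms(1)] by metis
qed

lemma overlap_open: "c \<in> A \<Longrightarrow> c' \<in> A \<Longrightarrow> open (overlap c c')"
  unfolding overlap_def by (intro chart_image_open openin_Int chart_dom_open) auto

lemma overlapI: "p \<in> chart_dom c \<Longrightarrow> p \<in> chart_dom c' \<Longrightarrow> chart_map c p \<in> overlap c c'"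
  by (auto simp: overlap_def)

lemma overlap_iff: "c \<in> A \<Longrightarrow> x \<in> overlap c c' \<longleftrightarrow> x \<in> chart_range c \<and> chart_inv c x \<in> chart_dom c'"
  by (auto simp: overlap_def chart_inv_in intro!: image_eqI[of _ _ "chart_inv c x"])

lemma transition_eq: "transition c c' x = chart_map c' (chart_inv c x)"
  by (simp add: transition_def)

lemma transition_inv: "c' \<in> A \<Longrightarrow> c \<in> A \<Longrightarrow> x \<in> overlap c c' \<Longrightarrow> chart_inv c' (transition c c' x) = chart_inv c x"
  by (simp add: transition_eq overlap_iff)

lemma transition_in: "c \<in> A \<Longrightarrow> c' \<in> A \<Longrightarrow> x \<in> overlap c c' \<Longrightarrow> transition c c' x \<in> overlap c' c"
  by (simp add: transition_eq overlap_iff chart_inv_in)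

lemma transition_Ck: "c \<in> A \<Longrightarrow> c' \<in> A \<Longrightarrow> Ck_on k (overlap c c') (transition c c')"
  using manifold unfolding smooth_manifold_def smooth_on_def overlap_def by blast

lemma transition_differentiable:
  "c \<in> A \<Longrightarrow> c' \<in> A \<Longrightarrow> x \<in> overlap c c' \<Longrightarrow> transition c c' differentiable (at x)"
  using transition_Ck[of c c' 1] by simp

lemma jac_has_derivative:
  "c \<in> A \<Longrightarrow> c' \<in> A \<Longrightarrow> x \<in> overlap c c' \<Longrightarrow> (transition c c' has_derivative jac c c' x) (at x)"
  unfolding jac_def by (intro has_derivative_frechet transition_differentiable)

lemma jac_linear: "c \<in> A \<Longrightarrow> c' \<in> A \<Longrightarrow> x \<in> overlap c c' \<Longrightarrow> linear (jac c c' x)"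
  using has_derivative_linear[OF jac_has_derivative] .

lemma jac_self:
  assumes "c \<in> A" "x \<in> chart_range c"
  shows "jac c c x u = u"
proof -
  have "((\<lambda>x. x) has_derivative (\<lambda>x. x)) (at x)" by simp
  then have "(transition c c has_derivative (\<lambda>x. x)) (at x)"
    by (rule has_derivative_transform_within_open[OF _ chart_range_open[OF assms(1)] assms(2)])
      (simp add: transition_eq)
  then show ?thesis by (simp add: jac_def frechet_derivative_eq)
qed

lemma jac_compose:
  assumes "c \<in> A" "c' \<in> A" "c'' \<in> A" "x \<in> overlap c c'" "x \<in> overlap c c''"
  shows "jac c' c'' (transition c c' x) (jac c c' x u) = jac c c'' x u"
proof -
  let ?S = "overlap c c' \<inter> overlap c c''"
  have "transition c c' x \<in> overlap c' c''"
    using assms by (simp add: transition_eq overlap_iff)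
  from has_derivative_compose[OF jac_has_derivative jac_has_derivative, OF assms(1,2,4,2,3) this]
  have "((\<lambda>x. transition c' c'' (transition c c' x)) has_derivative (\<lambda>u. jac c' c'' (transition c c' x) (jac c c' x u))) (at x)"
    by simp
  then have "(transition c c'' has_derivative (\<lambda>u. jac c' c'' (transition c c' x) (jac c c' x u))) (at x)"
  proof (rule has_derivative_transform_within_open)
    show "open ?S" "x \<in> ?S" using assms by (auto simp: overlap_open)
    show "transition c' c'' (transition c c' y) = transition c c'' y" if "y \<in> ?S" for y
      using that assms by (simp add: transition_eq overlap_iff)
  qed
  then show ?thesis by (simp add: jac_def frechet_derivative_eq)
qed

section \<open>Tangent vectors and pointwise forms in a chart\<close>

lemma chart_vec_eq:
  "chart_vec A c p u c' = (if c' \<in> A \<and> p \<in> chart_dom c' then jac c c' (chart_map c p) u else 0)"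
  by (simp add: chart_vec_def jac_def)

lemma chart_vec_self: "c \<in> A \<Longrightarrow> p \<in> chart_dom c \<Longrightarrow> chart_vec A c p u c = u"
  by (simp add: chart_vec_eq jac_self)

lemma chart_vec_tangent:
  assumes "c \<in> A" "p \<in> chart_dom c"
  shows "chart_vec A c p u \<in> tangent_space A p"
proof -
  have *: "jac c d' (chart_map c p) u = fderiv (transition d d') (chart_map d p) (jac c d (chart_map c p) u)"
    if "d \<in> A" "d' \<in> A" "p \<in> chart_dom d" "p \<in> chart_dom d'" for d d'
    using jac_compose[of c d d' "chart_map c p" u] assms that by (simp add: overlapI transition_eq flip: jac_def)
  show ?thesis
    unfolding tangent_space_def
  proof (intro CollectI conjI ballI allI impI)
    fix d d' assume "d \<in> A" "d' \<in> A" "p \<in> chart_dom d" "p \<in> chart_dom d'"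
    with *[OF this] show "chart_vec A c p u d' = fderiv (transition d d') (chart_map d p) (chart_vec A c p u d)"
      by (simp add: chart_vec_eq)
  qed (auto simp: chart_vec_eq)
qed

lemma tangent_change:
  assumes "v \<in> tangent_space A p" "c \<in> A" "c' \<in> A" "p \<in> chart_dom c" "p \<in> chart_dom c'"
  shows "jac c c' (chart_map c p) (v c) = v c'"
proof -
  have "v c' = fderiv (transition c c') (chart_map c p) (v c)"
    using assms unfolding tangent_space_def by blast
  then show ?thesis by (simp only: jac_def)
qed

lemma chart_vec_component:
  assumes "v \<in> tangent_space A p" "c \<in> A" "p \<in> chart_dom c"
  shows "chart_vec A c p (v c) = v"
proof
  fix c'
  show "chart_vec A c p (v c) c' = v c'"
  proof (cases "c' \<in> A \<and> p \<in> chart_dom c'")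
    case True
    then show ?thesis using tangent_change[OF assms(1,2) _ assms(3), of c'] by (simp add: chart_vec_eq)
  next
    case False
    then have "v c' = 0" using assms(1) unfolding tangent_space_def by blast
    then show ?thesis using False by (auto simp: chart_vec_eq)
  qed
qed

lemma chart_vec_change:
  assumes "c \<in> A" "c' \<in> A" "p \<in> chart_dom c" "p \<in> chart_dom c'"
  shows "chart_vec A c' p (jac c c' (chart_map c p) u) = chart_vec A c p u"
  using chart_vec_component[OF chart_vec_tangent[OF assms(1,3)] assms(2,4), of u] assms by (simp add: chart_vec_eq)

lemma chart_vec_lincomb:
  assumes "c \<in> A" "p \<in> chart_dom c"
  shows "chart_vec A c p (a *\<^sub>R u + b *\<^sub>R v) = (\<lambda>c'. a *\<^sub>R chart_vec A c p u c' + b *\<^sub>R chart_vec A c p v c')"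
proof
  fix c'
  show "chart_vec A c p (a *\<^sub>R u + b *\<^sub>R v) c' = a *\<^sub>R chart_vec A c p u c' + b *\<^sub>R chart_vec A c p v c'"
  proof (cases "c' \<in> A \<and> p \<in> chart_dom c'")
    case True
    then have "linear (jac c c' (chart_map c p))"
      using assms by (intro jac_linear) (auto simp: overlapI)
    then show ?thesis using True by (simp add: chart_vec_eq linear_add linear_scale)
  qed (auto simp: chart_vec_eq)
qed

lemma tangent_scaleR:
  assumes "v \<in> tangent_space A p" "p \<in> topspace M"
  shows "(\<lambda>c. a *\<^sub>R v c) \<in> tangent_space A p"
proof -
  obtain c where c: "c \<in> A" "p \<in> chart_dom c" using chart_cover assms(2) by blast
  have "chart_vec A c p (a *\<^sub>R v c) = (\<lambda>c. a *\<^sub>R v c)"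
    using chart_vec_lincomb[OF c, of a "v c" 0 0] chart_vec_component[OF assms(1) c] by simp
  then show ?thesis using chart_vec_tangent[OF c] by metis
qed

text \<open>\<open>alternating_form\<close> prescribes vanishing on repeated entries. Skewness
  follows by expanding the value 0 obtained with u + v in two adjacent slots.\<close>

lemma local_form_alt:
  assumes "c \<in> A" "x \<in> chart_range c" and alt: "alternating_form (tangent_space A (chart_inv c x)) k (\<omega> (chart_inv c x))"
  shows "alt k (local_form A c \<omega> x)"
proof -
  define p where "p = chart_inv c x"
  define \<psi> where "\<psi> = local_form A c \<omega> x"
  have p: "p \<in> chart_dom c" using assms(2) by (simp add: p_def chart_inv_in)
  let ?V = "chart_vec A c p"
  have alt': "alternating_form (tangent_space A p) k (\<omega> p)"
    using alt by (simp only: p_def)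
  note linear = alt'[unfolded alternating_form_def, THEN conjunct1, rule_format]
  note alternating = alt'[unfolded alternating_form_def, THEN conjunct2, rule_format]
  have \<psi>: "\<psi> us = \<omega> p (map ?V us)" for us
    by (simp add: \<psi>_def local_form_def p_def)
  have T: "set (map ?V us) \<subseteq> tangent_space A p" for us
    using chart_vec_tangent[OF assms(1) p] by auto
  have lin: "\<psi> (xs @ (a *\<^sub>R u + b *\<^sub>R v) # ys) = a * \<psi> (xs @ u # ys) + b * \<psi> (xs @ v # ys)"
    if "Suc (length xs + length ys) = k" for xs ys a b u v
  proof -
    let ?vs = "map ?V (xs @ 0 # ys)"
    have up: "map ?V (xs @ w # ys) = ?vs[length xs := ?V w]" for w
      by (simp add: list_update_append)
    show ?thesis
      unfolding \<psi> up[of "a *\<^sub>R u + b *\<^sub>R v"] up[of u] up[of v] chart_vec_lincomb[OF assms(1) p]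
      by (rule linear[OF _ T _ chart_vec_tangent[OF assms(1) p] chart_vec_tangent[OF assms(1) p]]) (use that in auto)
  qed
  have zero: "\<psi> (xs @ u # u # ys) = 0" if "length xs + length ys + 2 = k" for xs ys u
    unfolding \<psi>
    by (rule alternating[OF _ T, of _ "length xs" "Suc (length xs)"]) (use that in \<open>auto simp: nth_append\<close>)
  show ?thesis
    unfolding alt_def \<psi>_def[symmetric]
  proof (intro conjI allI impI)
    show "skew k \<psi>"
      unfolding skew_def
    proof (intro allI impI)
      fix xs ys :: "(real ^ 'n) list" and u v assume len: "length xs + length ys + 2 = k"
      have 1: "\<psi> (xs @ (u + v) # w # ys) = \<psi> (xs @ u # w # ys) + \<psi> (xs @ v # w # ys)" for w
        using lin[of xs "w # ys" 1 u 1 v] len by simp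
      have 2: "\<psi> (xs @ w # (u + v) # ys) = \<psi> (xs @ w # u # ys) + \<psi> (xs @ w # v # ys)" for w
        using lin[of "xs @ [w]" ys 1 u 1 v] len by simp
      show "\<psi> (xs @ u # v # ys) = - \<psi> (xs @ v # u # ys)"
        using zero[OF len, of u] zero[OF len, of v] zero[OF len, of "u + v"] unfolding 1 2 by simp
    qed
    fix us :: "(real ^ 'n) list" assume "Suc (length us) = k"
    then show "linear (\<lambda>u. \<psi> (u # us))"
      using lin[of "[]" us 1 _ 1 _] lin[of "[]" us _ _ 0 0] by (intro linearI) simp_all
  qed
qed

lemma local_form_change:
  assumes "c \<in> A" "c' \<in> A" "x \<in> overlap c c'"
  shows "local_form A c \<omega> x us = local_form A c' \<omega> (transition c c' x) (map (jac c c' x) us)"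
proof -
  have p: "chart_inv c x \<in> chart_dom c" "chart_inv c x \<in> chart_dom c'" "chart_map c (chart_inv c x) = x"
    using assms by (auto simp: overlap_iff chart_inv_in)
  show ?thesis
    unfolding local_form_def transition_inv[OF assms(2,1,3)]
    using chart_vec_change[OF assms(1,2) p(1,2)] p(3) by (simp add: o_def)
qed

text \<open>A differential \<open>k\<close>-form of class \<open>C\<^sup>j\<close>, given by its local expressions \<open>\<Theta> c\<close> in all charts.\<close>

definition form_family :: "nat \<Rightarrow> nat \<Rightarrow> (('a, 'n) chart \<Rightarrow> real ^ 'n \<Rightarrow> (real ^ 'n) mform) \<Rightarrow> bool" where
  "form_family j k \<Theta> \<longleftrightarrow>
     (\<forall>c\<in>A. \<forall>x\<in>chart_range c. alt k (\<Theta> c x)) \<and>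
     (\<forall>c\<in>A. \<forall>us. length us = k \<longrightarrow> Ck_on j (chart_range c) (\<lambda>x. \<Theta> c x us)) \<and>
     (\<forall>c\<in>A. \<forall>c'\<in>A. \<forall>x\<in>overlap c c'. \<forall>us. length us = k \<longrightarrow>
        \<Theta> c x us = \<Theta> c' (transition c c' x) (map (jac c c' x) us))"

definition Ck_function :: "nat \<Rightarrow> ('a \<Rightarrow> real) \<Rightarrow> bool" where
  "Ck_function j h \<longleftrightarrow> (\<forall>c\<in>A. Ck_on j (chart_range c) (\<lambda>x. h (chart_inv c x)))"

lemma form_family_alt: "form_family j k \<Theta> \<Longrightarrow> c \<in> A \<Longrightarrow> x \<in> chart_range c \<Longrightarrow> alt k (\<Theta> c x)"
  unfolding form_family_def by blast

lemma form_family_Ck: "form_family j k \<Theta> \<Longrightarrow> c \<in> A \<Longrightarrow> length us = k \<Longrightarrow> Ck_on j (chart_range c) (\<lambda>x. \<Theta> c x us)"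
  unfolding form_family_def by blast

lemma form_family_change:
  "form_family j k \<Theta> \<Longrightarrow> c \<in> A \<Longrightarrow> c' \<in> A \<Longrightarrow> x \<in> overlap c c' \<Longrightarrow> length us = k \<Longrightarrow>
    \<Theta> c x us = \<Theta> c' (transition c c' x) (map (jac c c' x) us)"
  unfolding form_family_def by blast

lemma form_family_diff:
  assumes "form_family (Suc j) k \<Theta>" "c \<in> A" "x \<in> chart_range c"
  shows "diff_form_at k (\<Theta> c) x"
  using form_family_Ck[OF assms(1,2), unfolded Ck_on.simps] assms(3) unfolding diff_form_at_def by blast

lemma form_family_local_form:
  assumes "smooth_form M A k \<omega>"
  shows "form_family j k (\<lambda>c. local_form A c \<omega>)"
  unfolding form_family_def
proof (intro conjI ballI allI impI)
  fix c x assume c: "c \<in> A" and x: "x \<in> chart_range c"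
  have "alternating_form (tangent_space A (chart_inv c x)) k (\<omega> (chart_inv c x))"
    using assms chart_inv_topspace[OF c x] by (simp add: smooth_form_def)
  then show "alt k (local_form A c \<omega> x)" by (rule local_form_alt[where \<omega> = \<omega>, OF c x])
next
  fix c and us :: "(real ^ 'n) list" assume "c \<in> A" "length us = k"
  then show "Ck_on j (chart_range c) (\<lambda>x. local_form A c \<omega> x us)"
    using assms unfolding smooth_form_def smooth_on_def by blast
qed (rule local_form_change)

lemma overlap_subset: "overlap c c' \<subseteq> chart_range c"
  by (auto simp: overlap_def)

lemma Ck_on_ext_deriv:
  assumes "open S" "\<And>us. length us = k \<Longrightarrow> Ck_on (Suc j) S (\<lambda>x. \<omega> x us)" "length us = Suc k"
  shows "Ck_on j S (\<lambda>x. local_ext_deriv \<omega> x us)"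
  unfolding local_ext_deriv_def
proof (intro Ck_on_sum[OF assms(1)] Ck_on_mult[OF assms(1)] Ck_on_const)
  fix i assume "i \<in> {..<length us}"
  then show "Ck_on j S (\<lambda>x. fderiv (\<lambda>y. \<omega> y (take i us @ drop (Suc i) us)) x (us ! i))"
    using assms(2)[of "take i us @ drop (Suc i) us"] assms(3) by simp
qed

lemma Ck_on_wedge:
  assumes "open S" "\<And>us. length us = k \<Longrightarrow> Ck_on j S (\<lambda>x. \<omega> x us)" "\<And>us. length us = l \<Longrightarrow> Ck_on j S (\<lambda>x. \<eta> x us)"
  shows "Ck_on j S (\<lambda>x. wedge k l (\<omega> x) (\<eta> x) us)"
  unfolding wedge_def divide_inverse
  by (intro Ck_on_sum[OF assms(1)] Ck_on_mult[OF assms(1)] Ck_on_const assms(2,3)) auto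

text \<open>The class drops by one, and compatibility between charts is naturality of d under
  transition maps.\<close>

lemma form_family_ext_deriv:
  assumes "form_family (Suc j) k \<Theta>"
  shows "form_family j (Suc k) (\<lambda>c. local_ext_deriv (\<Theta> c))"
  unfolding form_family_def
proof (intro conjI ballI allI impI)
  fix c x assume c: "c \<in> A" and x: "x \<in> chart_range c"
  show "alt (Suc k) (local_ext_deriv (\<Theta> c) x)"
    by (rule local_ext_deriv_alt[OF chart_range_open[OF c] x form_family_alt[OF assms c] form_family_diff[OF assms c x]])
next
  fix c and us :: "(real ^ 'n) list" assume c: "c \<in> A" and us: "length us = Suc k"
  show "Ck_on j (chart_range c) (\<lambda>x. local_ext_deriv (\<Theta> c) x us)"
    by (rule Ck_on_ext_deriv[OF chart_range_open[OF c] form_family_Ck[OF assms c] us])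
next
  fix c c' x and us :: "(real ^ 'n) list"
  assume c: "c \<in> A" and c': "c' \<in> A" and x: "x \<in> overlap c c'" and us: "length us = Suc k"
  have sub: "transition c c' ` overlap c c' \<subseteq> chart_range c'"
    using transition_in[OF c c'] overlap_subset by blast
  have "local_ext_deriv (\<Theta> c) x us
    = local_ext_deriv (\<lambda>y vs. \<Theta> c' (transition c c' y) (map (fderiv (transition c c') y) vs)) x us"
    by (rule local_ext_deriv_cong[OF overlap_open[OF c c'] x _ us])
      (rule form_family_change[OF assms c c', unfolded jac_def])
  also have "\<dots> = local_ext_deriv (\<Theta> c') (transition c c' x) (map (fderiv (transition c c') x) us)"
    using sub x
    by (intro local_ext_deriv_pullback[OF overlap_open[OF c c'] x chart_range_open[OF c'] sub transition_Ck[OF c c'] _ _ us]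
        form_family_alt[OF assms c'] form_family_diff[OF assms c']) auto
  finally show "local_ext_deriv (\<Theta> c) x us = local_ext_deriv (\<Theta> c') (transition c c' x) (map (jac c c' x) us)"
    by (simp add: jac_def)
qed

lemma form_family_wedge:
  assumes "form_family j k \<Theta>" "form_family j l \<Psi>"
  shows "form_family j (k + l) (\<lambda>c x. wedge k l (\<Theta> c x) (\<Psi> c x))"
  unfolding form_family_def
proof (intro conjI ballI allI impI)
  fix c x assume c: "c \<in> A" and x: "x \<in> chart_range c"
  show "alt (k + l) (wedge k l (\<Theta> c x) (\<Psi> c x))"
    by (rule wedge_alt[OF form_family_alt[OF assms(1) c x] form_family_alt[OF assms(2) c x]])
next
  fix c and us :: "(real ^ 'n) list" assume c: "c \<in> A"
  show "Ck_on j (chart_range c) (\<lambda>x. wedge k l (\<Theta> c x) (\<Psi> c x) us)"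
    by (rule Ck_on_wedge[OF chart_range_open[OF c] form_family_Ck[OF assms(1) c] form_family_Ck[OF assms(2) c]])
next
  fix c c' x and us :: "(real ^ 'n) list"
  assume c: "c \<in> A" and c': "c' \<in> A" and x: "x \<in> overlap c c'" and us: "length us = k + l"
  show "wedge k l (\<Theta> c x) (\<Psi> c x) us
    = wedge k l (\<Theta> c' (transition c c' x)) (\<Psi> c' (transition c c' x)) (map (jac c c' x) us)"
    unfolding wedge_map[OF us]
    by (rule wedge_cong[OF form_family_change[OF assms(1) c c' x] form_family_change[OF assms(2) c c' x] us])
qed

lemma form_family_scale:
  assumes "Ck_function j h" "form_family j k \<Theta>"
  shows "form_family j k (\<lambda>c x us. h (chart_inv c x) * \<Theta> c x us)"
  unfolding form_family_def
proof (intro conjI ballI allI impI)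
  fix c x assume c: "c \<in> A" and x: "x \<in> chart_range c"
  note alt = form_family_alt[OF assms(2) c x]
  show "alt k (\<lambda>us. h (chart_inv c x) * \<Theta> c x us)"
    unfolding alt_def
  proof (intro conjI allI impI)
    have "h (chart_inv c x) * \<Theta> c x (xs @ u # v # ys) = - (h (chart_inv c x) * \<Theta> c x (xs @ v # u # ys))"
      if "length xs + length ys + 2 = k" for xs u v ys
      using skewD[OF alt_skew[OF alt] that, of u v] by simp
    then show "skew k (\<lambda>us. h (chart_inv c x) * \<Theta> c x us)" unfolding skew_def by blast
    fix us :: "(real ^ 'n) list" assume us: "Suc (length us) = k"
    show "linear (\<lambda>u. h (chart_inv c x) * \<Theta> c x (u # us))"
      using linear_compose_scale_right[OF alt_linear[OF alt us], of "h (chart_inv c x)"] by simp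
  qed
next
  fix c and us :: "(real ^ 'n) list" assume c: "c \<in> A" and us: "length us = k"
  show "Ck_on j (chart_range c) (\<lambda>x. h (chart_inv c x) * \<Theta> c x us)"
    using assms(1) c by (intro Ck_on_mult[OF chart_range_open[OF c]] form_family_Ck[OF assms(2) c us]) (use assms(1) c in \<open>unfold Ck_function_def, blast\<close>)
next
  fix c c' x and us :: "(real ^ 'n) list"
  assume c: "c \<in> A" and c': "c' \<in> A" and x: "x \<in> overlap c c'" and us: "length us = k"
  show "h (chart_inv c x) * \<Theta> c x us = h (chart_inv c' (transition c c' x)) * \<Theta> c' (transition c c' x) (map (jac c c' x) us)"
    using form_family_change[OF assms(2) c c' x us] transition_inv[OF c' c x] by simp
qed

end


section \<open>The contact form\<close>

lemma wedge_power_map: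
  "length vs = k * n \<Longrightarrow> wedge_power k \<omega> n (map f vs) = wedge_power k (\<lambda>us. \<omega> (map f us)) n vs"
proof (induction n arbitrary: vs)
  case (Suc n)
  then have len: "length vs = k + k * n" by simp
  have "wedge k (k * n) \<omega> (wedge_power k \<omega> n) (map f vs)
    = wedge k (k * n) (\<lambda>us. \<omega> (map f us)) (wedge_power k (\<lambda>us. \<omega> (map f us)) n) vs"
    unfolding wedge_map[OF len] by (rule wedge_cong[OF refl Suc.IH len])
  then show ?case by simp
qed simp

lemma alternating_form_scale:
  assumes "alternating_form T k \<omega>" "length vs = k" "set vs \<subseteq> T" "i < k"
  shows "\<omega> (vs[i := (\<lambda>c. a *\<^sub>R (vs ! i) c)]) = a * \<omega> vs"
proof -
  have "vs ! i \<in> T" using assms nth_mem by blast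
  from assms(1)[unfolded alternating_form_def, THEN conjunct1, rule_format, OF assms(2-4) this this, of a 0]
  show ?thesis by simp
qed

context smooth_atlas
begin

text \<open>\<open>ext_deriv\<close> evaluates in a chart picked by choice; compatibility of the
  family shows that every chart around p yields the same value.\<close>

lemma ext_deriv_local:
  assumes "form_family (Suc j) k (\<lambda>c. local_form A c \<omega>)" and c: "c \<in> A" "p \<in> chart_dom c" and us: "length us = Suc k"
  shows "ext_deriv A \<omega> p (map (chart_vec A c p) us) = local_ext_deriv (local_form A c \<omega>) (chart_map c p) us"
proof -
  define c0 where "c0 = (SOME c. c \<in> A \<and> p \<in> chart_dom c)"
  have c0: "c0 \<in> A" "p \<in> chart_dom c0"
    using someI[of "\<lambda>c. c \<in> A \<and> p \<in> chart_dom c" c] c by (simp_all add: c0_def)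
  have "map (\<lambda>v. v c0) (map (chart_vec A c p) us) = map (jac c c0 (chart_map c p)) us"
    using c0 by (simp add: chart_vec_eq)
  then have "ext_deriv A \<omega> p (map (chart_vec A c p) us)
    = local_ext_deriv (local_form A c0 \<omega>) (chart_map c0 p) (map (jac c c0 (chart_map c p)) us)"
    by (simp only: ext_deriv_def Let_def c0_def)
  also have "\<dots> = local_ext_deriv (local_form A c \<omega>) (chart_map c p) us"
    using form_family_change[OF form_family_ext_deriv[OF assms(1)] c(1) c0(1) overlapI[OF c(2) c0(2)] us] c
    by (simp add: transition_eq)
  finally show ?thesis .
qed

lemma smooth_function_Ck: "smooth_function A h \<Longrightarrow> Ck_function j h"
  unfolding smooth_function_def smooth_on_def Ck_function_def o_def by blast

lemma Ck_functionD: "Ck_function j h \<Longrightarrow> c \<in> A \<Longrightarrow> Ck_on j (chart_range c) (\<lambda>x. h (chart_inv c x))"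
  unfolding Ck_function_def by blast

lemma smooth_function_Ck_iff: "smooth_function A h \<longleftrightarrow> (\<forall>j. Ck_function j h)"
  unfolding smooth_function_def smooth_on_def Ck_function_def o_def by blast

lemma Ck_function_mult: "Ck_function j h \<Longrightarrow> Ck_function j h' \<Longrightarrow> Ck_function j (\<lambda>p. h p * h' p)"
  unfolding Ck_function_def[of _ "\<lambda>p. h p * h' p"] by (intro ballI Ck_on_mult chart_range_open Ck_functionD)

lemma Ck_function_inverse:
  assumes "Ck_function j h" "\<And>p. p \<in> topspace M \<Longrightarrow> h p \<noteq> 0"
  shows "Ck_function j (\<lambda>p. inverse (h p))"
  unfolding Ck_function_def
proof
  fix c assume c: "c \<in> A"
  show "Ck_on j (chart_range c) (\<lambda>x. inverse (h (chart_inv c x)))"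
    by (rule Ck_on_inverse[OF chart_range_open[OF c] Ck_functionD[OF assms(1) c] assms(2)[OF chart_inv_topspace[OF c]]])
qed

lemma smooth_form_scale:
  assumes h: "smooth_function A h" and \<omega>: "smooth_form M A k \<omega>"
  shows "smooth_form M A k (\<lambda>p vs. h p * \<omega> p vs)"
  unfolding smooth_form_def
proof (intro conjI ballI allI impI)
  fix p assume "p \<in> topspace M"
  then have alt: "alternating_form (tangent_space A p) k (\<omega> p)"
    using \<omega> unfolding smooth_form_def by blast
  show "alternating_form (tangent_space A p) k (\<lambda>vs. h p * \<omega> p vs)"
    unfolding alternating_form_def
  proof (intro conjI allI impI)
    fix vs i u w a b
    assume "length vs = k" "set vs \<subseteq> tangent_space A p" "i < k" "u \<in> tangent_space A p" "w \<in> tangent_space A p"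
    from alt[unfolded alternating_form_def, THEN conjunct1, rule_format, OF this, of a b]
    show "h p * \<omega> p (vs[i := \<lambda>c. a *\<^sub>R u c + b *\<^sub>R w c]) = a * (h p * \<omega> p (vs[i := u])) + b * (h p * \<omega> p (vs[i := w]))"
      by (simp add: algebra_simps)
  next
    fix vs i j assume "length vs = k" "set vs \<subseteq> tangent_space A p" "i < j" "j < k" "vs ! i = vs ! j"
    from alt[unfolded alternating_form_def, THEN conjunct2, rule_format, OF this]
    show "h p * \<omega> p vs = 0" by simp
  qed
next
  fix c and us :: "(real ^ 'n) list" assume c: "c \<in> A" and us: "length us = k"
  have "Ck_on j (chart_range c) (\<lambda>x. h (chart_inv c x) * local_form A c \<omega> x us)" for j
    by (rule Ck_on_mult[OF chart_range_open[OF c] Ck_functionD[OF smooth_function_Ck[OF h] c]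
          form_family_Ck[OF form_family_local_form[OF \<omega>] c us]])
  then show "smooth_on (chart_range c) (\<lambda>x. local_form A c (\<lambda>p vs. h p * \<omega> p vs) x us)"
    by (simp add: smooth_on_def local_form_def)
qed

end

locale contact_G2_manifold = smooth_atlas M A for M :: "'a topology" and A :: "('a, 7) chart set" +
  fixes \<phi> :: "('a, 7) dform" and R :: "'a \<Rightarrow> ('a, 7) tvec" and \<alpha> :: "('a, 7) dform" and f g :: "'a \<Rightarrow> real"
  assumes contact_G2: "contact_G2_structure M A \<phi> R \<alpha> f g"
begin

definition \<beta> :: "('a, 7) dform" where
  "\<beta> p vs = g p * \<alpha> p vs"

lemma \<phi>_smooth: "smooth_form M A 3 \<phi>"
  and R_smooth: "smooth_vector_field M A R"
  and R_nonzero: "p \<in> topspace M \<Longrightarrow> R p \<noteq> (\<lambda>c. 0)"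
  and \<alpha>_smooth: "smooth_form M A 1 \<alpha>"
  and f_smooth: "smooth_function A f"
  and f_nonzero: "p \<in> topspace M \<Longrightarrow> f p \<noteq> 0"
  and g_smooth: "smooth_function A g"
  and g_nonzero: "p \<in> topspace M \<Longrightarrow> g p \<noteq> 0"
  and \<alpha>_R: "p \<in> topspace M \<Longrightarrow> \<alpha> p [R p] = f p"
  and d\<beta>: "form_eq M A 2 (ext_deriv A \<beta>) (interior_product R \<phi>)"
  using contact_G2 unfolding contact_G2_structure_def G2_structure_def \<beta>_def[abs_def] by blast+

lemma R_tangent: "p \<in> topspace M \<Longrightarrow> R p \<in> tangent_space A p"
  using R_smooth by (simp add: smooth_vector_field_def)

lemma R_component_nonzero:
  assumes "c \<in> A" "p \<in> chart_dom c"
  shows "R p c \<noteq> 0"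
proof
  assume "R p c = 0"
  have p: "p \<in> topspace M" using chart_dom_subset assms by blast
  have "R p = chart_vec A c p 0"
    using chart_vec_component[OF R_tangent[OF p] assms] \<open>R p c = 0\<close> by simp
  also have "\<dots> = (\<lambda>c. 0)"
    using chart_vec_lincomb[OF assms, of 0 0 0 0] by simp
  finally show False using R_nonzero[OF p] by simp
qed

lemma \<beta>_smooth: "smooth_form M A 1 \<beta>"
  using smooth_form_scale[OF g_smooth \<alpha>_smooth] by (simp add: \<beta>_def[abs_def])

lemma local_G2_form:
  assumes c: "c \<in> A" and x: "x \<in> chart_range c"
  shows "G2_form (local_form A c \<phi> x)"
proof -
  define p where "p = chart_inv c x"
  have p: "p \<in> chart_dom c" "p \<in> topspace M"
    using x c chart_inv_in chart_inv_topspace by (simp_all add: p_def)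
  from bspec[OF contact_G2[unfolded contact_G2_structure_def G2_structure_def, THEN conjunct1, THEN conjunct2] p(2)]
  obtain L where L: "bij_betw L UNIV (tangent_space A p)"
    "\<And>a b u v. L (a *\<^sub>R u + b *\<^sub>R v) = (\<lambda>c. a *\<^sub>R L u c + b *\<^sub>R L v c)"
    "\<And>u v w. \<phi> p [L u, L v, L w] = phi0 [u, v, w]"
    by (elim exE conjE) blast
  have inv: "inv L v \<in> UNIV" "L (inv L v) = v" if "v \<in> tangent_space A p" for v
    using L(1) that by (auto simp: bij_betw_def f_inv_into_f)
  have injL: "inj L" using L(1) by (simp add: bij_betw_def)
  have V: "bij_betw (chart_vec A c p) UNIV (tangent_space A p)"
    unfolding bij_betw_def
  proof
    show "inj (chart_vec A c p)"
      by (rule injI) (metis chart_vec_self[OF c p(1)])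
    show "range (chart_vec A c p) = tangent_space A p"
    proof
      show "range (chart_vec A c p) \<subseteq> tangent_space A p"
        using chart_vec_tangent[OF c p(1)] by blast
      show "tangent_space A p \<subseteq> range (chart_vec A c p)"
        by (rule subsetI) (metis chart_vec_component[OF _ c p(1)] rangeI)
    qed
  qed
  \<comment> \<open>L is a frame of the tangent space adapted to \<phi>; P compares the coordinate
    frame of c with it.\<close>
  define P where "P u = inv L (chart_vec A c p u)" for u
  have LP: "L (P u) = chart_vec A c p u" for u
    unfolding P_def by (rule inv(2)[OF chart_vec_tangent[OF c p(1)]])
  have Plin: "P (a *\<^sub>R u + b *\<^sub>R v) = a *\<^sub>R P u + b *\<^sub>R P v" for a b u v
    by (rule injD[OF injL]) (simp only: LP L(2) chart_vec_lincomb[OF c p(1)])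
  have "linear P"
    using Plin[of 1 _ 1 _] Plin[of _ _ 0 0] by (intro linearI) simp_all
  moreover have "bij P"
    using bij_betw_trans[OF V bij_betw_inv_into[OF L(1)]] by (simp add: P_def[abs_def] o_def)
  moreover have "local_form A c \<phi> x [u, v, w] = phi0 [P u, P v, P w]" for u v w
    by (simp add: local_form_def LP flip: L(3) p_def)
  ultimately show ?thesis unfolding G2_form_def by blast
qed

lemma local_d\<beta>:
  assumes c: "c \<in> A" and x: "x \<in> chart_range c"
  shows "local_ext_deriv (local_form A c \<beta>) x [u, v] = local_form A c \<phi> x [R (chart_inv c x) c, u, v]"
proof -
  define p where "p = chart_inv c x"
  have p: "p \<in> chart_dom c" "p \<in> topspace M" "chart_map c p = x"
    using x c chart_inv_in chart_inv_topspace by (simp_all add: p_def)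
  let ?V = "chart_vec A c p"
  have "local_ext_deriv (local_form A c \<beta>) x [u, v] = ext_deriv A \<beta> p (map ?V [u, v])"
    using ext_deriv_local[OF form_family_local_form[OF \<beta>_smooth] c p(1), of "[u, v]"] p(3) by simp
  also have "\<dots> = \<phi> p [R p, ?V u, ?V v]"
    using d\<beta>[unfolded form_eq_def interior_product_def, rule_format, OF p(2), of "map ?V [u, v]"]
      chart_vec_tangent[OF c p(1)] by simp
  also have "\<dots> = local_form A c \<phi> x [R p c, u, v]"
    using chart_vec_component[OF R_tangent[OF p(2)] c p(1)] by (simp add: local_form_def p_def)
  finally show ?thesis by (simp add: p_def)
qed

text \<open>Criterion shared by \<beta>, with h = 1, and \<alpha>, with h = 1/g: the derivative has
  to match the contraction of \<phi> only on the kernel, and R is transverse to that kernel.\<close>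

lemma contact_formI:
  assumes \<gamma>: "smooth_form M A 1 \<gamma>" and R: "\<And>p. p \<in> topspace M \<Longrightarrow> \<gamma> p [R p] \<noteq> 0"
    and h: "\<And>p. p \<in> topspace M \<Longrightarrow> h p \<noteq> 0"
    and d\<gamma>: "\<And>c x u v. c \<in> A \<Longrightarrow> x \<in> chart_range c \<Longrightarrow> local_form A c \<gamma> x [u] = 0 \<Longrightarrow> local_form A c \<gamma> x [v] = 0 \<Longrightarrow>
      local_ext_deriv (local_form A c \<gamma>) x [u, v] = h (chart_inv c x) * local_form A c \<phi> x [R (chart_inv c x) c, u, v]"
  shows "contact_form M A \<gamma>"
proof -
  have "\<exists>vs. length vs = 7 \<and> set vs \<subseteq> tangent_space A p \<and> wedge 1 6 (\<gamma> p) (wedge_power 2 (ext_deriv A \<gamma> p) 3) vs \<noteq> 0"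
    if p: "p \<in> topspace M" for p
  proof -
    obtain c where c: "c \<in> A" "p \<in> chart_dom c" using chart_cover[OF p] by blast
    define x where "x = chart_map c p"
    have x: "x \<in> chart_range c" "chart_inv c x = p" using c by (auto simp: x_def)
    define a where "a = local_form A c \<gamma> x"
    define \<tau> where "\<tau> = local_ext_deriv (local_form A c \<gamma>) x"
    let ?V = "chart_vec A c p"
    note fam = form_family_local_form[OF \<gamma>]
    have a: "alt 1 a" unfolding a_def by (rule form_family_alt[OF fam c(1) x(1)])
    have \<tau>: "skew 2 \<tau>"
      using alt_skew[OF form_family_alt[OF form_family_ext_deriv[OF fam] c(1) x(1)]] by (simp add: \<tau>_def numeral_2_eq_2)
    have "a [R p c] = \<gamma> p [R p]"
      using chart_vec_component[OF R_tangent[OF p] c] x(2) by (simp add: a_def local_form_def)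
    then have aR: "a [R p c] \<noteq> 0" using R[OF p] by simp
    have "\<tau> [u, v] = h p * local_form A c \<phi> x [R p c, u, v]" if "a [u] = 0" "a [v] = 0" for u v
      using d\<gamma>[OF c(1) x(1), of u v] that x(2) by (simp add: a_def \<tau>_def)
    from wedge_1_wedge_power_nonzero[OF local_G2_form[OF c(1) x(1)] R_component_nonzero[OF c] a aR \<tau> h[OF p] this]
    obtain vs where vs: "length vs = 7" "wedge 1 6 a (wedge_power 2 \<tau> 3) vs \<noteq> 0" by metis
    \<comment> \<open>The exterior derivative is identified with \<tau> on pairs, which determines
      its wedge powers on lists of the right length.\<close>
    have E: "ext_deriv A \<gamma> p (map ?V us) = \<tau> us" if "length us = 2" for us
      using ext_deriv_local[OF fam c, of us] that by (simp add: \<tau>_def x_def)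
    have "wedge 1 6 (\<gamma> p) (wedge_power 2 (ext_deriv A \<gamma> p) 3) (map ?V vs)
      = wedge 1 6 (\<lambda>us. \<gamma> p (map ?V us)) (\<lambda>us. wedge_power 2 (ext_deriv A \<gamma> p) 3 (map ?V us)) vs"
      by (rule wedge_map) (use vs in simp)
    also have "\<dots> = wedge 1 6 a (wedge_power 2 \<tau> 3) vs"
    proof (rule wedge_cong)
      show "\<gamma> p (map ?V us) = a us" for us by (simp add: a_def local_form_def x(2))
      fix us :: "(real ^ 7) list" assume us: "length us = 6"
      have "wedge_power 2 (ext_deriv A \<gamma> p) 3 (map ?V us) = wedge_power 2 (\<lambda>us. ext_deriv A \<gamma> p (map ?V us)) 3 us"
        by (rule wedge_power_map) (use us in simp)
      also have "\<dots> = 1 ^ 3 * wedge_power 2 \<tau> 3 us"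
        by (rule wedge_power_cong) (use us E in \<open>simp_all del: list.map\<close>)
      finally show "wedge_power 2 (ext_deriv A \<gamma> p) 3 (map ?V us) = wedge_power 2 \<tau> 3 us" by simp
    qed (use vs in simp)
    finally show ?thesis
      using vs chart_vec_tangent[OF c] by (intro exI[of _ "map ?V vs"]) auto
  qed
  then show ?thesis
    unfolding contact_form_def nowhere_zero_form_def by (intro conjI \<gamma> exI[of _ 3]) simp_all
qed

lemma contact_form_\<beta>: "contact_form M A \<beta>"
proof (rule contact_formI[where h = "\<lambda>_. 1"])
  show "\<beta> p [R p] \<noteq> 0" if "p \<in> topspace M" for p
    using \<alpha>_R[OF that] f_nonzero[OF that] g_nonzero[OF that] by (simp add: \<beta>_def)
qed (rule \<beta>_smooth, simp_all add: local_d\<beta>)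

lemma contact_form_\<alpha>: "contact_form M A \<alpha>"
proof (rule contact_formI[where h = "\<lambda>p. inverse (g p)"])
  fix c x u v
  assume c: "c \<in> A" and x: "x \<in> chart_range c"
    and uv: "local_form A c \<alpha> x [u] = 0" "local_form A c \<alpha> x [v] = 0"
  define p where "p = chart_inv c x"
  define G where "G y = g (chart_inv c y)" for y
  note fam = form_family_local_form[OF \<alpha>_smooth]
  have d\<alpha>: "(\<lambda>y. local_form A c \<alpha> y [w]) differentiable (at x)" for w
    using form_family_diff[OF fam c x] by (rule diff_form_atD) simp
  have "Ck_on 1 (chart_range c) G"
    unfolding G_def by (rule Ck_functionD[OF smooth_function_Ck[OF g_smooth] c])
  then have dG: "G differentiable (at x)" using x unfolding One_nat_def Ck_on.simps by blast
  have \<beta>G: "local_form A c \<beta> y us = G y * local_form A c \<alpha> y us" for y us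
    by (simp add: local_form_def \<beta>_def G_def)
  \<comment> \<open>Product rule for d(g\<alpha>) = dg \<and> \<alpha> + g d\<alpha>; the first
    summand vanishes on two vectors of the kernel of \<alpha>.\<close>
  have "fderiv (\<lambda>y. G y * local_form A c \<alpha> y [w]) x w'
      = G x * fderiv (\<lambda>y. local_form A c \<alpha> y [w]) x w' + fderiv G x w' * local_form A c \<alpha> x [w]" for w w'
    using frechet_derivative_scaleR[OF dG d\<alpha>] by simp
  then have "local_ext_deriv (local_form A c \<beta>) x [u, v] = G x * local_ext_deriv (local_form A c \<alpha>) x [u, v]"
    using uv by (simp add: local_ext_deriv_Cons local_ext_deriv_Nil \<beta>G algebra_simps)
  then show "local_ext_deriv (local_form A c \<alpha>) x [u, v]
      = inverse (g (chart_inv c x)) * local_form A c \<phi> x [R (chart_inv c x) c, u, v]"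
    using local_d\<beta>[OF c x, of u v] g_nonzero[OF chart_inv_topspace[OF c x]] by (simp add: G_def field_simps)
qed (rule \<alpha>_smooth, simp_all add: \<alpha>_R f_nonzero g_nonzero)

text \<open>\<beta> serves as both contact forms in the definition: its derivative is the
  contraction of \<phi> with R, and the multiple of R by h = 1/(fg) is its Reeb field, since
  \<beta>(R) = fg.\<close>

lemma A_compatible_ker: "A_compatible M A \<phi> (form_ker A \<alpha>)"
proof -
  define h where "h p = inverse (f p * g p)" for p
  define X where "X p = (\<lambda>c. h p *\<^sub>R R p c)" for p
  have "Ck_function j h" for j
    unfolding h_def
    by (intro Ck_function_inverse Ck_function_mult smooth_function_Ck f_smooth g_smooth) (simp add: f_nonzero g_nonzero)
  then have h_smooth: "smooth_function A h" by (simp add: smooth_function_Ck_iff)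
  have h_nonzero: "h p \<noteq> 0" if "p \<in> topspace M" for p
    using that by (simp add: h_def f_nonzero g_nonzero)
  have X_tangent: "X p \<in> tangent_space A p" if "p \<in> topspace M" for p
    unfolding X_def by (rule tangent_scaleR[OF R_tangent[OF that] that])
  have "smooth_vector_field M A X"
    unfolding smooth_vector_field_def
  proof (intro conjI ballI)
    fix c assume c: "c \<in> A"
    have "Ck_on j (chart_range c) (\<lambda>x. h (chart_inv c x) *\<^sub>R R (chart_inv c x) c)" for j
      using R_smooth c unfolding smooth_vector_field_def smooth_on_def
      by (intro Ck_on_scaleR[OF chart_range_open[OF c] Ck_functionD[OF smooth_function_Ck[OF h_smooth] c]]) blast
    then show "smooth_on (chart_range c) (\<lambda>x. X (chart_inv c x) c)"
      by (simp add: smooth_on_def X_def)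
  qed (rule X_tangent)
  moreover have "form_eq M A 1 (interior_product X (ext_deriv A \<beta>)) (\<lambda>p vs. 0)"
    unfolding form_eq_def interior_product_def
  proof (intro ballI allI impI)
    fix p and vs :: "('a, 7) tvec list" assume p: "p \<in> topspace M" and vs: "length vs = 1" "set vs \<subseteq> tangent_space A p"
    obtain v where v: "vs = [v]" using vs(1) by (cases vs) auto
    have alt: "alternating_form (tangent_space A p) 3 (\<phi> p)"
      using \<phi>_smooth p unfolding smooth_form_def by blast
    have T: "set [R p, R p, v] \<subseteq> tangent_space A p"
      using vs v R_tangent[OF p] by simp
    have "ext_deriv A \<beta> p [X p, v] = \<phi> p [R p, X p, v]"
      using d\<beta>[unfolded form_eq_def interior_product_def, rule_format, OF p, of "[X p, v]"] X_tangent[OF p] vs v by simp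
    also have "\<dots> = h p * \<phi> p [R p, R p, v]"
      using alternating_form_scale[OF alt _ T, of 1 "h p"] by (simp add: X_def)
    also have "\<phi> p [R p, R p, v] = 0"
      using alt[unfolded alternating_form_def, THEN conjunct2, rule_format, OF _ T, of 0 1] by simp
    finally show "ext_deriv A \<beta> p (X p # vs) = 0" by (simp add: v)
  qed
  moreover have "\<beta> p [X p] = 1" if p: "p \<in> topspace M" for p
  proof -
    have alt: "alternating_form (tangent_space A p) 1 (\<alpha> p)"
      using \<alpha>_smooth p unfolding smooth_form_def by blast
    have "\<alpha> p [X p] = h p * f p"
      using alternating_form_scale[OF alt, of "[R p]" 0 "h p"] R_tangent[OF p] \<alpha>_R[OF p] by (simp add: X_def)
    then show ?thesis
      using f_nonzero[OF p] g_nonzero[OF p] by (simp add: \<beta>_def h_def field_simps)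
  qed
  ultimately have Reeb: "is_Reeb_field M A \<beta> X"
    unfolding is_Reeb_field_def by blast
  have ker: "form_ker A \<alpha> p = form_ker A \<beta> p" if "p \<in> topspace M" for p
    using g_nonzero[OF that] by (simp add: form_ker_def \<beta>_def)
  have "contact_form_for M A (form_ker A \<alpha>) \<beta>" "contact_form_for M A (form_ker A \<alpha>) \<alpha>"
    unfolding contact_form_for_def using contact_form_\<alpha> contact_form_\<beta> ker by blast+
  then show ?thesis
    unfolding A_compatible_def contact_structure_def
    using R_smooth h_smooth h_nonzero d\<beta> Reeb unfolding X_def[abs_def] by blast
qed

end


section \<open>Stokes' theorem for an exact volume form on a compact manifold\<close>

lemma integrable_on_compact_continuous:
  fixes f :: "'a::euclidean_space \<Rightarrow> real"
  assumes "compact S" "continuous_on S f"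
  shows "f absolutely_integrable_on S"
proof -
  have 1: "integrable lborel (\<lambda>x. indicator S x *\<^sub>R f x)"
    by (rule borel_integrable_compact[OF assms])
  then have "(\<lambda>x. indicator S x *\<^sub>R f x) \<in> borel_measurable lborel" by auto
  from integrable_completion[OF this] 1 show ?thesis
    by (simp add: set_integrable_def)
qed

text \<open>Translation invariance makes the integral of every difference quotient 0. The quotients
  converge to the derivative and are dominated by a constant on a box, so the limit has integral 0
  as well.\<close>

lemma has_integral_frechet_derivative_0:
  fixes F :: "'a::euclidean_space \<Rightarrow> real"
  assumes F: "Ck_on 1 UNIV F" and zero: "\<And>y. y \<notin> cball x0 r \<Longrightarrow> F y = 0"
  shows "((\<lambda>x. fderiv F x v) has_integral 0) (cball x0 r)"
proof -
  define D where "D x = fderiv F x v" for x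
  have diff: "F differentiable (at x)" for x using F by simp
  have D: "continuous_on UNIV D" using F by (simp add: D_def[abs_def])
  have line: "((\<lambda>s. F (x + s *\<^sub>R v)) has_real_derivative D (x + s *\<^sub>R v)) (at s)" for x s
    unfolding D_def by (rule frechet_derivative_line[OF diff])
  have D0: "D y = 0" if "y \<notin> cball x0 r" for y
  proof -
    have "fderiv F y = fderiv (\<lambda>_. 0) y"
      by (rule frechet_derivative_cong_open[of "- cball x0 r"]) (use zero that in auto)
    then show ?thesis by (simp add: D_def frechet_derivative_const)
  qed
  have "compact (D ` cball x0 r)"
    by (rule compact_continuous_image[OF continuous_on_subset[OF D]]) auto
  then obtain B0 where B0: "\<And>x. x \<in> cball x0 r \<Longrightarrow> \<bar>D x\<bar> \<le> B0"
    using compact_imp_bounded bounded_iff by (metis image_eqI real_norm_def)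
  define B where "B = max B0 0"
  have B: "\<bar>D x\<bar> \<le> B" for x
    using B0[of x] D0[of x] by (cases "x \<in> cball x0 r") (auto simp: B_def)
  \<comment> \<open>The ball is enlarged by the length of v, so that outside the box both F(x) and
    F(x + t v) vanish for 0 < t \<le> 1.\<close>
  obtain a b where ab: "cball x0 (r + norm v) \<subseteq> cbox a b"
    using bounded_subset_cbox_symmetric[OF bounded_cball] by metis
  have sub: "cball x0 r \<subseteq> cball x0 (r + norm v)" by (rule subset_cball) simp
  have F0: "F y = 0" if "y \<notin> cbox a b" for y
    using that ab sub zero by blast
  have "continuous_on UNIV F" using Ck_on_continuous[OF F] .
  then have "F integrable_on cbox a b"
    by (intro integrable_continuous) (rule continuous_on_subset, auto)
  then obtain I where I: "(F has_integral I) (cbox a b)" by blast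
  then have IU: "(F has_integral I) UNIV"
    by (rule has_integral_on_superset) (use F0 in auto)
  have shift: "((\<lambda>x. F (x + t *\<^sub>R v)) has_integral I) UNIV" for t
  proof -
    have "((\<lambda>x. F (1 *\<^sub>R x + t *\<^sub>R v)) has_integral (I /\<^sub>R 1 ^ DIM('a))) (cbox ((a - t *\<^sub>R v) /\<^sub>R 1) ((b - t *\<^sub>R v) /\<^sub>R 1))"
      by (rule has_integral_affinity'[OF I]) simp
    then have "((\<lambda>x. F (x + t *\<^sub>R v)) has_integral I) (cbox (a - t *\<^sub>R v) (b - t *\<^sub>R v))" by simp
    then show ?thesis
    proof (rule has_integral_on_superset)
      fix x assume "x \<notin> cbox (a - t *\<^sub>R v) (b - t *\<^sub>R v)"
      then have "x + t *\<^sub>R v \<notin> cbox a b"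
        by (auto simp: mem_box inner_diff_left inner_add_left algebra_simps)
      then show "F (x + t *\<^sub>R v) = 0" by (rule F0)
    qed simp
  qed
  \<comment> \<open>Difference quotients with step 1/(n+1); the step never exceeds 1, as the choice
    of the box requires.\<close>
  define q where "q n x = (F (x + inverse (real (Suc n)) *\<^sub>R v) - F x) * real (Suc n)" for n x
  have q0: "(q n has_integral 0) UNIV" for n
    using has_integral_mult_left[OF has_integral_diff[OF shift[of "inverse (real (Suc n))"] IU], of "real (Suc n)"]
    by (simp add: q_def[abs_def])
  define h where "h x = (if x \<in> cbox a b then B else 0)" for x :: 'a
  have h: "h integrable_on UNIV"
    unfolding h_def integrable_restrict_UNIV by (rule integrable_const)
  have bound: "norm (q n x) \<le> h x" for n x
  proof (cases "x \<in> cbox a b")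
    case True
    let ?t = "inverse (real (Suc n))"
    have t: "0 < ?t" by simp
    obtain s where "F (x + ?t *\<^sub>R v) - F (x + 0 *\<^sub>R v) = (?t - 0) * D (x + s *\<^sub>R v)"
      using MVT2[OF t, of "\<lambda>s. F (x + s *\<^sub>R v)" "\<lambda>s. D (x + s *\<^sub>R v)"] line by blast
    then have "q n x = D (x + s *\<^sub>R v)"
      by (simp add: q_def field_simps)
    then show ?thesis using B True by (simp add: h_def)
  next
    case False
    then have "x \<notin> cball x0 (r + norm v)" using ab by blast
    then have far: "dist x0 x > r + norm v" by simp
    have "norm (inverse (real (Suc n)) *\<^sub>R v) \<le> 1 * norm v"
      unfolding norm_scaleR by (intro mult_right_mono) (auto simp: inverse_le_1_iff)
    then have "dist x0 (x + inverse (real (Suc n)) *\<^sub>R v) > r"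
      using far dist_triangle[of x0 x "x + inverse (real (Suc n)) *\<^sub>R v"] by (simp add: dist_norm)
    then have "F (x + inverse (real (Suc n)) *\<^sub>R v) = 0" by (intro zero) simp
    moreover have "r < dist x0 x" using far norm_ge_zero[of v] by linarith
    then have "F x = 0" by (intro zero) simp
    ultimately show ?thesis using False by (simp add: q_def h_def)
  qed
  have lim: "(\<lambda>n. q n x) \<longlonglongrightarrow> D x" for x
  proof -
    have "((\<lambda>s. F (x + s *\<^sub>R v)) has_real_derivative D (x + 0 *\<^sub>R v)) (at 0)" by (rule line)
    then have "((\<lambda>t. (F (x + t *\<^sub>R v) - F x) / t) \<longlongrightarrow> D x) (at 0)"
      by (simp add: DERIV_def)
    moreover have "filterlim (\<lambda>n. inverse (real (Suc n))) (at 0) sequentially"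
      unfolding filterlim_at using LIMSEQ_inverse_real_of_nat by auto
    ultimately have "(\<lambda>n. (F (x + inverse (real (Suc n)) *\<^sub>R v) - F x) / inverse (real (Suc n))) \<longlonglongrightarrow> D x"
      by (rule filterlim_compose)
    then show ?thesis by (simp add: q_def divide_inverse)
  qed
  have "D integrable_on UNIV" "(\<lambda>n. integral UNIV (q n)) \<longlonglongrightarrow> integral UNIV D"
    using dominated_convergence[of q UNIV h D] q0 h bound lim by (auto simp: integrable_on_def)
  moreover have "integral UNIV (q n) = 0" for n using q0 by (rule integral_unique)
  ultimately have "(D has_integral 0) UNIV"
    using LIMSEQ_unique[of "\<lambda>n. integral UNIV (q n)" 0] by (simp add: has_integral_iff)
  moreover have "(\<lambda>x. if x \<in> cball x0 r then D x else 0) = D"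
    using D0 by auto
  ultimately show ?thesis
    using has_integral_restrict_UNIV[of "cball x0 r" D 0] by (simp add: D_def[abs_def])
qed

text \<open>A nonnegative continuous function of integral 0 vanishes on a box around x0, contrary to
  w x0 > 0.\<close>

lemma integral_pos_continuous:
  fixes w :: "'a::euclidean_space \<Rightarrow> real"
  assumes w: "continuous_on (cball x0 r) w" "\<And>x. x \<in> cball x0 r \<Longrightarrow> w x \<ge> 0" "w x0 > 0" and r: "r > 0"
  shows "integral (cball x0 r) w > 0"
proof (rule ccontr)
  assume "\<not> integral (cball x0 r) w > 0"
  moreover have int: "w integrable_on cball x0 r"
    using integrable_on_compact_continuous[OF compact_cball w(1)] by (rule set_lebesgue_integral_eq_integral)
  ultimately have "(w has_integral 0) (cball x0 r)"
    using integral_nonneg[OF int w(2)] by (simp add: has_integral_iff)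
  moreover obtain a b where ab: "x0 \<in> box a b" "cbox a b \<subseteq> cball x0 r"
  proof -
    obtain a b where "cbox a b \<subseteq> ball x0 r" "x0 \<in> box a b"
      using open_contains_cbox[OF open_ball, of x0 x0 r] r by (metis centre_in_ball)
    then show ?thesis using that ball_subset_cball by blast
  qed
  have int': "w integrable_on cbox a b"
    by (rule integrable_continuous[OF continuous_on_subset[OF w(1) ab(2)]])
  ultimately have "integral (cbox a b) w \<le> 0"
    using integral_subset_le[OF ab(2) int' int] w(2) by (simp add: has_integral_iff)
  moreover have nn: "0 \<le> w x" if "x \<in> cbox a b" for x
    using w(2) ab(2) that by blast
  ultimately have "integral (cbox a b) w = 0"
    using integral_nonneg[OF int' nn] by linarith
  then have "(w has_integral 0) (cbox a b)" using int' by (simp add: has_integral_iff)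
  moreover have "box a b \<noteq> {}" "x0 \<in> cbox a b" using ab(1) box_subset_cbox by blast+
  ultimately have "w x0 = 0"
    using has_integral_0_cbox_imp_0[OF continuous_on_subset[OF w(1) ab(2)] nn[OF subsetD[OF box_subset_cbox]]] by blast
  then show False using w(3) by simp
qed

text \<open>Scalar substitution rule, obtained through functions with values in
  \<open>real ^ 1\<close>. Compactness of S provides the integrability of h.\<close>

lemma integral_change_of_variables_compact:
  fixes h :: "real ^ 'n::{finite,wellorder} \<Rightarrow> real"
  assumes "compact S" "\<And>x. x \<in> S \<Longrightarrow> (F has_derivative F' x) (at x)" "inj_on F S" "continuous_on (F ` S) h"
  shows "integral (F ` S) h = integral S (\<lambda>x. \<bar>det (matrix (F' x))\<bar> * h (F x))"
proof -
  have "continuous_on S F"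
    using assms(2) by (meson continuous_at_imp_continuous_on has_derivative_continuous)
  then have "h absolutely_integrable_on (F ` S)"
    using assms by (intro integrable_on_compact_continuous compact_continuous_image)
  then have "(\<lambda>x. vec (h x) :: real ^ 1) absolutely_integrable_on (F ` S) \<and>
      integral (F ` S) (\<lambda>x. vec (h x) :: real ^ 1) = vec (integral (F ` S) h)"
    by (simp add: absolutely_integrable_on_1_iff integral_on_1_eq)
  then have "integral S (\<lambda>x. \<bar>det (matrix (F' x))\<bar> *\<^sub>R (vec (h (F x)) :: real ^ 1)) = vec (integral (F ` S) h)"
    using has_absolute_integral_change_of_variables_compact[OF assms(1) has_derivative_at_withinI[OF assms(2)] assms(3),
        of "\<lambda>x. vec (h x) :: real ^ 1" "vec (integral (F ` S) h)"] by blast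
  then show ?thesis
    by (simp add: integral_on_1_eq vec_eq_iff)
qed

text \<open>Squaring the positive part makes the gluing along the sphere continuously
  differentiable. The function is not smooth, but class C^1 is all that one exterior derivative asks
  of a cutoff.\<close>

definition bump :: "real ^ 'n \<Rightarrow> real \<Rightarrow> real ^ 'n \<Rightarrow> real" where
  "bump x0 r y = (max 0 (r\<^sup>2 - (y - x0) \<bullet> (y - x0)))\<^sup>2"

lemma bump_nonneg: "bump x0 r y \<ge> 0"
  by (simp add: bump_def)

lemma bump_pos_iff:
  assumes "r > 0"
  shows "bump x0 r y > 0 \<longleftrightarrow> y \<in> ball x0 r"
proof -
  have "bump x0 r y > 0 \<longleftrightarrow> (norm (y - x0))\<^sup>2 < r\<^sup>2"
    by (auto simp: bump_def power2_norm_eq_inner max_def)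
  also have "\<dots> \<longleftrightarrow> norm (y - x0) < r"
    using assms power2_less_imp_less[of "norm (y - x0)" r] power_strict_mono[of "norm (y - x0)" r 2] by auto
  finally show ?thesis by (simp add: dist_norm norm_minus_commute)
qed

lemma has_real_derivative_max_0_square: "((\<lambda>t. (max 0 t)\<^sup>2) has_real_derivative 2 * max 0 t) (at (t::real))"
proof -
  consider "t > 0" | "t < 0" | "t = 0" by linarith
  then show ?thesis
  proof cases
    case 1
    have "((\<lambda>t. t\<^sup>2) has_real_derivative 2 * t) (at t)" by (auto intro!: derivative_eq_intros)
    then have "((\<lambda>t. (max 0 t)\<^sup>2) has_real_derivative 2 * t) (at t)"
      by (rule has_field_derivative_transform_within_open[of _ _ _ "{0<..}"]) (use 1 in \<open>auto simp: max_def\<close>)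
    then show ?thesis using 1 by simp
  next
    case 2
    have "((\<lambda>t. 0) has_real_derivative 0) (at t)" by simp
    then have "((\<lambda>t. (max 0 t)\<^sup>2) has_real_derivative 0) (at t)"
      by (rule has_field_derivative_transform_within_open[of _ _ _ "{..<0}"]) (use 2 in \<open>auto simp: max_def\<close>)
    then show ?thesis using 2 by simp
  next
    case 3
    \<comment> \<open>At the corner the difference quotient is bounded by |h|.\<close>
    have "((\<lambda>h. (max 0 h)\<^sup>2 / h) \<longlongrightarrow> 0) (at (0::real))"
    proof (rule Lim_null_comparison)
      show "\<forall>\<^sub>F h in at (0::real). norm ((max 0 h)\<^sup>2 / h) \<le> \<bar>h\<bar>"
        by (intro always_eventually allI) (auto simp: max_def power2_eq_square)
      show "((\<lambda>h. \<bar>h\<bar>) \<longlongrightarrow> 0) (at (0::real))" by (auto intro!: tendsto_eq_intros)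
    qed
    then show ?thesis using 3 by (simp add: DERIV_def)
  qed
qed

lemma bump_has_derivative:
  "(bump x0 r has_derivative (\<lambda>h. 2 * max 0 (r\<^sup>2 - (y - x0) \<bullet> (y - x0)) * - (2 * ((y - x0) \<bullet> h)))) (at y)"
proof -
  have "((\<lambda>y. r\<^sup>2 - (y - x0) \<bullet> (y - x0)) has_derivative (\<lambda>h. - (2 * ((y - x0) \<bullet> h)))) (at y)"
    by (auto intro!: derivative_eq_intros simp: inner_commute)
  from has_derivative_compose[OF this has_real_derivative_max_0_square[unfolded has_field_derivative_def]]
  show ?thesis by (simp add: bump_def[abs_def])
qed

lemma Ck_on_bump: "Ck_on 1 UNIV (bump x0 r)"
proof -
  have "continuous_on UNIV (\<lambda>y. 2 * max 0 (r\<^sup>2 - (y - x0) \<bullet> (y - x0)) * - (2 * ((y - x0) \<bullet> v)))" for v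
    by (intro continuous_intros)
  then show ?thesis
    using bump_has_derivative[of x0 r] by (auto simp: frechet_derivative_eq[OF bump_has_derivative] intro: differentiableI)
qed

lemma local_ext_deriv_sum:
  assumes "finite I" "\<And>i. i \<in> I \<Longrightarrow> diff_form_at k (\<omega> i) x" "length us = Suc k"
  shows "local_ext_deriv (\<lambda>y vs. \<Sum>i\<in>I. \<omega> i y vs) x us = (\<Sum>i\<in>I. local_ext_deriv (\<omega> i) x us)"
  using assms(1,2)
proof (induction I rule: finite_induct)
  case empty
  then show ?case by (simp add: local_ext_deriv_def frechet_derivative_const)
next
  case (insert i I)
  have "diff_form_at k (\<lambda>y vs. \<Sum>i\<in>I. \<omega> i y vs) x"
    using insert unfolding diff_form_at_def by (intro allI impI differentiable_sum) auto
  then have "local_ext_deriv (\<lambda>y vs. 1 * \<omega> i y vs + 1 * (\<Sum>i\<in>I. \<omega> i y vs)) x us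
      = 1 * local_ext_deriv (\<omega> i) x us + 1 * local_ext_deriv (\<lambda>y vs. \<Sum>i\<in>I. \<omega> i y vs) x us"
    using insert.prems by (intro local_ext_deriv_lincomb[OF _ _ assms(3)]) auto
  then show ?case using insert by simp
qed

context smooth_atlas
begin

section \<open>Cutoff functions on the manifold\<close>

lemma Ck_function_sum: "(\<And>i. i \<in> I \<Longrightarrow> Ck_function j (h i)) \<Longrightarrow> Ck_function j (\<lambda>p. \<Sum>i\<in>I. h i p)"
  unfolding Ck_function_def[of _ "\<lambda>p. \<Sum>i\<in>I. h i p"] by (intro ballI Ck_on_sum chart_range_open Ck_functionD)

definition chart_cball :: "('a, 'n) chart \<Rightarrow> real ^ 'n \<Rightarrow> real \<Rightarrow> 'a set" where
  "chart_cball c x0 r = {q \<in> chart_dom c. chart_map c q \<in> cball x0 r}"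

lemma chart_cball_image:
  assumes "cball x0 r \<subseteq> chart_range c"
  shows "chart_map c ` chart_cball c x0 r = cball x0 r"
  using assms unfolding chart_cball_def by auto

text \<open>The preimage of a compact ball is compact, hence closed because M is Hausdorff. Its
  complement is then open, and there the extension of a cutoff by zero is constant.\<close>

lemma chart_cball_closed:
  assumes "c \<in> A" "cball x0 r \<subseteq> chart_range c"
  shows "closedin M (chart_cball c x0 r)"
proof -
  have sub: "chart_cball c x0 r \<subseteq> topspace (subtopology M (chart_dom c))"
    using chart_dom_subset[OF assms(1)] by (auto simp: chart_cball_def)
  have "compactin (top_of_set (chart_range c)) (chart_map c ` chart_cball c x0 r)"
    unfolding chart_cball_image[OF assms(2)] using assms(2) by (simp add: compactin_subtopology)
  then have "compactin (subtopology M (chart_dom c)) (chart_cball c x0 r)"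
    using homeomorphic_map_compactness[OF chart_homeomorphic[OF assms(1)] sub] by blast
  then have "compactin M (chart_cball c x0 r)" by (simp add: compactin_subtopology)
  moreover have "Hausdorff_space M" using manifold by (simp add: smooth_manifold_def)
  ultimately show ?thesis by (simp add: compactin_imp_closedin)
qed

definition chart_bump :: "('a, 'n) chart \<Rightarrow> real ^ 'n \<Rightarrow> real \<Rightarrow> 'a \<Rightarrow> real" where
  "chart_bump c x0 r q = (if q \<in> chart_dom c then bump x0 r (chart_map c q) else 0)"

lemma chart_complement_open:
  assumes "c \<in> A" "closedin M K"
  shows "open (chart_map c ` (chart_dom c - K))"
  by (rule chart_image_open[OF assms(1) openin_diff[OF chart_dom_open[OF assms(1)] assms(2)]]) auto

lemma chart_complementI: "x \<in> chart_range c \<Longrightarrow> chart_inv c x \<notin> K \<Longrightarrow> x \<in> chart_map c ` (chart_dom c - K)"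
  by (rule image_eqI[of _ _ "chart_inv c x"]) (simp_all add: chart_inv_in)

text \<open>Any chart range is covered by two open sets: the overlap with c0, where the function is
  a bump composed with a transition map, and the part outside the closed ball, where it is
  0.\<close>

lemma Ck_function_chart_bump:
  assumes c0: "c0 \<in> A" "cball x0 r \<subseteq> chart_range c0" and r: "r > 0"
  shows "Ck_function 1 (chart_bump c0 x0 r)"
  unfolding Ck_function_def
proof
  fix c assume c: "c \<in> A"
  let ?O1 = "overlap c c0" and ?O2 = "chart_map c ` (chart_dom c - chart_cball c0 x0 r)"
  have o1: "open ?O1" by (rule overlap_open[OF c c0(1)])
  have o2: "open ?O2" by (rule chart_complement_open[OF c chart_cball_closed[OF c0]])
  have base: "Ck_on 1 ?O1 (\<lambda>x. bump x0 r (transition c c0 x))"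
    by (rule Ck_on_1_compose[OF o1 transition_Ck[OF c c0(1)] Ck_on_bump]) simp
  have on_O1: "chart_bump c0 x0 r (chart_inv c x) = bump x0 r (transition c c0 x)" if "x \<in> ?O1" for x
    using that c by (simp add: overlap_iff transition_eq chart_bump_def)
  have 1: "Ck_on 1 ?O1 (\<lambda>x. chart_bump c0 x0 r (chart_inv c x))"
    by (rule iffD2[OF Ck_on_cong[OF o1 on_O1] base])
  have on_O2: "chart_bump c0 x0 r (chart_inv c x) = 0" if x: "x \<in> ?O2" for x
  proof -
    obtain q where q: "q \<in> chart_dom c" "q \<notin> chart_cball c0 x0 r" "x = chart_map c q" using x by blast
    then have "chart_inv c x = q" using c by simp
    moreover have "bump x0 r (chart_map c0 q) = 0" if "q \<in> chart_dom c0"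
    proof -
      have "chart_map c0 q \<notin> ball x0 r" using q(2) that by (auto simp: chart_cball_def)
      then show ?thesis
        using bump_pos_iff[OF r, of x0 "chart_map c0 q"] bump_nonneg[of x0 r "chart_map c0 q"] by linarith
    qed
    ultimately show ?thesis by (simp add: chart_bump_def)
  qed
  have 2: "Ck_on 1 ?O2 (\<lambda>x. chart_bump c0 x0 r (chart_inv c x))"
    by (rule iffD2[OF Ck_on_cong[OF o2 on_O2] Ck_on_const])
  have "chart_range c \<subseteq> ?O1 \<union> ?O2"
    by (auto simp: overlap_def chart_cball_def)
  then show "Ck_on 1 (chart_range c) (\<lambda>x. chart_bump c0 x0 r (chart_inv c x))"
    by (rule Ck_on_subset[OF Ck_on_Un[OF o1 o2 1 2]])
qed

end

text \<open>\<Theta> stands for a form of degree one less than the dimension whose exterior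
  derivative vanishes nowhere. The sort \<open>wellorder\<close> is the one under which the change
  of variables is stated.\<close>

locale exact_top_form = smooth_atlas M A for M :: "'a topology" and A :: "('a, 'n::{finite,wellorder}) chart set" +
  fixes \<Theta> :: "('a, 'n) chart \<Rightarrow> (real, 'n) vec \<Rightarrow> (real, 'n) vec mform" and k :: nat
  assumes fam: "form_family 1 k \<Theta>" and k: "Suc k = CARD('n)" and compact: "compact_space M"
    and nonzero: "\<And>c x. c \<in> A \<Longrightarrow> x \<in> chart_range c \<Longrightarrow> \<exists>vs. length vs = Suc k \<and> local_ext_deriv (\<Theta> c) x vs \<noteq> 0"
begin

section \<open>The density attached to an exact top form\<close>

definition ix :: "'n list" where
  "ix = (SOME xs. distinct xs \<and> set xs = UNIV)"

definition frame :: "((real, 'n) vec) list" where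
  "frame = map (\<lambda>i. axis i 1) ix"

lemma ix: "distinct ix" "set ix = UNIV" "length ix = Suc k"
proof -
  have "\<exists>xs :: 'n list. distinct xs \<and> set xs = UNIV"
    using finite_distinct_list[of "UNIV :: 'n set"] by auto
  then have "distinct ix \<and> set ix = UNIV" unfolding ix_def by (rule someI_ex)
  then show "distinct ix" "set ix = UNIV" "length ix = Suc k"
    using distinct_card[of ix] k by auto
qed

lemma length_frame: "length frame = Suc k"
  by (simp add: frame_def ix)

lemma top_form_change:
  assumes "form_family j (Suc k) \<Psi>" and c: "c \<in> A" "c' \<in> A" "x \<in> overlap c c'"
  shows "\<Psi> c x frame = det (matrix (jac c c' x)) * \<Psi> c' (transition c c' x) frame"
proof -
  have "transition c c' x \<in> chart_range c'"
    using transition_in[OF c] overlap_subset by blast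
  then have "\<Psi> c' (transition c c' x) (map (\<lambda>i. jac c c' x (axis i 1)) ix)
      = det (matrix (jac c c' x)) * \<Psi> c' (transition c c' x) (map (\<lambda>i. axis i 1) ix)"
    by (rule alt_top_linear[OF form_family_alt[OF assms(1) c(2)] ix jac_linear[OF c]])
  then show ?thesis
    using form_family_change[OF assms(1) c length_frame] by (simp add: frame_def o_def)
qed

definition N :: "('a, 'n) chart \<Rightarrow> (real, 'n) vec \<Rightarrow> real" where
  "N c x = local_ext_deriv (\<Theta> c) x frame"

definition cut :: "('a \<Rightarrow> real) \<Rightarrow> ('a, 'n) chart \<Rightarrow> (real, 'n) vec \<Rightarrow> (real, 'n) vec mform" where
  "cut \<rho> c y us = \<rho> (chart_inv c y) * \<Theta> c y us"

definition T :: "('a \<Rightarrow> real) \<Rightarrow> ('a, 'n) chart \<Rightarrow> (real, 'n) vec \<Rightarrow> real" where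
  "T \<rho> c x = local_ext_deriv (cut \<rho> c) x frame"

text \<open>Multiplying by the sign of \<open>N\<close> turns the top form \<open>d(\<rho>\<Theta>)\<close> into a density, which transforms by
  the absolute value of the Jacobian determinant.\<close>

definition W :: "('a \<Rightarrow> real) \<Rightarrow> ('a, 'n) chart \<Rightarrow> (real, 'n) vec \<Rightarrow> real" where
  "W \<rho> c x = T \<rho> c x * (N c x / \<bar>N c x\<bar>)"

lemma fam_d: "form_family 0 (Suc k) (\<lambda>c. local_ext_deriv (\<Theta> c))"
  by (rule form_family_ext_deriv) (use fam in simp)

lemma fam_cut: "Ck_function 1 \<rho> \<Longrightarrow> form_family 1 k (cut \<rho>)"
  using form_family_scale[OF _ fam] by (simp add: cut_def[abs_def])

lemma fam_d_cut: "Ck_function 1 \<rho> \<Longrightarrow> form_family 0 (Suc k) (\<lambda>c. local_ext_deriv (cut \<rho> c))"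
  by (rule form_family_ext_deriv) (use fam_cut in simp)

text \<open>A top form that vanishes on the coordinate frame vanishes on every list.\<close>

lemma N_nonzero:
  assumes "c \<in> A" "x \<in> chart_range c"
  shows "N c x \<noteq> 0"
proof
  assume "N c x = 0"
  moreover obtain vs where vs: "length vs = Suc k" "local_ext_deriv (\<Theta> c) x vs \<noteq> 0"
    using nonzero[OF assms] by blast
  ultimately show False
    using alt_eq_0[OF form_family_alt[OF fam_d assms] ix _ vs(1)] by (simp add: N_def frame_def)
qed

lemma N_continuous: "c \<in> A \<Longrightarrow> continuous_on (chart_range c) (N c)"
  using form_family_Ck[OF fam_d _ length_frame] by (simp add: N_def[abs_def])

lemma T_continuous: "Ck_function 1 \<rho> \<Longrightarrow> c \<in> A \<Longrightarrow> continuous_on (chart_range c) (T \<rho> c)"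
  using form_family_Ck[OF fam_d_cut _ length_frame] by (simp add: T_def[abs_def])

lemma W_continuous: "Ck_function 1 \<rho> \<Longrightarrow> c \<in> A \<Longrightarrow> continuous_on (chart_range c) (W \<rho> c)"
  unfolding W_def by (intro continuous_on_mult continuous_on_divide continuous_on_rabs T_continuous N_continuous)
    (use N_nonzero in auto)

text \<open>T and N are both multiplied by the Jacobian determinant d, so W acquires d times the
  sign of d, which is |d|, whether or not the transition map preserves orientation.\<close>

lemma W_change:
  assumes \<rho>: "Ck_function 1 \<rho>" and c: "c \<in> A" "c' \<in> A" "x \<in> overlap c c'"
  shows "W \<rho> c x = \<bar>det (matrix (jac c c' x))\<bar> * W \<rho> c' (transition c c' x)"
proof -
  define d where "d = det (matrix (jac c c' x))"
  have T: "T \<rho> c x = d * T \<rho> c' (transition c c' x)"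
    using top_form_change[OF fam_d_cut[OF \<rho>] c] by (simp add: T_def d_def)
  have N: "N c x = d * N c' (transition c c' x)"
    using top_form_change[OF fam_d c] by (simp add: N_def d_def)
  have "x \<in> chart_range c" using c overlap_subset by blast
  then have "d \<noteq> 0" using N N_nonzero[OF c(1)] by auto
  moreover have "d * d = \<bar>d\<bar> * \<bar>d\<bar>" by simp
  ultimately show ?thesis
    unfolding W_def T N d_def[symmetric] by (simp add: abs_mult divide_simps)
qed

lemma T_zero:
  assumes "c \<in> A" "x \<in> chart_range c" and K: "closedin M K" "chart_inv c x \<notin> K"
    and \<rho>: "\<And>p. p \<in> topspace M \<Longrightarrow> p \<notin> K \<Longrightarrow> \<rho> p = 0"
  shows "T \<rho> c x = 0"
proof -
  have "T \<rho> c x = local_ext_deriv (\<lambda>y us. 0) x frame"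
    unfolding T_def
  proof (rule local_ext_deriv_cong[OF chart_complement_open[OF assms(1) K(1)] chart_complementI[OF assms(2) K(2)] _ length_frame])
    fix y us assume "y \<in> chart_map c ` (chart_dom c - K)"
    then obtain q where q: "q \<in> chart_dom c" "q \<notin> K" "y = chart_map c q" by blast
    then show "cut \<rho> c y us = 0"
      using \<rho>[of q] chart_dom_subset[OF assms(1)] assms(1) by (auto simp: cut_def)
  qed
  then show ?thesis by (simp add: local_ext_deriv_def frechet_derivative_const)
qed

text \<open>The functions \<rho>_i are summed before differentiating, and the sum of the forms
  \<rho>_i \<Theta> is \<Theta> itself; no derivative of a cutoff has to be computed.\<close>

lemma T_sum:
  assumes "finite I" and \<rho>: "\<And>i. i \<in> I \<Longrightarrow> Ck_function 1 (\<rho> i)" and one: "\<And>p. p \<in> topspace M \<Longrightarrow> (\<Sum>i\<in>I. \<rho> i p) = 1"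
    and c: "c \<in> A" "x \<in> chart_range c"
  shows "(\<Sum>i\<in>I. T (\<rho> i) c x) = N c x"
proof -
  have "diff_form_at k (cut (\<rho> i) c) x" if "i \<in> I" for i
    by (rule form_family_diff[OF _ c]) (use fam_cut[OF \<rho>[OF that]] in simp)
  then have "(\<Sum>i\<in>I. T (\<rho> i) c x) = local_ext_deriv (\<lambda>y vs. \<Sum>i\<in>I. cut (\<rho> i) c y vs) x frame"
    unfolding T_def by (rule local_ext_deriv_sum[OF assms(1) _ length_frame, symmetric])
  also have "\<dots> = N c x"
    unfolding N_def
  proof (rule local_ext_deriv_cong[OF chart_range_open[OF c(1)] c(2) _ length_frame])
    fix y vs assume "y \<in> chart_range c"
    then show "(\<Sum>i\<in>I. cut (\<rho> i) c y vs) = \<Theta> c y vs"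
      using one[OF chart_inv_topspace[OF c(1)]] by (simp add: cut_def sum_distrib_right[symmetric])
  qed
  finally show ?thesis .
qed

text \<open>Stokes in one chart: the coefficient of d(\<rho>\<Theta>) is a signed sum of directional
  derivatives of functions supported in the ball, each of integral 0.\<close>

lemma T_has_integral:
  assumes \<rho>: "Ck_function 1 \<rho>" and c: "c \<in> A" "cball x0 r \<subseteq> chart_range c"
    and zero: "\<And>p. p \<in> topspace M \<Longrightarrow> p \<notin> chart_cball c x0 r \<Longrightarrow> \<rho> p = 0"
  shows "(T \<rho> c has_integral 0) (cball x0 r)"
proof -
  define us where "us i = take i frame @ drop (Suc i) frame" for i
  \<comment> \<open>Extension by zero to the whole space. The chart range and the complement of the
    ball are open and cover it, and on the latter F i is 0.\<close>
  define F where "F i y = (if y \<in> chart_range c then cut \<rho> c y (us i) else 0)" for i y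
  note op = chart_range_open[OF c(1)]
  have z: "cut \<rho> c y vs = 0" if y: "y \<in> chart_range c" "y \<notin> cball x0 r" for y vs
  proof -
    have "chart_inv c y \<notin> chart_cball c x0 r" using y by (simp add: chart_cball_def)
    then show ?thesis using zero[OF chart_inv_topspace[OF c(1) y(1)]] by (simp add: cut_def)
  qed
  have len: "length (us i) = k" if "i < Suc k" for i
    using that length_frame by (simp add: us_def)
  have F: "Ck_on 1 UNIV (F i)" if i: "i < Suc k" for i
  proof -
    have "Ck_on 1 (chart_range c) (F i)"
      using form_family_Ck[OF fam_cut[OF \<rho>] c(1) len[OF i]] Ck_on_cong[OF op, of "F i" "\<lambda>y. cut \<rho> c y (us i)" 1]
      by (simp add: F_def)
    moreover have "Ck_on 1 (- cball x0 r) (F i) \<longleftrightarrow> Ck_on 1 (- cball x0 r) (\<lambda>_. 0 :: real)"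
      by (rule Ck_on_cong) (use z in \<open>auto simp: F_def\<close>)
    then have "Ck_on 1 (- cball x0 r) (F i)" using Ck_on_const by blast
    ultimately have "Ck_on 1 (chart_range c \<union> - cball x0 r) (F i)"
      by (intro Ck_on_Un op) auto
    moreover have "chart_range c \<union> - cball x0 r = UNIV" using c(2) by blast
    ultimately show ?thesis by simp
  qed
  have "((\<lambda>x. \<Sum>i<Suc k. (-1) ^ i * fderiv (F i) x (frame ! i)) has_integral (\<Sum>i<Suc k. (-1) ^ i * 0)) (cball x0 r)"
  proof (intro has_integral_sum finite_lessThan has_integral_mult_right has_integral_frechet_derivative_0)
    fix i y assume "i \<in> {..<Suc k}"
    then show "Ck_on 1 UNIV (F i)" using F by blast
    show "F i y = 0" if "y \<notin> cball x0 r" using z that by (simp add: F_def)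
  qed
  moreover have "(\<Sum>i<Suc k. (-1) ^ i * fderiv (F i) x (frame ! i)) = T \<rho> c x" if "x \<in> cball x0 r" for x
    unfolding T_def local_ext_deriv_def length_frame
  proof (rule sum.cong[OF refl])
    fix i
    have "fderiv (F i) x = fderiv (\<lambda>y. cut \<rho> c y (take i frame @ drop (Suc i) frame)) x"
      by (rule frechet_derivative_cong_open[OF op]) (use that c(2) in \<open>auto simp: F_def us_def\<close>)
    then show "(-1) ^ i * fderiv (F i) x (frame ! i)
      = (-1) ^ i * fderiv (\<lambda>y. cut \<rho> c y (take i frame @ drop (Suc i) frame)) x (frame ! i)"
      by simp
  qed
  ultimately show ?thesis
    using has_integral_cong[of "cball x0 r"] by (metis (no_types, lifting) mult_zero_right sum.neutral)
qed

text \<open>N is continuous and nonzero on a connected ball, so its sign is constant there and W is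
  a constant multiple of T.\<close>

lemma W_integral:
  assumes \<rho>: "Ck_function 1 \<rho>" and c: "c \<in> A" "cball x0 r \<subseteq> chart_range c"
    and zero: "\<And>p. p \<in> topspace M \<Longrightarrow> p \<notin> chart_cball c x0 r \<Longrightarrow> \<rho> p = 0"
  shows "integral (cball x0 r) (W \<rho> c) = 0"
proof (cases "cball x0 r = {}")
  case False
  have sgn: "N c x / \<bar>N c x\<bar> = N c x0 / \<bar>N c x0\<bar>" if x: "x \<in> cball x0 r" for x
  proof -
    have conn: "connected (N c ` cball x0 r)"
      using continuous_on_subset[OF N_continuous[OF c(1)] c(2)] by (intro connected_continuous_image) auto
    have no_zero: "0 \<notin> N c ` cball x0 r"
    proof
      assume "0 \<in> N c ` cball x0 r"
      then obtain z where "N c z = 0" "z \<in> cball x0 r" by (elim imageE) simp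
      then show False using N_nonzero[OF c(1) subsetD[OF c(2)], of z] by simp
    qed
    have im: "N c x \<in> N c ` cball x0 r" "N c x0 \<in> N c ` cball x0 r" using x False by auto
    have "\<not> (N c x \<le> 0 \<and> 0 \<le> N c x0)" "\<not> (N c x0 \<le> 0 \<and> 0 \<le> N c x)"
      using connectedD_interval[OF conn im, of 0] connectedD_interval[OF conn im(2,1), of 0] no_zero by argo+
    then consider "N c x > 0" "N c x0 > 0" | "N c x < 0" "N c x0 < 0" by linarith
    then show ?thesis by cases simp_all
  qed
  have "integral (cball x0 r) (W \<rho> c) = integral (cball x0 r) (\<lambda>x. T \<rho> c x * (N c x0 / \<bar>N c x0\<bar>))"
    by (rule integral_cong) (simp only: W_def sgn)
  also have "\<dots> = 0 * (N c x0 / \<bar>N c x0\<bar>)"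
    by (rule integral_unique[OF has_integral_mult_left[OF T_has_integral[OF assms]]])
  finally show ?thesis by simp
qed simp

text \<open>The integrand is 0 outside the intersection of the two closed chart balls: h vanishes
  off the second, and W \<rho> off the first. The image S of the intersection is compact, and the
  transition map carries it injectively to the other chart.\<close>

lemma W_integral_change:
  assumes \<rho>: "Ck_function 1 \<rho>" and h: "Ck_function 1 h"
    and c: "c \<in> A" "cball x r \<subseteq> chart_range c" and c': "c' \<in> A" "cball x' r' \<subseteq> chart_range c'"
    and \<rho>0: "\<And>p. p \<in> topspace M \<Longrightarrow> p \<notin> chart_cball c x r \<Longrightarrow> \<rho> p = 0"
    and h0: "\<And>p. p \<in> topspace M \<Longrightarrow> p \<notin> chart_cball c' x' r' \<Longrightarrow> h p = 0"
  shows "integral (cball x r) (\<lambda>y. h (chart_inv c y) * W \<rho> c y)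
    = integral (cball x' r') (\<lambda>y. h (chart_inv c' y) * W \<rho> c' y)"
proof -
  let ?K = "chart_cball c x r \<inter> chart_cball c' x' r'"
  let ?F = "transition c c'"
  define S where "S = chart_map c ` ?K"
  have Ksub: "?K \<subseteq> chart_dom c \<inter> chart_dom c'" by (auto simp: chart_cball_def)
  then have Sov: "S \<subseteq> overlap c c'" unfolding S_def overlap_def by (rule image_mono)
  have FS: "?F ` S = chart_map c' ` ?K"
    unfolding S_def image_image using Ksub c(1) by (intro image_cong refl) (auto simp: transition_eq)
  have inv_K: "y \<in> S \<longleftrightarrow> chart_inv c y \<in> ?K" if "y \<in> chart_range c" for y
    using that c(1) unfolding S_def by (auto simp: chart_cball_def intro!: image_eqI[of _ _ "chart_inv c y"])
  have inv_K': "y \<in> ?F ` S \<longleftrightarrow> chart_inv c' y \<in> ?K" if "y \<in> chart_range c'" for y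
    using that c'(1) unfolding FS by (auto simp: chart_cball_def intro!: image_eqI[of _ _ "chart_inv c' y"])
  have Ssub: "S \<subseteq> cball x r" unfolding S_def by (auto simp: chart_cball_def)
  have FSsub: "?F ` S \<subseteq> cball x' r'" unfolding FS by (auto simp: chart_cball_def)
  have compS: "compact S"
  proof -
    have "compactin M ?K"
      by (rule closedin_compact_space[OF compact closedin_Int[OF chart_cball_closed[OF c] chart_cball_closed[OF c']]])
    then have "compactin (subtopology M (chart_dom c)) ?K"
      using Ksub by (auto simp: compactin_subtopology)
    then have "compactin (top_of_set (chart_range c)) S"
      unfolding S_def using homeomorphic_map_compactness_eq[OF chart_homeomorphic[OF c(1)]] by blast
    then show ?thesis by (simp add: compactin_subtopology)
  qed
  have hcont: "continuous_on (chart_range d) (\<lambda>y. h (chart_inv d y) * W \<rho> d y)" if "d \<in> A" for d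
    by (intro continuous_on_mult W_continuous[OF \<rho> that] Ck_on_continuous[OF Ck_functionD[OF h that]])
  have "integral (cball x r) (\<lambda>y. h (chart_inv c y) * W \<rho> c y) = integral S (\<lambda>y. h (chart_inv c y) * W \<rho> c y)"
  proof -
    have "h (chart_inv c y) * W \<rho> c y = (if y \<in> S then h (chart_inv c y) * W \<rho> c y else 0)" if y: "y \<in> cball x r" for y
    proof (cases "y \<in> S")
      case False
      have y': "y \<in> chart_range c" using y c(2) by blast
      have "chart_inv c y \<in> chart_cball c x r" using y y' by (simp add: chart_cball_def chart_inv_in)
      then have "chart_inv c y \<notin> chart_cball c' x' r'" using False inv_K[OF y'] by blast
      then show ?thesis using h0[OF chart_inv_topspace[OF c(1) y']] by simp
    qed simp
    then have "integral (cball x r) (\<lambda>y. h (chart_inv c y) * W \<rho> c y)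
        = integral (cball x r) (\<lambda>y. if y \<in> S then h (chart_inv c y) * W \<rho> c y else 0)"
      by (rule integral_cong)
    then show ?thesis
      using Ssub by (simp add: integral_restrict_Int Int_absorb2)
  qed
  also have "\<dots> = integral S (\<lambda>y. \<bar>det (matrix (jac c c' y))\<bar> * (h (chart_inv c' (?F y)) * W \<rho> c' (?F y)))"
  proof (rule integral_cong)
    fix y assume "y \<in> S"
    then have y: "y \<in> overlap c c'" using Sov by blast
    show "h (chart_inv c y) * W \<rho> c y = \<bar>det (matrix (jac c c' y))\<bar> * (h (chart_inv c' (?F y)) * W \<rho> c' (?F y))"
      using W_change[OF \<rho> c(1) c'(1) y] transition_inv[OF c'(1) c(1) y] by simp
  qed
  also have "\<dots> = integral (?F ` S) (\<lambda>y. h (chart_inv c' y) * W \<rho> c' y)"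
  proof (rule integral_change_of_variables_compact[OF compS, symmetric])
    show "(?F has_derivative jac c c' y) (at y)" if "y \<in> S" for y
      by (rule jac_has_derivative[OF c(1) c'(1)]) (use that Sov in blast)
    show "inj_on ?F S"
    proof (rule inj_onI)
      fix y z assume "y \<in> S" "z \<in> S" "?F y = ?F z"
      then have "chart_inv c y = chart_inv c z" and "y \<in> chart_range c" "z \<in> chart_range c"
        using transition_inv[OF c'(1) c(1)] Sov overlap_subset by (metis subsetD)+
      then show "y = z" by (metis chart_map_inv)
    qed
    show "continuous_on (?F ` S) (\<lambda>y. h (chart_inv c' y) * W \<rho> c' y)"
      by (rule continuous_on_subset[OF hcont[OF c'(1)]]) (use FSsub c'(2) in blast)
  qed
  also have "\<dots> = integral (cball x' r') (\<lambda>y. h (chart_inv c' y) * W \<rho> c' y)"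
  proof -
    have "h (chart_inv c' y) * W \<rho> c' y = (if y \<in> ?F ` S then h (chart_inv c' y) * W \<rho> c' y else 0)" if y: "y \<in> cball x' r'" for y
    proof (cases "y \<in> ?F ` S")
      case False
      have y': "y \<in> chart_range c'" using y c'(2) by blast
      have "chart_inv c' y \<in> chart_cball c' x' r'" using y y' by (simp add: chart_cball_def chart_inv_in)
      then have "chart_inv c' y \<notin> chart_cball c x r" using False inv_K'[OF y'] by blast
      then have "W \<rho> c' y = 0"
        using T_zero[OF c'(1) y' chart_cball_closed[OF c] _ \<rho>0] by (simp add: W_def)
      then show ?thesis by simp
    qed simp
    then have "integral (cball x' r') (\<lambda>y. h (chart_inv c' y) * W \<rho> c' y)
        = integral (cball x' r') (\<lambda>y. if y \<in> ?F ` S then h (chart_inv c' y) * W \<rho> c' y else 0)"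
      by (rule integral_cong)
    then show ?thesis
      using FSsub by (simp add: integral_restrict_Int Int_absorb2)
  qed
  finally show ?thesis .
qed

end

section \<open>The contradiction from a finite partition of unity\<close>

context exact_top_form
begin

lemma manifold_empty: "topspace M = {}"
proof (rule ccontr)
  assume nonempty: "topspace M \<noteq> {}"
  have "\<exists>c r. c \<in> A \<and> p \<in> chart_dom c \<and> r > 0 \<and> cball (chart_map c p) r \<subseteq> chart_range c" if p: "p \<in> topspace M" for p
  proof -
    obtain c where c: "c \<in> A" "p \<in> chart_dom c" using chart_cover[OF p] by blast
    then have "chart_map c p \<in> chart_range c" by blast
    then obtain r where "r > 0" "cball (chart_map c p) r \<subseteq> chart_range c"
      using open_contains_cball chart_range_open[OF c(1)] by blast
    then show ?thesis using c by blast
  qed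
  then obtain cc rr where cc: "\<And>p. p \<in> topspace M \<Longrightarrow> cc p \<in> A"
    and dom: "\<And>p. p \<in> topspace M \<Longrightarrow> p \<in> chart_dom (cc p)"
    and rr: "\<And>p. p \<in> topspace M \<Longrightarrow> rr p > 0"
    and sub: "\<And>p. p \<in> topspace M \<Longrightarrow> cball (chart_map (cc p) p) (rr p) \<subseteq> chart_range (cc p)"
    by metis
  define xx where "xx p = chart_map (cc p) p" for p
  define U where "U p = {q \<in> chart_dom (cc p). chart_map (cc p) q \<in> ball (xx p) (rr p)}" for p
  have "openin M (U p)" "p \<in> U p" if "p \<in> topspace M" for p
    using chart_vimage_open[OF cc[OF that] open_ball] dom[OF that] rr[OF that] by (auto simp: U_def xx_def)
  then have "(\<forall>V\<in>U ` topspace M. openin M V) \<and> topspace M \<subseteq> \<Union>(U ` topspace M)" by blast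
  then obtain \<F> where \<F>: "finite \<F>" "\<F> \<subseteq> U ` topspace M" "topspace M \<subseteq> \<Union>\<F>"
    using compact unfolding compact_space_def compactin_def by metis
  then obtain I where I: "finite I" "I \<subseteq> topspace M" "\<F> = U ` I"
    using finite_subset_image by metis
  define b where "b p = chart_bump (cc p) (xx p) (rr p)" for p
  define B where "B q = (\<Sum>p\<in>I. b p q)" for q
  define \<rho> where "\<rho> p q = b p q * inverse (B q)" for p q
  have chart: "cc p \<in> A" "cball (xx p) (rr p) \<subseteq> chart_range (cc p)" "rr p > 0" if "p \<in> I" for p
    unfolding xx_def using cc sub rr subsetD[OF I(2) that] by blast+
  have b_nonneg: "b p q \<ge> 0" for p q
    by (simp add: b_def chart_bump_def bump_nonneg)
  have b_pos: "b p q > 0" if "p \<in> I" "q \<in> U p" for p q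
  proof -
    have "q \<in> chart_dom (cc p)" "chart_map (cc p) q \<in> ball (xx p) (rr p)" using that(2) by (auto simp: U_def)
    then show ?thesis using bump_pos_iff[OF chart(3)[OF that(1)], of "xx p" "chart_map (cc p) q"] by (simp only: b_def chart_bump_def if_True)
  qed
  have B_pos: "B q > 0" if q: "q \<in> topspace M" for q
  proof -
    obtain p where "p \<in> I" "q \<in> U p" using \<F>(3) I(3) q by blast
    then show ?thesis
      unfolding B_def using b_pos b_nonneg I(1) by (intro sum_pos2[of I p]) auto
  qed
  have b_Ck: "Ck_function 1 (b p)" if "p \<in> I" for p
    unfolding b_def by (rule Ck_function_chart_bump[OF chart[OF that]])
  have "Ck_function 1 B"
    unfolding B_def by (rule Ck_function_sum[OF b_Ck])
  then have "Ck_function 1 (\<lambda>q. inverse (B q))"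
    by (rule Ck_function_inverse) (use B_pos in force)
  then have \<rho>_Ck: "Ck_function 1 (\<rho> p)" if "p \<in> I" for p
    unfolding \<rho>_def by (rule Ck_function_mult[OF b_Ck[OF that]])
  have \<rho>_sum: "(\<Sum>p\<in>I. \<rho> p q) = 1" if "q \<in> topspace M" for q
    using B_pos[OF that] by (simp add: \<rho>_def B_def sum_distrib_right[symmetric])
  have \<rho>_nonneg: "\<rho> p q \<ge> 0" if "q \<in> topspace M" for p q
    using B_pos[OF that] b_nonneg by (simp add: \<rho>_def)
  have \<rho>_zero: "\<rho> p q = 0" if "p \<in> I" "q \<in> topspace M" "q \<notin> chart_cball (cc p) (xx p) (rr p)" for p q
  proof -
    have "b p q = 0"
    proof (cases "q \<in> chart_dom (cc p)")
      case True
      then have "chart_map (cc p) q \<notin> ball (xx p) (rr p)"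
        using that(3) by (auto simp: chart_cball_def)
      then have "\<not> bump (xx p) (rr p) (chart_map (cc p) q) > 0"
        using bump_pos_iff[OF chart(3)[OF that(1)], of "xx p" "chart_map (cc p) q"] by blast
      then show ?thesis
        using bump_nonneg[of "xx p" "rr p" "chart_map (cc p) q"] by (simp add: b_def chart_bump_def True)
    qed (simp add: b_def chart_bump_def)
    then show ?thesis by (simp add: \<rho>_def)
  qed
  \<comment> \<open>J and J' are the same quantity, computed in the chart of i and in the chart of
    j. Summing J over j removes \<rho>_j and leaves an integral that is 0 by Stokes; summing J' over
    i removes the cutoff inside the derivative.\<close>
  define J where "J i j = integral (cball (xx i) (rr i)) (\<lambda>x. \<rho> j (chart_inv (cc i) x) * W (\<rho> i) (cc i) x)" for i j
  define J' where "J' i j = integral (cball (xx j) (rr j)) (\<lambda>x. \<rho> j (chart_inv (cc j) x) * W (\<rho> i) (cc j) x)" for i j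
  have cont: "continuous_on (cball (xx l) (rr l)) (\<lambda>x. \<rho> j (chart_inv (cc l) x) * W (\<rho> i) (cc l) x)"
    if "i \<in> I" "j \<in> I" "l \<in> I" for i j l
    by (rule continuous_on_subset[OF continuous_on_mult[OF Ck_on_continuous[OF Ck_functionD[OF \<rho>_Ck[OF that(2)] chart(1)[OF that(3)]]]
            W_continuous[OF \<rho>_Ck[OF that(1)] chart(1)[OF that(3)]]] chart(2)[OF that(3)]])
  have int: "(\<lambda>x. \<rho> j (chart_inv (cc l) x) * W (\<rho> i) (cc l) x) integrable_on cball (xx l) (rr l)"
    if "i \<in> I" "j \<in> I" "l \<in> I" for i j l
    using integrable_on_compact_continuous[OF compact_cball cont[OF that]] by (rule set_lebesgue_integral_eq_integral)
  have "(\<Sum>j\<in>I. J i j) = 0" if i: "i \<in> I" for i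
  proof -
    have "(\<Sum>j\<in>I. J i j) = integral (cball (xx i) (rr i)) (\<lambda>x. \<Sum>j\<in>I. \<rho> j (chart_inv (cc i) x) * W (\<rho> i) (cc i) x)"
      unfolding J_def by (rule integral_sum[OF I(1) int[OF i _ i], symmetric])
    also have "\<dots> = integral (cball (xx i) (rr i)) (W (\<rho> i) (cc i))"
    proof (rule integral_cong)
      fix x assume "x \<in> cball (xx i) (rr i)"
      then have "chart_inv (cc i) x \<in> topspace M"
        using chart[OF i] chart_inv_topspace by blast
      then show "(\<Sum>j\<in>I. \<rho> j (chart_inv (cc i) x) * W (\<rho> i) (cc i) x) = W (\<rho> i) (cc i) x"
        by (simp add: sum_distrib_right[symmetric] \<rho>_sum)
    qed
    also have "\<dots> = 0"
      by (rule W_integral[OF \<rho>_Ck[OF i] chart(1,2)[OF i] \<rho>_zero[OF i]])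
    finally show ?thesis .
  qed
  then have zero: "(\<Sum>i\<in>I. \<Sum>j\<in>I. J i j) = 0" by simp
  have JJ': "J i j = J' i j" if "i \<in> I" "j \<in> I" for i j
    unfolding J_def J'_def
    by (rule W_integral_change[OF \<rho>_Ck[OF that(1)] \<rho>_Ck[OF that(2)] chart(1,2)[OF that(1)] chart(1,2)[OF that(2)]
          \<rho>_zero[OF that(1)] \<rho>_zero[OF that(2)]])
  have pos: "(\<Sum>i\<in>I. J' i j) > 0" if j: "j \<in> I" for j
  proof -
    let ?w = "\<lambda>x. \<Sum>i\<in>I. \<rho> j (chart_inv (cc j) x) * W (\<rho> i) (cc j) x"
    \<comment> \<open>Summed over i the coefficients T give N, so the densities give N times its own
      sign, that is |N|.\<close>
    have w: "?w x = \<rho> j (chart_inv (cc j) x) * \<bar>N (cc j) x\<bar>" if x: "x \<in> chart_range (cc j)" for x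
    proof -
      have "(\<Sum>i\<in>I. T (\<rho> i) (cc j) x) = N (cc j) x"
        by (rule T_sum[OF I(1) \<rho>_Ck \<rho>_sum chart(1)[OF j] x])
      then have "(\<Sum>i\<in>I. W (\<rho> i) (cc j) x) = N (cc j) x * (N (cc j) x / \<bar>N (cc j) x\<bar>)"
        by (simp only: W_def sum_distrib_right[symmetric])
      also have "\<dots> = \<bar>N (cc j) x\<bar>" by (simp add: abs_if)
      finally show ?thesis by (simp add: sum_distrib_left[symmetric])
    qed
    have "(\<Sum>i\<in>I. J' i j) = integral (cball (xx j) (rr j)) ?w"
      unfolding J'_def by (rule integral_sum[OF I(1) int[OF _ j j], symmetric])
    also have "\<dots> > 0"
    proof (rule integral_pos_continuous)
      show "continuous_on (cball (xx j) (rr j)) ?w"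
        by (rule continuous_on_sum[OF cont[OF _ j j]])
      fix x assume "x \<in> cball (xx j) (rr j)"
      then have "x \<in> chart_range (cc j)" using chart(2)[OF j] by blast
      then show "?w x \<ge> 0"
        using w \<rho>_nonneg chart_inv_topspace[OF chart(1)[OF j]] by simp
    next
      have jM: "j \<in> topspace M" using j I(2) by blast
      have inv: "chart_inv (cc j) (xx j) = j" using chart(1)[OF j] dom[OF jM] by (simp add: xx_def)
      have x: "xx j \<in> chart_range (cc j)" using dom[OF jM] by (simp add: xx_def)
      have "j \<in> U j" using dom[OF jM] chart(3)[OF j] by (simp add: U_def xx_def)
      then have "\<rho> j j > 0" using b_pos[OF j] B_pos[OF jM] by (simp add: \<rho>_def)
      then show "?w (xx j) > 0"
        using w[OF x] N_nonzero[OF chart(1)[OF j] x] inv by simp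
    qed (rule chart(3)[OF j])
    finally show ?thesis .
  qed
  have "I \<noteq> {}" using \<F>(3) I(3) nonempty by blast
  then have "0 < (\<Sum>j\<in>I. \<Sum>i\<in>I. J' i j)"
    by (rule sum_pos[OF I(1) _ pos])
  also have "\<dots> = (\<Sum>i\<in>I. \<Sum>j\<in>I. J i j)"
    by (subst sum.swap) (intro sum.cong refl JJ'[symmetric])
  finally show False using zero by simp
qed

end

context contact_G2_manifold
begin

section \<open>The case of closed \<phi>\<close>

definition \<Theta> :: "('a, 7) chart \<Rightarrow> real ^ 7 \<Rightarrow> (real ^ 7) mform" where
  "\<Theta> c x = wedge 1 5 (local_form A c \<beta> x) (wedge 2 3 (local_ext_deriv (local_form A c \<beta>) x) (local_form A c \<phi> x))"

lemma form_family_local_d\<beta>: "form_family j 2 (\<lambda>c. local_ext_deriv (local_form A c \<beta>))"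
  using form_family_ext_deriv[OF form_family_local_form[OF \<beta>_smooth]] by (simp add: numeral_2_eq_2)

lemma form_family_d\<beta>_\<phi>: "form_family j 5 (\<lambda>c x. wedge 2 3 (local_ext_deriv (local_form A c \<beta>) x) (local_form A c \<phi> x))"
  using form_family_wedge[OF form_family_local_d\<beta> form_family_local_form[OF \<phi>_smooth]] by simp

lemma form_family_\<Theta>: "form_family j 6 \<Theta>"
  using form_family_wedge[OF form_family_local_form[OF \<beta>_smooth] form_family_d\<beta>_\<phi>] by (simp add: \<Theta>_def[abs_def])

text \<open>The Leibniz rule is applied twice. By d(d\<beta>) = 0 and d\<phi> = 0 the factor
  d\<beta> \<and> \<phi> is closed, so only the derivative of the leading \<beta> remains.\<close>

lemma local_ext_deriv_\<Theta>:
  assumes closed: "form_eq M A 4 (ext_deriv A \<phi>) (\<lambda>p vs. 0)" and c: "c \<in> A" and x: "x \<in> chart_range c" and vs: "length vs = 7"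
  shows "local_ext_deriv (\<Theta> c) x vs
    = wedge 2 5 (local_ext_deriv (local_form A c \<beta>) x) (wedge 2 3 (local_ext_deriv (local_form A c \<beta>) x) (local_form A c \<phi> x)) vs"
proof -
  let ?b = "local_form A c \<beta>" and ?db = "local_ext_deriv (local_form A c \<beta>)" and ?f = "local_form A c \<phi>"
  note S = chart_range_open[OF c] x
  note fb = form_family_local_form[OF \<beta>_smooth] and fd = form_family_local_d\<beta> and ff = form_family_local_form[OF \<phi>_smooth]
  define p where "p = chart_inv c x"
  have p: "p \<in> chart_dom c" "p \<in> topspace M" "chart_map c p = x"
    using x c chart_inv_in chart_inv_topspace by (simp_all add: p_def)
  have dd: "local_ext_deriv ?db x us = 0" if us: "length us = 3" for us
  proof -
    obtain u v w where "us = [u, v, w]" using us by (auto simp: numeral_3_eq_3 length_Suc_conv)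
    moreover have "Ck_on 2 (chart_range c) (\<lambda>y. ?b y [u])" for u
      by (rule form_family_Ck[OF fb c]) simp
    ultimately show ?thesis using local_ext_deriv_twice[OF S] by blast
  qed
  have d\<phi>: "local_ext_deriv ?f x us = 0" if us: "length us = 4" for us
  proof -
    have "local_ext_deriv ?f x us = ext_deriv A \<phi> p (map (chart_vec A c p) us)"
      using ext_deriv_local[OF ff c p(1), of us] us p(3) by simp
    also have "\<dots> = 0"
      using closed[unfolded form_eq_def, rule_format, OF p(2), of "map (chart_vec A c p) us"]
        chart_vec_tangent[OF c p(1)] us by auto
    finally show ?thesis .
  qed
  have d5: "local_ext_deriv (\<lambda>y. wedge 2 3 (?db y) (?f y)) x us = 0" if us: "length us = 6" for us
  proof -
    have "local_ext_deriv (\<lambda>y. wedge 2 3 (?db y) (?f y)) x us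
      = wedge (Suc 2) 3 (local_ext_deriv ?db x) (?f x) us + (-1) ^ 2 * wedge 2 (Suc 3) (?db x) (local_ext_deriv ?f x) us"
      using us
      by (intro local_ext_deriv_wedge[OF S] alt_skew form_family_alt[OF fd c] form_family_alt[OF ff c]
          form_family_diff[OF fd c x] form_family_diff[OF ff c x]) auto
    also have "wedge (Suc 2) 3 (local_ext_deriv ?db x) (?f x) us = wedge (Suc 2) 3 (\<lambda>_. 0) (?f x) us"
      by (rule wedge_cong) (use dd us in auto)
    also have "wedge 2 (Suc 3) (?db x) (local_ext_deriv ?f x) us = wedge 2 (Suc 3) (?db x) (\<lambda>_. 0) us"
      by (rule wedge_cong) (use d\<phi> us in auto)
    finally show ?thesis by (simp add: wedge_zero_left wedge_zero_right)
  qed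
  have "local_ext_deriv (\<lambda>y. wedge 1 5 (?b y) (wedge 2 3 (?db y) (?f y))) x vs
    = wedge (Suc 1) 5 (?db x) (wedge 2 3 (?db x) (?f x)) vs
      + (-1) ^ 1 * wedge 1 (Suc 5) (?b x) (local_ext_deriv (\<lambda>y. wedge 2 3 (?db y) (?f y)) x) vs"
    using vs
    by (intro local_ext_deriv_wedge[OF S] alt_skew form_family_alt[OF fb c] form_family_alt[OF form_family_d\<beta>_\<phi> c]
        form_family_diff[OF fb c x] form_family_diff[OF form_family_d\<beta>_\<phi> c x]) auto
  also have "wedge 1 (Suc 5) (?b x) (local_ext_deriv (\<lambda>y. wedge 2 3 (?db y) (?f y)) x) vs = wedge 1 (Suc 5) (?b x) (\<lambda>_. 0) vs"
    by (rule wedge_cong) (use d5 vs in auto)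
  finally show ?thesis by (simp add: wedge_zero_right \<Theta>_def[abs_def] numeral_2_eq_2)
qed

lemma compact_not_closed_form:
  assumes "compact_space M" "topspace M \<noteq> {}" and closed: "form_eq M A 4 (ext_deriv A \<phi>) (\<lambda>p vs. 0)"
  shows False
proof -
  have "exact_top_form M A \<Theta> 6"
  proof (unfold_locales)
    fix c x assume c: "c \<in> A" and x: "x \<in> chart_range c"
    have sk: "skew 2 (local_ext_deriv (local_form A c \<beta>) x)"
      by (rule alt_skew[OF form_family_alt[OF form_family_local_d\<beta> c x]])
    have "R (chart_inv c x) c \<noteq> 0"
      by (rule R_component_nonzero[OF c chart_inv_in[OF x]])
    from wedge_contraction_square_nonzero[OF local_G2_form[OF c x] form_family_alt[OF form_family_local_form[OF \<phi>_smooth] c x] this sk local_d\<beta>[OF c x]]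
    obtain vs where vs: "length vs = 7" "wedge 2 5 (local_ext_deriv (local_form A c \<beta>) x)
        (wedge 2 3 (local_ext_deriv (local_form A c \<beta>) x) (local_form A c \<phi> x)) vs \<noteq> 0"
      by metis
    then show "\<exists>vs. length vs = Suc 6 \<and> local_ext_deriv (\<Theta> c) x vs \<noteq> 0"
      using local_ext_deriv_\<Theta>[OF closed c x vs(1)] by (intro exI[of _ vs]) simp
  qed (simp_all add: form_family_\<Theta> assms)
  then show False
    using exact_top_form.manifold_empty assms(2) by blast
qed

end

text \<open>Nonemptiness enters in the last part because all conditions hold vacuously on the empty
  manifold, which is compact.\<close>

theorem theorem6p3:
  fixes M :: "'a topology" and A :: "('a, 7) chart set"
  assumes "smooth_manifold M A"
  shows "(\<forall>\<phi> R \<alpha> f g. contact_G2_structure M A \<phi> R \<alpha> f g \<longrightarrow>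
             contact_form M A \<alpha> \<and> A_compatible M A \<phi> (form_ker A \<alpha>)) \<and>
         (compact_space M \<and> topspace M \<noteq> {} \<longrightarrow>
             \<not> (\<exists>\<phi> R \<alpha> f g. contact_G2_structure M A \<phi> R \<alpha> f g \<and>
                   form_eq M A 4 (ext_deriv A \<phi>) (\<lambda>p vs. 0)))"
proof -
  have G2: "contact_G2_manifold M A \<phi> R \<alpha> f g" if "contact_G2_structure M A \<phi> R \<alpha> f g" for \<phi> R \<alpha> f g
    using assms that by (simp add: contact_G2_manifold_def contact_G2_manifold_axioms_def smooth_atlas_def)
  show ?thesis
    using contact_G2_manifold.contact_form_\<alpha>[OF G2] contact_G2_manifold.A_compatible_ker[OF G2]
      contact_G2_manifold.compact_not_closed_form[OF G2] by blast
qed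

end
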